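(* The fiber body of a zonoid is a zonoid. More precisely, let $X$ be a random vector in $\mathbb{R}^{n+m}$ with $\mathbb{E}\|X\|<\infty$, let $K:=K_0(X)$, and let $X_1,\dots,X_{n+1}$ be i.i.d. copies of $X$. Then $$\Sigma_\pi K=K_0\big(F_\pi(X_1,\dots,X_{n+1})\big),$$ i.e. for all $u\in W$, $h_{\Sigma_\pi K}(u)=\tfrac12\mathbb{E}|\langle u,Y\rangle|$ with $Y:=F_\pi(X_1,\dots,X_{n+1})\in W$.
   Context: A convex body is a non-empty compact convex subset of a real vector space; its support function is $h_L(u)=\max\{\langle u,x\rangle:x\in L\}$. For $x\in\mathbb{R}^{n+m}$ write $\underline{x}:=\tfrac12[-x,x]$ (segment). A zonotope is a finite Minkowski sum $\underline{x_1}+\dots+\underline{x_N}$; a zonoid is a Hausdorff limit of zonotopes. For a random vector $X$ with $\mathbb{E}\|X\|<\infty$, the Vitale zonoid $K_0(X)$ is the convex body with support function $h_{K_0(X)}(u)=\tfrac12\mathbb{E}|\langle u,X\rangle|$; it is known (Vitale) that a convex body is a zonoid iff it equals $K_0(X)$ for some such $X$. Let $V\subset\mathbb{R}^{n+m}$ be a linear subspace of dimension $n$, $W=V^\perp$, $\pi$ the orthogonal projection onto $V$. Fix an orthonormal basis of $V$; for $x_1,\dots,x_n\in V$ let $x_1\wedge\cdots\wedge x_n$ denote the determinant of their coordinate matrix. Define the multilinear map $F_\pi:(V\oplus W)^{n+1}\to W$ by $$F_\pi(x_1+y_1,\dots,x_{n+1}+y_{n+1})=\frac{1}{(n+1)!}\sum_{i=1}^{n+1}(-1)^{n+1-i}\,(x_1\wedge\cdots\wedge\widehat{x_i}\wedge\cdots\wedge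 x_{n+1})\,y_i\qquad(x_i\in V,\ y_i\in W),$$ where $\widehat{x_i}$ means $x_i$ is omitted. Fiber body: for $x\in\pi(K)$ let $K_x:=\{y\in W:x+y\in K\}$; $\Sigma_\pi K:=\{\int_{\pi(K)}\gamma(x)\,\mathrm{d}x:\gamma:\pi(K)\to W\text{ Borel measurable},\ \gamma(x)\in K_x\}$, $\mathrm{d}x$ Lebesgue measure on $V$. *)

theory Defs
  imports "HOL-Probability.Probability"
begin

text \<open>Convention: V is given by an orthonormal family b 0, ..., b (n-1) in the euclidean space 'a
(dimension n+m); V = span of b, W = orthogonal complement of V, pi = orthogonal projection onto V.\<close>

definition proj :: "(nat \<Rightarrow> 'a::euclidean_space) \<Rightarrow> nat \<Rightarrow> 'a \<Rightarrow> 'a" where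
  "proj b n x = (\<Sum>j<n. (x \<bullet> b j) *\<^sub>R b j)"

definition orthW :: "(nat \<Rightarrow> 'a::euclidean_space) \<Rightarrow> nat \<Rightarrow> 'a set" where
  "orthW b n = {y. \<forall>j<n. y \<bullet> b j = 0}"

definition coord_emb :: "(nat \<Rightarrow> 'a::euclidean_space) \<Rightarrow> nat \<Rightarrow> (nat \<Rightarrow> real) \<Rightarrow> 'a" where
  "coord_emb b n t = (\<Sum>j<n. t j *\<^sub>R b j)"

definition det_nat :: "nat \<Rightarrow> (nat \<Rightarrow> nat \<Rightarrow> real) \<Rightarrow> real" where
  "det_nat n A = (\<Sum>p | p permutes {..<n}. of_int (sign p) * (\<Prod>i<n. A i (p i)))"

definition wedge :: "(nat \<Rightarrow> 'a::euclidean_space) \<Rightarrow> nat \<Rightarrow> (nat \<Rightarrow> 'a) \<Rightarrow> real" where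
  "wedge b n xs = det_nat n (\<lambda>j l. proj b n (xs l) \<bullet> b j)"

text \<open>F_pi on n+1 vectors xs 0, ..., xs n (paper's index i = k+1).\<close>
definition Fpi :: "(nat \<Rightarrow> 'a::euclidean_space) \<Rightarrow> nat \<Rightarrow> (nat \<Rightarrow> 'a) \<Rightarrow> 'a" where
  "Fpi b n xs = (1 / fact (n + 1)) *\<^sub>R
     (\<Sum>k\<le>n. ((-1) ^ (n - k) * wedge b n (\<lambda>l. xs (if l < k then l else Suc l)))
              *\<^sub>R (xs k - proj b n (xs k)))"

text \<open>Vitale zonoid: the convex body with support function u |-> 1/2 E|<u,X>|.\<close>
definition K0 :: "'s measure \<Rightarrow> ('s \<Rightarrow> 'a::euclidean_space) \<Rightarrow> 'a set" where
  "K0 M X = {x. \<forall>u. x \<bullet> u \<le> (1/2) * integral\<^sup>L M (\<lambda>\<omega>. \<bar>u \<bullet> X \<omega>\<bar>)}"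

definition fiber :: "(nat \<Rightarrow> 'a::euclidean_space) \<Rightarrow> nat \<Rightarrow> 'a set \<Rightarrow> 'a \<Rightarrow> 'a set" where
  "fiber b n K x = {y \<in> orthW b n. x + y \<in> K}"

text \<open>Fiber body: integrals over pi(K) (Lebesgue measure on V via orthonormal coordinates)
of Borel measurable sections gamma with gamma(x) in K_x.\<close>
definition fiber_body :: "(nat \<Rightarrow> 'a::euclidean_space) \<Rightarrow> nat \<Rightarrow> 'a set \<Rightarrow> 'a set" where
  "fiber_body b n K =
     {(LINT t | PiM {..<n} (\<lambda>_. lborel).
          indicator (proj b n ` K) (coord_emb b n t) *\<^sub>R \<gamma> (coord_emb b n t)) | \<gamma>.
        \<gamma> \<in> borel_measurable borel \<and> (\<forall>x \<in> proj b n ` K. \<gamma> x \<in> fiber b n K x)}"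

end

theory Submission
  imports Defs
begin

text \<open>
  Fix \<open>u \<in> W\<close> and let \<open>T z = (\<pi> z, \<langle>u, z\<rangle>)\<close>. By Fubini and the symmetry of the zonoid \<open>K\<close>, the
  \<open>(n + 1)\<close>-dimensional volume of \<open>T K\<close> is twice the integral over \<open>\<pi> K\<close> of the support
  function of the fibers at \<open>u\<close>, which is the support function of the fiber body. On the other
  hand, \<open>T K\<close> is a zonoid, so Vitale's formula gives its volume as
  \<open>E \<bar>det (T X\<^sub>1, \<dots>, T X\<^sub>n\<^sub>+\<^sub>1)\<bar> / (n + 1)!\<close>, and by Laplace expansion along the last row this
  determinant is \<open>(n + 1)! \<langle>u, F\<^sub>\<pi>(X\<^sub>1, \<dots>, X\<^sub>n\<^sub>+\<^sub>1)\<rangle>\<close>.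

  Vitale's formula is obtained for zonotopes by adding one segment at a time: after a shear that
  makes the segment orthogonal to all coordinates but one, its contribution is its length times
  the volume of a projection. The general case follows by squeezing the zonoid between zonotopes
  of simple approximations of \<open>X\<close>.
\<close>

section \<open>Leibniz determinants over a finite index set\<close>

text \<open>Equality of bodies asks for more than equal support functions. Separation applies only
  once the fiber body is known to be closed and convex, and the supremum over sections must be
  approached by Borel ones. Sections with convergent integrals need not converge themselves, so
  closedness rests on a selection by almost minimal square norm. Maximisers are replaced by the
  points of the fibers nearest to a far point in direction \<open>u\<close>: these are unique by
  convexity, can be shown to be Borel, and are maximal up to a small error.

  A single fiber need not be symmetric. Symmetry of \<open>K\<close> only pairs the fibers over
  \<open>x\<close> and \<open>- x\<close>: if \<open>h x\<close> is the maximum of \<open>u\<close>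
  on the fiber over \<open>x\<close>, the slice of \<open>T K\<close> over \<open>x\<close> is the
  interval from \<open>- h (- x)\<close> to \<open>h x\<close>. The factor two thus appears only
  after integration over the symmetric set \<open>\<pi> K\<close>, and it is the source of the
  \<open>1/2\<close> in \<open>K0\<close>.

  Determinants and volumes are indexed by arbitrary finite sets and arbitrary families of
  functionals. The induction on segments can then drop an index without renumbering, and dependent
  families, such as those with \<open>u = 0\<close>, are covered by the same formulas.\<close>

definition detI :: "'i set \<Rightarrow> ('i \<Rightarrow> 'i \<Rightarrow> real) \<Rightarrow> real" where
  "detI I A = (\<Sum>p | p permutes I. of_int (sign p) * (\<Prod>i\<in>I. A i (p i)))"

lemma detI_cong:
  assumes "\<And>i j. i \<in> I \<Longrightarrow> j \<in> I \<Longrightarrow> A i j = B i j"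
  shows "detI I A = detI I B"
  unfolding detI_def
  by (intro sum.cong refl arg_cong2[where f="(*)"] prod.cong) (auto simp: assms permutes_in_image)

lemma detI_permute_cols:
  assumes "finite I" and s: "s permutes I"
  shows "detI I (\<lambda>i j. A i (s j)) = of_int (sign s) * detI I A"
proof -
  have ps: "permutation p" if "p permutes I" for p
    using that assms(1) permutation_permutes by blast
  \<comment> \<open>Reindexing by \<open>s \<circ> p\<close> multiplies each sign by
    \<open>sign s\<close>; the copy of \<open>sign s\<close> in front cancels it.\<close>
  have "of_int (sign s) * detI I A
      = (\<Sum>p | p permutes I. of_int (sign s) * (of_int (sign (s \<circ> p)) * (\<Prod>i\<in>I. A i ((s \<circ> p) i))))"
    unfolding detI_def by (subst setum_permutations_compose_left[OF s]) (simp add: sum_distrib_left)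
  also have "\<dots> = detI I (\<lambda>i j. A i (s j))"
    unfolding detI_def
  proof (intro sum.cong refl)
    fix p assume "p \<in> {p. p permutes I}"
    then have "sign (s \<circ> p) = sign s * sign p"
      by (simp add: ps s sign_compose)
    then show "of_int (sign s) * (of_int (sign (s \<circ> p)) * (\<Prod>i\<in>I. A i ((s \<circ> p) i)))
        = of_int (sign p) * (\<Prod>i\<in>I. A i (s (p i)))"
      by (simp add: sign_def)
  qed
  finally show ?thesis by simp
qed

lemma detI_permute_rows:
  assumes "finite I" and s: "s permutes I"
  shows "detI I (\<lambda>i j. A (s i) j) = of_int (sign s) * detI I A"
proof -
  have ps: "permutation p" if "p permutes I" for p
    using that assms(1) permutation_permutes by blast
  have "detI I (\<lambda>i j. A (s i) j)
      = (\<Sum>p | p permutes I. of_int (sign (p \<circ> s)) * (\<Prod>i\<in>I. A (s i) ((p \<circ> s) i)))"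
    unfolding detI_def by (subst sum_permutations_compose_right[OF s]) simp
  also have "\<dots> = (\<Sum>p | p permutes I. of_int (sign s) * (of_int (sign p) * (\<Prod>i\<in>I. A i (p i))))"
  proof (intro sum.cong refl)
    fix p assume p: "p \<in> {p. p permutes I}"
    have "(\<Prod>i\<in>I. A (s i) ((p \<circ> s) i)) = (\<Prod>i\<in>s ` I. A i (p i))"
      by (subst prod.reindex) (use s permutes_inj_on in \<open>auto simp: permutes_inj_on\<close>)
    also have "s ` I = I" using s by (rule permutes_image)
    finally show "of_int (sign (p \<circ> s)) * (\<Prod>i\<in>I. A (s i) ((p \<circ> s) i))
        = of_int (sign s) * (of_int (sign p) * (\<Prod>i\<in>I. A i (p i)))"
      using p by (simp add: ps s sign_compose)
  qed
  finally show ?thesis by (simp add: detI_def sum_distrib_left)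
qed

lemma detI_equal_cols:
  assumes "finite I" "a \<in> I" "b \<in> I" "a \<noteq> b" "\<And>i. i \<in> I \<Longrightarrow> A i a = A i b"
  shows "detI I A = 0"
proof -
  have "detI I A = detI I (\<lambda>i j. A i (Transposition.transpose a b j))"
    using assms(5) by (intro detI_cong) (auto simp: Transposition.transpose_def)
  also have "\<dots> = - detI I A"
    using assms by (subst detI_permute_cols) (auto simp: permutes_swap_id sign_swap_id)
  finally show ?thesis by simp
qed

lemma detI_equal_rows:
  assumes "finite I" "a \<in> I" "b \<in> I" "a \<noteq> b" "\<And>j. j \<in> I \<Longrightarrow> A a j = A b j"
  shows "detI I A = 0"
proof -
  have "detI I A = detI I (\<lambda>i j. A (Transposition.transpose a b i) j)"
    using assms(5) by (intro detI_cong) (auto simp: Transposition.transpose_def)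
  also have "\<dots> = - detI I A"
    using assms by (subst detI_permute_rows) (auto simp: permutes_swap_id sign_swap_id)
  finally show ?thesis by simp
qed

lemma detI_row_add:
  assumes "finite I" "a \<in> I"
  shows "detI I (A(a := \<lambda>j. r j + c * q j)) = detI I (A(a := r)) + c * detI I (A(a := q))"
proof -
  have "(\<Prod>i\<in>I. (A(a := f)) i (p i)) = f (p a) * (\<Prod>i\<in>I - {a}. A i (p i))" for f p
    using assms by (subst prod.remove[of _ a]) (auto intro!: prod.cong)
  then show ?thesis
    by (simp add: detI_def sum.distrib sum_distrib_left algebra_simps del: fun_upd_apply)
qed

text \<open>One row at a time: \<open>J\<close> collects the rows already reduced. Row
  \<open>a\<close> stays outside \<open>J\<close>, so every step subtracts a multiple of the
  untouched pivot row, and the extra determinant has two equal rows. This is the algebraic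
  counterpart of the volume-preserving shear.\<close>

lemma detI_row_operations:
  assumes "finite I" "a \<in> I"
  shows "detI I (\<lambda>i j. if i = a then A i j else A i j - c i * A a j) = detI I A"
proof -
  have "detI I (\<lambda>i j. if i \<in> J then A i j - c i * A a j else A i j) = detI I A"
    if "finite J" "J \<subseteq> I - {a}" for J
    using that
  proof (induction J rule: finite_induct)
    case empty
    show ?case by simp
  next
    case (insert k J)
    let ?B = "\<lambda>i j. if i \<in> J then A i j - c i * A a j else A i j"
    have "(\<lambda>i j. if i \<in> insert k J then A i j - c i * A a j else A i j)
        = ?B(k := \<lambda>j. A k j + (- c k) * A a j)"
      by (auto simp: fun_eq_iff)
    then have "detI I (\<lambda>i j. if i \<in> insert k J then A i j - c i * A a j else A i j)
        = detI I (?B(k := A k)) - c k * detI I (?B(k := A a))"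
      using detI_row_add[OF assms(1), of k ?B "A k" "- c k" "A a"] insert.prems
      by (simp del: fun_upd_apply)
    also have "?B(k := A k) = ?B" using insert.hyps by (auto simp: fun_eq_iff)
    also have "detI I (?B(k := A a)) = 0"
      by (rule detI_equal_rows[of _ k a]) (use assms insert in auto)
    finally show ?case using insert by simp
  qed
  from this[of "I - {a}"] have "detI I (\<lambda>i j. if i \<in> I - {a} then A i j - c i * A a j else A i j) = detI I A"
    using assms by simp
  then show ?thesis
    by (subst (asm) detI_cong[where B="\<lambda>i j. if i = a then A i j else A i j - c i * A a j"]) auto
qed

text \<open>A permutation that moves \<open>a\<close> has some other row sent to column
  \<open>a\<close>, where the entry is zero. The surviving permutations are exactly those of
  \<open>I - {a}\<close>.\<close>

lemma detI_pivot:
  assumes "finite I" "a \<in> I" "\<And>i. i \<in> I \<Longrightarrow> i \<noteq> a \<Longrightarrow> A i a = 0"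
  shows "detI I A = A a a * detI (I - {a}) A"
proof -
  have sub: "{p. p permutes I - {a}} \<subseteq> {p. p permutes I}"
    by (auto intro: permutes_subset)
  have z: "(\<Prod>i\<in>I. A i (p i)) = 0" if p: "p permutes I" "\<not> p permutes (I - {a})" for p
  proof -
    have "p a \<noteq> a"
      using p permutes_superset[of p I "I - {a}"] assms(2) by auto
    obtain i where i: "i \<in> I" "p i = a"
      using p(1) assms(2) by (metis permutes_def permutes_not_in)
    with \<open>p a \<noteq> a\<close> have "i \<noteq> a" by auto
    with i have "A i (p i) = 0" using assms(3)[of i] by simp
    with i assms(1) show ?thesis by (auto simp: prod_zero_iff)
  qed
  have "detI I A = (\<Sum>p | p permutes I - {a}. of_int (sign p) * (\<Prod>i\<in>I. A i (p i)))"
    unfolding detI_def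
    by (rule sum.mono_neutral_right) (use assms sub z in \<open>auto simp: finite_permutations\<close>)
  also have "\<dots> = (\<Sum>p | p permutes I - {a}. A a a * (of_int (sign p) * (\<Prod>i\<in>I - {a}. A i (p i))))"
  proof (intro sum.cong refl)
    fix p assume "p \<in> {p. p permutes I - {a}}"
    then have "p a = a" by (auto intro: permutes_not_in)
    then show "of_int (sign p) * (\<Prod>i\<in>I. A i (p i))
       = A a a * (of_int (sign p) * (\<Prod>i\<in>I - {a}. A i (p i)))"
      using assms by (subst prod.remove[of _ a]) auto
  qed
  finally show ?thesis by (simp add: detI_def sum_distrib_left)
qed

text \<open>Swapping columns \<open>a\<close> and \<open>b\<close> brings the pivot to the diagonal,
  so rows and columns of the minor are again indexed by the same set. The sign of the swap is
  dropped because only absolute values enter volumes.\<close>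

lemma abs_detI_pivot:
  assumes "finite I" "a \<in> I" "b \<in> I" "\<And>i. i \<in> I \<Longrightarrow> i \<noteq> a \<Longrightarrow> A i b = 0"
  shows "\<bar>detI I A\<bar> = \<bar>A a b\<bar> * \<bar>detI (I - {a}) (\<lambda>i j. A i (Transposition.transpose a b j))\<bar>"
proof -
  have t: "Transposition.transpose a b permutes I" using assms by (simp add: permutes_swap_id)
  have "\<bar>detI I A\<bar> = \<bar>detI I (\<lambda>i j. A i (Transposition.transpose a b j))\<bar>"
    using detI_permute_cols[OF assms(1) t, of A] by (simp add: abs_mult sign_def)
  also have "\<dots> = \<bar>A a b\<bar> * \<bar>detI (I - {a}) (\<lambda>i j. A i (Transposition.transpose a b j))\<bar>"
    using assms by (subst detI_pivot) (auto simp: abs_mult)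
  finally show ?thesis .
qed

lemma detI_zero_col:
  assumes "finite I" "b \<in> I" "\<And>i. i \<in> I \<Longrightarrow> A i b = 0"
  shows "detI I A = 0"
  using abs_detI_pivot[of I b b A] assms by auto

lemma det_nat_eq_detI: "det_nat n = detI {..<n}"
  by (simp add: fun_eq_iff det_nat_def detI_def)

section \<open>Laplace expansion along the last row\<close>

lemma detI_row_pivot:
  assumes "finite I" "a \<in> I" "\<And>j. j \<in> I \<Longrightarrow> j \<noteq> a \<Longrightarrow> A a j = 0"
  shows "detI I A = A a a * detI (I - {a}) A"
proof -
  have z: "(\<Prod>i\<in>I. A i (p i)) = 0" if p: "p permutes I" "\<not> p permutes (I - {a})" for p
  proof -
    have "p a \<noteq> a"
      using p permutes_superset[of p I "I - {a}"] assms(2) by auto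
    moreover have "p a \<in> I" using p(1) assms(2) by (simp add: permutes_in_image)
    ultimately have "A a (p a) = 0" using assms(3) by auto
    with assms(1,2) show ?thesis by (auto simp: prod_zero_iff)
  qed
  have "detI I A = (\<Sum>p | p permutes I - {a}. of_int (sign p) * (\<Prod>i\<in>I. A i (p i)))"
    unfolding detI_def
    by (rule sum.mono_neutral_right) (use assms z in \<open>auto simp: finite_permutations intro: permutes_subset\<close>)
  also have "\<dots> = (\<Sum>p | p permutes I - {a}. A a a * (of_int (sign p) * (\<Prod>i\<in>I - {a}. A i (p i))))"
  proof (intro sum.cong refl)
    fix p assume "p \<in> {p. p permutes I - {a}}"
    then have "p a = a" by (auto intro: permutes_not_in)
    then show "of_int (sign p) * (\<Prod>i\<in>I. A i (p i))
       = A a a * (of_int (sign p) * (\<Prod>i\<in>I - {a}. A i (p i)))"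
      using assms by (subst prod.remove[of _ a]) auto
  qed
  finally show ?thesis by (simp add: detI_def sum_distrib_left)
qed

text \<open>Linearity in row \<open>a\<close>, written as a combination of unit rows: a permutation
  \<open>p\<close> contributes only to the term \<open>k = p a\<close>.\<close>

lemma detI_expand_row:
  assumes "finite I" "a \<in> I"
  shows "detI I A = (\<Sum>k\<in>I. A a k * detI I (A(a := \<lambda>j. if j = k then 1 else 0)))"
proof -
  have pr: "(\<Prod>i\<in>I. (A(a := r)) i (p i)) = r (p a) * (\<Prod>i\<in>I - {a}. A i (p i))" for r p
    using assms by (subst prod.remove[of _ a]) (auto intro!: prod.cong)
  have "detI I A = detI I (A(a := A a))" by simp
  also have "\<dots> = (\<Sum>p | p permutes I. \<Sum>k\<in>I. A a k * (of_int (sign p) * ((if p a = k then 1 else 0) * (\<Prod>i\<in>I - {a}. A i (p i)))))"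
    unfolding detI_def pr
  proof (intro sum.cong refl)
    fix p assume "p \<in> {p. p permutes I}"
    then have "p a \<in> I" using assms(2) by (simp add: permutes_in_image)
    then show "of_int (sign p) * (A a (p a) * (\<Prod>i\<in>I - {a}. A i (p i)))
        = (\<Sum>k\<in>I. A a k * (of_int (sign p) * ((if p a = k then 1 else 0) * (\<Prod>i\<in>I - {a}. A i (p i)))))"
      using assms(1) by (simp add: if_distrib[of "\<lambda>x. _ * x"] if_distrib[of "\<lambda>x. x * _"] cong: if_cong)
  qed
  also have "\<dots> = (\<Sum>k\<in>I. A a k * detI I (A(a := \<lambda>j. if j = k then 1 else 0)))"
    unfolding detI_def pr sum_distrib_left by (rule sum.swap)
  finally show ?thesis .
qed

text \<open>This is the cycle \<open>(n k k+1 \<dots> n-1)\<close>.\<close>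
definition last_to :: "nat \<Rightarrow> nat \<Rightarrow> nat \<Rightarrow> nat" where
  "last_to n k l = (if l = n then k else if l < k \<or> n < l then l else Suc l)"

lemma last_to_step:
  assumes "k < n"
  shows "last_to n k = Transposition.transpose k (Suc k) \<circ> last_to n (Suc k)"
  using assms by (auto simp: fun_eq_iff last_to_def Transposition.transpose_def)

text \<open>The cycle arises from the identity at \<open>k = n\<close> by \<open>n - k\<close>
  adjacent transpositions, hence the downward induction. Their number is the exponent of the sign in
  \<open>Fpi\<close>.\<close>

lemma last_to_permutes_sign:
  assumes "k \<le> n"
  shows "last_to n k permutes {..<Suc n} \<and> sign (last_to n k) = (- 1) ^ (n - k)"
  using assms
proof (induction k rule: inc_induct)
  case base
  have "last_to n n = id" by (auto simp: fun_eq_iff last_to_def)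
  then show ?case by (simp only: permutes_id sign_id diff_self_eq_0 power_0 simp_thms)
next
  case (step k)
  have t: "Transposition.transpose k (Suc k) permutes {..<Suc n}"
    using step by (intro permutes_swap_id) auto
  have perm: "permutation (Transposition.transpose k (Suc k))" "permutation (last_to n (Suc k))"
    using t step permutation_permutes by blast+
  have "n - k = Suc (n - Suc k)" using step by simp
  then have "sign (Transposition.transpose k (Suc k) \<circ> last_to n (Suc k)) = (- 1) ^ (n - k)"
    using step by (subst sign_compose[OF perm]) (simp add: sign_swap_id)
  moreover have "Transposition.transpose k (Suc k) \<circ> last_to n (Suc k) permutes {..<Suc n}"
    using step t by (intro permutes_compose) auto
  ultimately show ?case unfolding last_to_step[OF step(2)] by blast
qed

text \<open>Stated with the column deletion used in \<open>Fpi\<close>, which is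
  \<open>last_to n k\<close> below \<open>n\<close>. Cycling column \<open>k\<close> into the last
  place turns the unit row into a pivot row on the diagonal.\<close>

lemma detI_laplace_last_row:
  "detI {..<Suc n} A
    = (\<Sum>k\<le>n. (- 1) ^ (n - k) * A n k * det_nat n (\<lambda>i l. A i (if l < k then l else Suc l)))"
proof -
  have "detI {..<Suc n} (A(n := \<lambda>j. if j = k then 1 else 0))
      = (- 1) ^ (n - k) * det_nat n (\<lambda>i l. A i (if l < k then l else Suc l))" if k: "k \<le> n" for k
  proof -
    let ?B = "A(n := \<lambda>j. if j = k then 1 else 0)"
    let ?c = "last_to n k"
    have c: "?c permutes {..<Suc n}" "sign ?c = (- 1) ^ (n - k)" using last_to_permutes_sign[OF k] by auto
    have "of_int (sign ?c) * detI {..<Suc n} ?B = detI {..<Suc n} (\<lambda>i j. ?B i (?c j))"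
      by (rule detI_permute_cols[symmetric]) (use c in auto)
    also have "\<dots> = ?B n (?c n) * detI ({..<Suc n} - {n}) (\<lambda>i j. ?B i (?c j))"
      using k by (intro detI_row_pivot) (auto simp: last_to_def)
    also have "\<dots> = detI {..<n} (\<lambda>i l. A i (if l < k then l else Suc l))"
    proof -
      have e: "{..<Suc n} - {n} = {..<n}" by auto
      have "detI {..<n} (\<lambda>i j. ?B i (?c j)) = detI {..<n} (\<lambda>i l. A i (if l < k then l else Suc l))"
        by (rule detI_cong) (simp add: last_to_def)
      moreover have "?B n (?c n) = 1" by (simp add: last_to_def)
      ultimately show ?thesis unfolding e by (simp only: mult_1)
    qed
    finally have "(- 1) ^ (n - k) * detI {..<Suc n} ?B = det_nat n (\<lambda>i l. A i (if l < k then l else Suc l))"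
      using c(2) by (simp add: det_nat_eq_detI)
    \<comment> \<open>The sign is its own inverse, so multiplying by it once more moves it to the
      other side.\<close>
    then have "(- 1) ^ (n - k) * ((- 1) ^ (n - k) * detI {..<Suc n} ?B)
        = (- 1) ^ (n - k) * det_nat n (\<lambda>i l. A i (if l < k then l else Suc l))" by simp
    then show ?thesis by (simp flip: mult.assoc power_add)
  qed
  then show ?thesis
    by (subst detI_expand_row[of _ n]) (auto simp: lessThan_Suc_atMost algebra_simps intro!: sum.cong)
qed

section \<open>Volumes of coordinate images\<close>

text \<open>Values of \<open>t\<close> outside \<open>I\<close> are left free, so this is a cylinder
  and updates \<open>t(i := y)\<close> need no restriction. It is therefore not a subset of the
  product space, and volumes are integrals of its indicator, which see only the extensional
  points.\<close>

definition coord_image :: "'i set \<Rightarrow> ('i \<Rightarrow> 'a::euclidean_space) \<Rightarrow> 'a set \<Rightarrow> ('i \<Rightarrow> real) set" where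
  "coord_image I f A = {t. \<exists>x\<in>A. \<forall>i\<in>I. f i \<bullet> x = t i}"

definition coord_volume :: "'i set \<Rightarrow> ('i \<Rightarrow> 'a::euclidean_space) \<Rightarrow> 'a set \<Rightarrow> ennreal" where
  "coord_volume I f A = (\<integral>\<^sup>+t. indicator (coord_image I f A) t \<partial>PiM I (\<lambda>_. lborel))"

text \<open>In a compact set, approximate solutions of the equations cluster at an exact one, and by
  density the approximate ones may be taken in \<open>D\<close>. With \<open>D\<close> countable,
  the uncountable existential becomes a countable combination of measurable conditions.\<close>

lemma coord_image_closed_approx:
  fixes A :: "'a::euclidean_space set"
  assumes "finite I" "compact A" "D \<subseteq> A" "A \<subseteq> closure D"
  shows "t \<in> coord_image I f A \<longleftrightarrow> (\<forall>m::nat. \<exists>x\<in>D. \<forall>i\<in>I. \<bar>f i \<bullet> x - t i\<bar> < 1 / Suc m)"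
proof
  assume "t \<in> coord_image I f A"
  then obtain x where x: "x \<in> A" "\<And>i. i \<in> I \<Longrightarrow> f i \<bullet> x = t i"
    unfolding coord_image_def by auto
  show "\<forall>m::nat. \<exists>x\<in>D. \<forall>i\<in>I. \<bar>f i \<bullet> x - t i\<bar> < 1 / Suc m"
  proof
    fix m :: nat
    let ?U = "\<Inter>i\<in>I. {y. \<bar>f i \<bullet> y - t i\<bar> < 1 / Suc m}"
    have "open ?U"
      using assms(1) by (intro open_INT ballI open_Collect_less continuous_intros) auto
    moreover have "x \<in> ?U" using x by auto
    ultimately have "?U \<inter> D \<noteq> {}"
      using x(1) assms(4) open_Int_closure_eq_empty[of ?U D] by auto
    then show "\<exists>x\<in>D. \<forall>i\<in>I. \<bar>f i \<bullet> x - t i\<bar> < 1 / Suc m" by auto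
  qed
next
  assume "\<forall>m::nat. \<exists>x\<in>D. \<forall>i\<in>I. \<bar>f i \<bullet> x - t i\<bar> < 1 / Suc m"
  then obtain d where d: "\<And>m. d m \<in> D" "\<And>m i. i \<in> I \<Longrightarrow> \<bar>f i \<bullet> d m - t i\<bar> < 1 / Suc m"
    by metis
  from d assms(3) have "\<forall>m. d m \<in> A" by auto
  with assms(2) obtain x r where x: "x \<in> A" "strict_mono r" "(d \<circ> r) \<longlonglongrightarrow> x"
    unfolding compact_def by metis
  have "f i \<bullet> x = t i" if i: "i \<in> I" for i
  proof -
    have "(\<lambda>m. f i \<bullet> (d \<circ> r) m) \<longlonglongrightarrow> f i \<bullet> x"
      by (intro tendsto_intros x)
    moreover have "(\<lambda>m. f i \<bullet> d m - t i) \<longlonglongrightarrow> 0"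
    proof (rule tendsto_0_le[where K=1])
      show "(\<lambda>m. 1 / real (Suc m)) \<longlonglongrightarrow> 0" by (rule lim_1_over_n[THEN LIMSEQ_Suc])
      show "\<forall>\<^sub>F m in sequentially. norm (f i \<bullet> d m - t i) \<le> norm (1 / real (Suc m)) * 1"
        by (intro always_eventually allI) (use d(2)[OF i] in \<open>auto intro: less_imp_le\<close>)
    qed
    then have "(\<lambda>m. f i \<bullet> d m) \<longlonglongrightarrow> t i" by (simp add: LIM_zero_iff)
    then have "(\<lambda>m. f i \<bullet> (d \<circ> r) m) \<longlonglongrightarrow> t i"
      using LIMSEQ_subseq_LIMSEQ[OF _ x(2)] by (auto simp: comp_def)
    ultimately show ?thesis by (rule LIMSEQ_unique)
  qed
  with x(1) show "t \<in> coord_image I f A" unfolding coord_image_def by auto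
qed

lemma pred_coord_image:
  assumes "finite I" "compact A"
  shows "Measurable.pred (PiM I (\<lambda>_. lborel)) (\<lambda>t. t \<in> coord_image I f A)"
proof -
  obtain D where D: "countable D" "D \<subseteq> A" "A \<subseteq> closure D"
    by (rule separable)
  have [measurable]: "(\<lambda>t. t i) \<in> borel_measurable (PiM I (\<lambda>_. lborel))" if "i \<in> I" for i
    using that by measurable
  show ?thesis
    unfolding coord_image_closed_approx[OF assms D(2,3)]
    using D(1) assms(1) countable_finite[OF assms(1)] by measurable
qed

lemma borel_measurable_coord_image [measurable]:
  assumes "finite I" "compact A"
  shows "(\<lambda>t. indicator (coord_image I f A) t :: ennreal) \<in> borel_measurable (PiM I (\<lambda>_. lborel))"
  using pred_coord_image[OF assms] unfolding indicator_def by measurable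

lemma measurable_coord_image_upd:
  assumes "finite I" "compact A"
  shows "(\<lambda>(t, y). indicator (coord_image (insert i I) f A) (t(i := y)) :: ennreal)
    \<in> borel_measurable (PiM I (\<lambda>_. lborel) \<Otimes>\<^sub>M lborel)"
proof -
  have "(\<lambda>(t, y). t(i := y)) \<in> measurable (PiM I (\<lambda>_. lborel) \<Otimes>\<^sub>M lborel) (PiM (insert i I) (\<lambda>_. lborel :: real measure))"
    by (rule measurable_add_dim)
  from measurable_compose[OF this borel_measurable_coord_image[of "insert i I" A f]] assms
  show ?thesis by (simp add: case_prod_unfold)
qed

lemma coord_volume_mono:
  assumes "A \<subseteq> B"
  shows "coord_volume I f A \<le> coord_volume I f B"
  unfolding coord_volume_def
  by (intro nn_integral_mono) (use assms in \<open>auto simp: coord_image_def indicator_def\<close>)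

interpretation lborel_product: product_sigma_finite "\<lambda>_. lborel :: real measure"
  by standard

text \<open>Applied twice: with translations in the shear, and with negation for the reflection
  symmetry of the measure on the projection. It suffices to compare the measures on boxes.\<close>

lemma nn_integral_PiM_lborel_map:
  fixes T :: "'i \<Rightarrow> real \<Rightarrow> real"
  assumes I: "finite I" and T [measurable]: "\<And>i. i \<in> I \<Longrightarrow> T i \<in> borel_measurable borel"
    and inv: "\<And>i. i \<in> I \<Longrightarrow> distr lborel lborel (T i) = (lborel :: real measure)"
    and h: "h \<in> borel_measurable (PiM I (\<lambda>_. lborel))"
  shows "(\<integral>\<^sup>+t. h (\<lambda>i\<in>I. T i (t i)) \<partial>PiM I (\<lambda>_. lborel)) = (\<integral>\<^sup>+t. h t \<partial>PiM I (\<lambda>_. lborel))"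
proof -
  let ?P = "PiM I (\<lambda>_. lborel :: real measure)"
  let ?T = "\<lambda>t. \<lambda>i\<in>I. T i (t i)"
  have Tm: "?T \<in> measurable ?P ?P"
    by (intro measurable_restrict measurable_compose[OF measurable_component_singleton]) (use T in auto)
  have "distr ?P ?P ?T = ?P"
  proof (rule lborel_product.PiM_eqI[OF I])
    show "sets (distr ?P ?P ?T) = sets ?P" by simp
  next
    fix A :: "_ \<Rightarrow> real set" assume A: "\<And>i. i \<in> I \<Longrightarrow> A i \<in> sets lborel"
    have S: "T i -` A i \<in> sets lborel" if "i \<in> I" for i
      using measurable_sets[OF T[OF that], of "A i"] A[OF that] by simp
    have "emeasure (distr ?P ?P ?T) (Pi\<^sub>E I A) = emeasure ?P (?T -` Pi\<^sub>E I A \<inter> space ?P)"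
      using A I by (intro emeasure_distr Tm sets_PiM_I_finite)
    also have "?T -` Pi\<^sub>E I A \<inter> space ?P = Pi\<^sub>E I (\<lambda>i. T i -` A i)"
      by (auto simp: space_PiM PiE_def Pi_def)
    also have "emeasure ?P \<dots> = (\<Prod>i\<in>I. emeasure lborel (T i -` A i))"
      using S by (intro lborel_product.emeasure_PiM I)
    also have "\<dots> = (\<Prod>i\<in>I. emeasure lborel (A i))"
    proof (rule prod.cong[OF refl])
      fix i assume i: "i \<in> I"
      have "emeasure (distr lborel lborel (T i)) (A i) = emeasure lborel (T i -` A i)"
        using A[OF i] T[OF i] by (subst emeasure_distr) auto
      with inv[OF i] show "emeasure lborel (T i -` A i) = emeasure lborel (A i)" by simp
    qed
    finally show "emeasure (distr ?P ?P ?T) (Pi\<^sub>E I A) = (\<Prod>i\<in>I. emeasure lborel (A i))" .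
  qed
  then have "(\<integral>\<^sup>+t. h t \<partial>?P) = (\<integral>\<^sup>+t. h t \<partial>distr ?P ?P ?T)" by simp
  also have "\<dots> = (\<integral>\<^sup>+t. h (?T t) \<partial>?P)"
    by (rule nn_integral_distr[OF Tm]) (use h in simp)
  finally show ?thesis by simp
qed

section \<open>Slices in one coordinate direction\<close>

definition coord_section :: "'i \<Rightarrow> 'i set \<Rightarrow> ('i \<Rightarrow> 'a::euclidean_space) \<Rightarrow> 'a set \<Rightarrow> ('i \<Rightarrow> real) \<Rightarrow> real set" where
  "coord_section i I f A t = (\<lambda>x. f i \<bullet> x) ` {x \<in> A. \<forall>j\<in>I. f j \<bullet> x = t j}"

lemma coord_section_eq:
  "coord_section i I f A t = (\<lambda>x. f i \<bullet> x) ` (A \<inter> (\<Inter>j\<in>I. {x. f j \<bullet> x = t j}))"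
  unfolding coord_section_def by (rule arg_cong[where f="(`) _"]) auto

lemma compact_coord_section: "compact A \<Longrightarrow> compact (coord_section i I f A t)"
  unfolding coord_section_eq
  by (intro compact_continuous_image compact_Int_closed closed_INT ballI closed_Collect_eq continuous_intros)

lemma convex_coord_section: "convex A \<Longrightarrow> convex (coord_section i I f A t)"
  unfolding coord_section_eq
  by (intro convex_linear_image convex_Int convex_INT convex_hyperplane)
    (auto intro!: linearI simp: inner_right_distrib)

lemma coord_image_fun_upd:
  assumes "i \<notin> I"
  shows "t(i := y) \<in> coord_image (insert i I) f A \<longleftrightarrow> y \<in> coord_section i I f A t"
proof -
  have "(\<forall>j\<in>insert i I. f j \<bullet> x = (t(i := y)) j) \<longleftrightarrow> f i \<bullet> x = y \<and> (\<forall>j\<in>I. f j \<bullet> x = t j)" for x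
    using assms by (auto simp: fun_upd_apply split: if_splits)
  then show ?thesis
    unfolding coord_image_def coord_section_def by (auto simp del: fun_upd_apply)
qed

lemma nn_integral_coord_image_fun_upd:
  assumes "i \<notin> I" "compact A"
  shows "(\<integral>\<^sup>+y. indicator (coord_image (insert i I) f A) (t(i := y)) \<partial>lborel)
    = emeasure lborel (coord_section i I f A t)"
proof -
  have "(\<integral>\<^sup>+y. indicator (coord_image (insert i I) f A) (t(i := y)) \<partial>lborel)
      = (\<integral>\<^sup>+y. indicator (coord_section i I f A t) y \<partial>lborel)"
    using assms(1) by (intro nn_integral_cong) (simp add: indicator_def coord_image_fun_upd)
  also have "\<dots> = emeasure lborel (coord_section i I f A t)"
    by (intro nn_integral_indicator) (simp add: borel_compact compact_coord_section assms)
  finally show ?thesis .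
qed

lemma coord_volume_insert:
  assumes I: "finite I" "i \<notin> I" and A: "compact A"
  shows "coord_volume (insert i I) f A
    = (\<integral>\<^sup>+t. emeasure lborel (coord_section i I f A t) \<partial>PiM I (\<lambda>_. lborel))"
proof -
  have "coord_volume (insert i I) f A
      = (\<integral>\<^sup>+t. (\<integral>\<^sup>+y. indicator (coord_image (insert i I) f A) (t(i := y)) \<partial>lborel) \<partial>PiM I (\<lambda>_. lborel))"
    unfolding coord_volume_def
    by (rule lborel_product.product_nn_integral_insert[OF I borel_measurable_coord_image]) (use I A in auto)
  then show ?thesis by (simp only: nn_integral_coord_image_fun_upd[OF I(2) A])
qed

lemma borel_measurable_emeasure_coord_section:
  assumes I: "finite I" "i \<notin> I" and A: "compact A"
  shows "(\<lambda>t. emeasure lborel (coord_section i I f A t)) \<in> borel_measurable (PiM I (\<lambda>_. lborel))"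
proof -
  have "(\<lambda>t. \<integral>\<^sup>+y. indicator (coord_image (insert i I) f A) (t(i := y)) \<partial>lborel)
      \<in> borel_measurable (PiM I (\<lambda>_. lborel))"
    by (intro lborel.borel_measurable_nn_integral measurable_coord_image_upd I A)
  then show ?thesis by (simp only: nn_integral_coord_image_fun_upd[OF I(2) A])
qed

section \<open>Adding a segment, and shears\<close>

definition add_segment :: "'a::euclidean_space set \<Rightarrow> 'a \<Rightarrow> 'a set" where
  "add_segment A x = (\<lambda>(a, s). a + s *\<^sub>R x) ` (A \<times> {-1/2..1/2})"

lemma compact_add_segment: "compact A \<Longrightarrow> compact (add_segment A x)"
  unfolding add_segment_def
  by (intro compact_continuous_image compact_Times) (auto simp: case_prod_unfold intro!: continuous_intros)

lemma convex_add_segment: "convex A \<Longrightarrow> convex (add_segment A x)"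
  unfolding add_segment_def
proof (intro convex_linear_image convex_Times)
  show "linear (\<lambda>(a, s). a + s *\<^sub>R x)"
    by (auto intro!: linearI simp: algebra_simps)
qed auto

text \<open>A nonempty interval grows by half of \<open>\<bar>c\<bar>\<close> at each end, while the
  empty set stays empty. The indicator records this distinction; integrated over all slices it
  becomes the volume of a projection.\<close>

lemma emeasure_lborel_interval_sum:
  fixes B :: "real set"
  assumes "compact B" "convex B"
  shows "emeasure lborel ((\<lambda>(b, s). b + s * c) ` (B \<times> {-1/2..1/2}))
    = emeasure lborel B + ennreal \<bar>c\<bar> * indicator {B. B \<noteq> {}} B"
proof (cases "B = {}")
  case False
  from assms obtain l r where B: "B = {l..r}"
    using connected_compact_interval_1 convex_connected by metis
  with False have lr: "l \<le> r" by auto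
  have "(\<lambda>(b, s). b + s * c) ` (B \<times> {-1/2..1/2}) = {l - \<bar>c\<bar>/2..r + \<bar>c\<bar>/2}"
  proof (intro set_eqI iffI)
    fix y assume "y \<in> (\<lambda>(b, s). b + s * c) ` (B \<times> {-1/2..1/2})"
    then obtain b s where bs: "l \<le> b" "b \<le> r" "-1/2 \<le> s" "s \<le> 1/2" "y = b + s * c" by (auto simp: B)
    have "\<bar>s * c\<bar> \<le> (1/2) * \<bar>c\<bar>"
      unfolding abs_mult using bs by (intro mult_right_mono) auto
    with bs show "y \<in> {l - \<bar>c\<bar>/2..r + \<bar>c\<bar>/2}" by auto
  next
    fix y assume y: "y \<in> {l - \<bar>c\<bar>/2..r + \<bar>c\<bar>/2}"
    \<comment> \<open>The point of \<open>B\<close> nearest to \<open>y\<close>; the segment only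
      has to cover the remaining offset.\<close>
    define b where "b = max l (min r y)"
    have b: "b \<in> B" "\<bar>y - b\<bar> \<le> \<bar>c\<bar>/2" using y lr by (auto simp: B b_def max_def min_def)
    show "y \<in> (\<lambda>(b, s). b + s * c) ` (B \<times> {-1/2..1/2})"
    proof (cases "c = 0")
      case True
      then have "y = (\<lambda>(b, s). b + s * c) (b, 0)" using b by auto
      then show ?thesis using b by (intro image_eqI[where x="(b, 0)"]) auto
    next
      case c: False
      have "\<bar>(y - b) / c\<bar> \<le> 1/2" using b c by (simp add: abs_divide field_simps)
      then have "-1/2 \<le> (y - b) / c \<and> (y - b) / c \<le> 1/2" by linarith
      then show ?thesis using b c by (intro image_eqI[where x="(b, (y - b) / c)"]) auto
    qed
  qed
  then show ?thesis using lr False by (simp add: B ennreal_plus[symmetric] del: ennreal_plus)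
qed simp

lemma coord_section_add_segment:
  assumes orth: "\<And>j. j \<in> I \<Longrightarrow> f j \<bullet> x = 0"
  shows "coord_section i I f (add_segment A x) t
    = (\<lambda>(b, s). b + s * (f i \<bullet> x)) ` (coord_section i I f A t \<times> {-1/2..1/2})"
proof (intro set_eqI iffI)
  fix y assume "y \<in> coord_section i I f (add_segment A x) t"
  then obtain a s where "a \<in> A" "s \<in> {-1/2..1/2}" "\<forall>j\<in>I. f j \<bullet> (a + s *\<^sub>R x) = t j"
      "y = f i \<bullet> (a + s *\<^sub>R x)"
    unfolding coord_section_def add_segment_def by auto
  then show "y \<in> (\<lambda>(b, s). b + s * (f i \<bullet> x)) ` (coord_section i I f A t \<times> {-1/2..1/2})"
    unfolding coord_section_def
    by (intro image_eqI[where x="(f i \<bullet> a, s)"]) (auto simp: inner_right_distrib orth)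
next
  fix y assume "y \<in> (\<lambda>(b, s). b + s * (f i \<bullet> x)) ` (coord_section i I f A t \<times> {-1/2..1/2})"
  then obtain a s where a: "a \<in> A" "s \<in> {-1/2..1/2}" "\<forall>j\<in>I. f j \<bullet> a = t j" "y = f i \<bullet> a + s * (f i \<bullet> x)"
    unfolding coord_section_def by auto
  then have "a + s *\<^sub>R x \<in> add_segment A x"
    unfolding add_segment_def by (intro image_eqI[where x="(a, s)"]) auto
  with a show "y \<in> coord_section i I f (add_segment A x) t"
    unfolding coord_section_def
    by (intro image_eqI[where x="a + s *\<^sub>R x"]) (auto simp: inner_right_distrib orth)
qed

text \<open>Orthogonality keeps the base point \<open>t\<close> of a slice fixed while multiples of
  \<open>x\<close> are added. Each nonempty slice lengthens by the same amount, and the nonempty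
  slices are those over the image in the coordinates \<open>I\<close>.\<close>

lemma coord_volume_add_segment_orthogonal:
  assumes I: "finite I" "i \<notin> I" and A: "compact A" "convex A"
    and orth: "\<And>j. j \<in> I \<Longrightarrow> f j \<bullet> x = 0"
  shows "coord_volume (insert i I) f (add_segment A x)
    = coord_volume (insert i I) f A + ennreal \<bar>f i \<bullet> x\<bar> * coord_volume I f A"
proof -
  let ?P = "PiM I (\<lambda>_. lborel :: real measure)"
  have "coord_volume (insert i I) f (add_segment A x)
      = (\<integral>\<^sup>+t. emeasure lborel (coord_section i I f (add_segment A x) t) \<partial>?P)"
    by (intro coord_volume_insert I compact_add_segment A)
  also have "\<dots> = (\<integral>\<^sup>+t. emeasure lborel (coord_section i I f A t)
      + ennreal \<bar>f i \<bullet> x\<bar> * indicator (coord_image I f A) t \<partial>?P)"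
  proof (intro nn_integral_cong)
    fix t
    have "indicator {B. B \<noteq> {}} (coord_section i I f A t) = (indicator (coord_image I f A) t :: ennreal)"
      by (auto simp: indicator_def coord_image_def coord_section_def)
    with emeasure_lborel_interval_sum[OF compact_coord_section[OF A(1), of i I f t]
        convex_coord_section[OF A(2), of i I f t], of "f i \<bullet> x"]
    show "emeasure lborel (coord_section i I f (add_segment A x) t)
        = emeasure lborel (coord_section i I f A t) + ennreal \<bar>f i \<bullet> x\<bar> * indicator (coord_image I f A) t"
      by (simp only: coord_section_add_segment[OF orth])
  qed
  also have "\<dots> = (\<integral>\<^sup>+t. emeasure lborel (coord_section i I f A t) \<partial>?P)
      + ennreal \<bar>f i \<bullet> x\<bar> * coord_volume I f A"
    unfolding coord_volume_def
    using borel_measurable_emeasure_coord_section[OF I A(1), of f] borel_measurable_coord_image[OF I(1) A(1), of f]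
    by (subst nn_integral_add) (auto simp: nn_integral_cmult)
  finally show ?thesis by (simp only: coord_volume_insert[OF I A(1)])
qed

text \<open>The coordinate \<open>y\<close> along \<open>f i\<close> is integrated last. For fixed
  \<open>y\<close> the shear is then a translation of the other coordinates by
  \<open>c j * y\<close>.\<close>

lemma coord_volume_shear:
  assumes I: "finite I" "i \<notin> I" and A: "compact A"
  shows "coord_volume (insert i I) (\<lambda>j. if j = i then f i else f j - c j *\<^sub>R f i) A
    = coord_volume (insert i I) f A"
proof -
  let ?P = "PiM I (\<lambda>_. lborel :: real measure)"
  let ?f = "\<lambda>j. if j = i then f i else f j - c j *\<^sub>R f i"
  have F: "coord_volume (insert i I) g A = (\<integral>\<^sup>+y. (\<integral>\<^sup>+t. indicator (coord_image (insert i I) g A) (t(i := y)) \<partial>?P) \<partial>lborel)" for g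
    unfolding coord_volume_def
    by (rule lborel_product.product_nn_integral_insert_rev[OF I borel_measurable_coord_image]) (use I A in auto)
  have "(\<integral>\<^sup>+t. indicator (coord_image (insert i I) ?f A) (t(i := y)) \<partial>?P)
      = (\<integral>\<^sup>+t. indicator (coord_image (insert i I) f A) (t(i := y)) \<partial>?P)" for y
  proof -
    have "(\<integral>\<^sup>+t. indicator (coord_image (insert i I) ?f A) (t(i := y)) \<partial>?P)
       = (\<integral>\<^sup>+t. indicator (coord_image (insert i I) f A) ((\<lambda>j\<in>I. c j * y + t j)(i := y)) \<partial>?P)"
    proof (intro nn_integral_cong)
      fix t
      have "t(i := y) \<in> coord_image (insert i I) ?f A
         \<longleftrightarrow> (\<lambda>j\<in>I. c j * y + t j)(i := y) \<in> coord_image (insert i I) f A"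
        using I(2) unfolding coord_image_def mem_Collect_eq
        by (intro bex_cong refl) (auto simp: inner_diff_left)
      then show "indicator (coord_image (insert i I) ?f A) (t(i := y))
          = (indicator (coord_image (insert i I) f A) ((\<lambda>j\<in>I. c j * y + t j)(i := y)) :: ennreal)"
        by (auto simp: indicator_def)
    qed
    also have "\<dots> = (\<integral>\<^sup>+t. indicator (coord_image (insert i I) f A) (t(i := y)) \<partial>?P)"
    proof (rule nn_integral_PiM_lborel_map[where T="\<lambda>j. (+) (c j * y)"
        and h="\<lambda>t. indicator (coord_image (insert i I) f A) (t(i := y))"])
      show "distr lborel lborel ((+) (c j * y)) = lborel" for j
        using lborel_distr_plus[of "c j * y"] by (simp cong: distr_cong)
      show "(\<lambda>t. indicator (coord_image (insert i I) f A) (t(i := y)) :: ennreal) \<in> borel_measurable ?P"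
        using measurable_compose[OF measurable_Pair2' measurable_coord_image_upd[OF I(1) A]] by simp
    qed (use I in auto)
    finally show ?thesis .
  qed
  then show ?thesis by (simp add: F)
qed

section \<open>The volume of a zonotope\<close>

primrec zonotope :: "(nat \<Rightarrow> 'a::euclidean_space) \<Rightarrow> nat \<Rightarrow> 'a set" where
  "zonotope x 0 = {0}"
| "zonotope x (Suc N) = add_segment (zonotope x N) (x N)"

lemma compact_zonotope: "compact (zonotope x N)"
  by (induction N) (auto intro: compact_add_segment)

lemma convex_zonotope: "convex (zonotope x N)"
  by (induction N) (auto intro: convex_add_segment)

text \<open>The new vector may occupy any column \<open>j\<close>, while the pivot row is always
  \<open>a\<close>. This relabelling moves the remaining column choices to \<open>I - {a}\<close>,
  in agreement with the minor in \<open>abs_detI_pivot\<close>.\<close>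

lemma bij_betw_PiE_transpose:
  assumes "a \<in> I" "j \<in> I"
  shows "bij_betw (\<lambda>\<tau>. \<lambda>l\<in>I - {a}. \<tau> (Transposition.transpose a j l)) (I - {j} \<rightarrow>\<^sub>E S) (I - {a} \<rightarrow>\<^sub>E S)"
proof (rule bij_betw_byWitness[where f'="\<lambda>\<tau>. \<lambda>l\<in>I - {j}. \<tau> (Transposition.transpose a j l)"])
  let ?t = "Transposition.transpose a j"
  have t: "?t l \<in> I - {j}" if "l \<in> I - {a}" for l
    using that assms by (auto simp: Transposition.transpose_def)
  have t': "?t l \<in> I - {a}" if "l \<in> I - {j}" for l
    using that assms by (auto simp: Transposition.transpose_def)
  show "\<forall>\<tau>\<in>I - {j} \<rightarrow>\<^sub>E S. (\<lambda>l\<in>I - {j}. (\<lambda>l\<in>I - {a}. \<tau> (?t l)) (?t l)) = \<tau>"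
    using t' by (auto simp: PiE_iff extensional_def restrict_def fun_eq_iff)
  show "\<forall>\<tau>\<in>I - {a} \<rightarrow>\<^sub>E S. (\<lambda>l\<in>I - {a}. (\<lambda>l\<in>I - {j}. \<tau> (?t l)) (?t l)) = \<tau>"
    using t by (auto simp: PiE_iff extensional_def restrict_def fun_eq_iff)
  show "(\<lambda>\<tau>. \<lambda>l\<in>I - {a}. \<tau> (?t l)) ` (I - {j} \<rightarrow>\<^sub>E S) \<subseteq> (I - {a} \<rightarrow>\<^sub>E S)"
  proof (rule image_subsetI)
    fix \<tau> assume "\<tau> \<in> I - {j} \<rightarrow>\<^sub>E S"
    then have "\<tau> (?t l) \<in> S" if "l \<in> I - {a}" for l
      using t[OF that] by (rule PiE_mem)
    then show "(\<lambda>l\<in>I - {a}. \<tau> (?t l)) \<in> I - {a} \<rightarrow>\<^sub>E S"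
      unfolding restrict_PiE_iff by blast
  qed
  show "(\<lambda>\<tau>. \<lambda>l\<in>I - {j}. \<tau> (?t l)) ` (I - {a} \<rightarrow>\<^sub>E S) \<subseteq> (I - {j} \<rightarrow>\<^sub>E S)"
  proof (rule image_subsetI)
    fix \<tau> assume "\<tau> \<in> I - {a} \<rightarrow>\<^sub>E S"
    then have "\<tau> (?t l) \<in> S" if "l \<in> I - {j}" for l
      using t'[OF that] by (rule PiE_mem)
    then show "(\<lambda>l\<in>I - {j}. \<tau> (?t l)) \<in> I - {j} \<rightarrow>\<^sub>E S"
      unfolding restrict_PiE_iff by blast
  qed
qed

text \<open>The vanishing hypothesis reflects that a determinant with two equal columns is zero.\<close>
lemma sum_PiE_lessThan_Suc:
  fixes G :: "('i \<Rightarrow> nat) \<Rightarrow> real"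
  assumes I: "finite I"
    and G: "\<And>s a b. a \<in> I \<Longrightarrow> b \<in> I \<Longrightarrow> a \<noteq> b \<Longrightarrow> s a = N \<Longrightarrow> s b = N \<Longrightarrow> G s = 0"
  shows "sum G (I \<rightarrow>\<^sub>E {..<Suc N}) = sum G (I \<rightarrow>\<^sub>E {..<N})
    + (\<Sum>j\<in>I. \<Sum>s\<in>I - {j} \<rightarrow>\<^sub>E {..<N}. G (s(j := N)))"
proof -
  let ?D = "SIGMA j:I. I - {j} \<rightarrow>\<^sub>E {..<N}"
  let ?u = "\<lambda>(j, s::'i \<Rightarrow> nat). s(j := N)"
  have fin: "finite (I \<rightarrow>\<^sub>E {..<Suc N})" "finite (I \<rightarrow>\<^sub>E {..<N})" "finite ?D"
    using I by (auto intro!: finite_PiE)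
  have mem: "?u p \<in> I \<rightarrow>\<^sub>E {..<Suc N}" "?u p \<notin> I \<rightarrow>\<^sub>E {..<N}" if pD: "p \<in> ?D" for p
  proof -
    obtain j s where p: "p = (j, s)" "j \<in> I" "s \<in> I - {j} \<rightarrow>\<^sub>E {..<N}" using pD by auto
    then have "s i < N" if "i \<in> I - {j}" for i using that by auto
    with p show "?u p \<in> I \<rightarrow>\<^sub>E {..<Suc N}"
      by (auto simp: PiE_iff extensional_def less_Suc_eq)
    have "(s(j := N)) j = N" by simp
    with p(1,2) show "?u p \<notin> I \<rightarrow>\<^sub>E {..<N}" by (auto simp: PiE_iff)
  qed
  have inj: "inj_on ?u ?D"
  proof (rule inj_onI)
    fix p q assume "p \<in> ?D" "q \<in> ?D" and eq: "?u p = ?u q"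
    then obtain j s k r where p: "p = (j, s)" "j \<in> I" "s \<in> I - {j} \<rightarrow>\<^sub>E {..<N}"
      and q: "q = (k, r)" "k \<in> I" "r \<in> I - {k} \<rightarrow>\<^sub>E {..<N}" by auto
    have e: "(s(j := N)) i = (r(k := N)) i" for i using eq p q by (auto simp: fun_eq_iff)
    have jk: "j = k"
    proof (rule ccontr)
      assume "j \<noteq> k"
      with e[of k] p q have "s k = N" "s k < N" by (auto simp: PiE_iff)
      then show False by simp
    qed
    have "s = r"
    proof (rule PiE_ext)
      show "s \<in> I - {j} \<rightarrow>\<^sub>E {..<N}" "r \<in> I - {j} \<rightarrow>\<^sub>E {..<N}" using p q jk by auto
      fix i assume "i \<in> I - {j}"
      with e[of i] jk show "s i = r i" by auto
    qed
    with jk p q show "p = q" by simp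
  qed
  have rest: "G s = 0" if s: "s \<in> (I \<rightarrow>\<^sub>E {..<Suc N}) - ((I \<rightarrow>\<^sub>E {..<N}) \<union> ?u ` ?D)" for s
  proof -
    from s obtain a where a: "a \<in> I" "s a = N"
      by (auto simp: PiE_iff less_Suc_eq)
    have "\<exists>b\<in>I. b \<noteq> a \<and> s b = N"
    proof (rule ccontr)
      assume "\<not> ?thesis"
      \<comment> \<open>If \<open>N\<close> is taken only at \<open>a\<close>, forgetting that value
        leaves an extensional function on \<open>I - {a}\<close>, of which \<open>s\<close> is an
        update.\<close>
      with s have "s(a := undefined) \<in> I - {a} \<rightarrow>\<^sub>E {..<N}"
        by (auto simp: PiE_iff extensional_def less_Suc_eq)
      with a have "(a, s(a := undefined)) \<in> ?D" "?u (a, s(a := undefined)) = s" by auto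
      then have "s \<in> ?u ` ?D" by (metis (no_types, lifting) image_eqI)
      with s show False by auto
    qed
    with a G show ?thesis by metis
  qed
  have "sum G (I \<rightarrow>\<^sub>E {..<Suc N}) = sum G ((I \<rightarrow>\<^sub>E {..<N}) \<union> ?u ` ?D)"
  proof (rule sum.mono_neutral_right[OF fin(1)])
    have "(I \<rightarrow>\<^sub>E {..<N}) \<subseteq> (I \<rightarrow>\<^sub>E {..<Suc N})" by (intro PiE_mono) auto
    then show "(I \<rightarrow>\<^sub>E {..<N}) \<union> ?u ` ?D \<subseteq> (I \<rightarrow>\<^sub>E {..<Suc N})"
      by (intro Un_least image_subsetI mem(1))
    show "\<forall>s\<in>(I \<rightarrow>\<^sub>E {..<Suc N}) - ((I \<rightarrow>\<^sub>E {..<N}) \<union> ?u ` ?D). G s = 0" by (intro ballI rest)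
  qed
  also have "\<dots> = sum G (I \<rightarrow>\<^sub>E {..<N}) + sum G (?u ` ?D)"
    using fin mem(2) by (intro sum.union_disjoint) auto
  also have "sum G (?u ` ?D) = (\<Sum>p\<in>?D. G (?u p))"
    using inj by (simp add: sum.reindex)
  also have "\<dots> = (\<Sum>j\<in>I. \<Sum>s\<in>I - {j} \<rightarrow>\<^sub>E {..<N}. G (s(j := N)))"
    using I by (subst sum.Sigma) (auto intro!: finite_PiE simp: case_prod_unfold)
  finally show ?thesis .
qed

text \<open>The sum runs over ordered tuples: those with repeated vectors vanish, and every subset
  of \<open>card I\<close> indices is counted \<open>card I\<close> factorial times. Hence the
  factorial that separates it from the volume of a zonotope.\<close>

definition det_sum :: "'i set \<Rightarrow> ('i \<Rightarrow> 'a::euclidean_space) \<Rightarrow> (nat \<Rightarrow> 'a) \<Rightarrow> nat \<Rightarrow> real" where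
  "det_sum I f x N = (\<Sum>s\<in>I \<rightarrow>\<^sub>E {..<N}. \<bar>detI I (\<lambda>i j. f i \<bullet> x (s j))\<bar>)"

text \<open>The tuples that use the new vector exactly once are grouped by its position
  \<open>j\<close>. After the row operations that vector has a single nonzero entry, in row
  \<open>a\<close>, so each of the \<open>card I\<close> positions contributes the same sum of
  minors.\<close>

lemma det_sum_Suc_pivot:
  fixes f :: "'i \<Rightarrow> 'a::euclidean_space"
  assumes I: "finite I" "a \<in> I" and nz: "f a \<bullet> x N \<noteq> 0"
  defines "g \<equiv> \<lambda>j. if j = a then f a else f j - ((f j \<bullet> x N) / (f a \<bullet> x N)) *\<^sub>R f a"
  shows "det_sum I f x (Suc N) = det_sum I f x N + card I * (\<bar>f a \<bullet> x N\<bar> * det_sum (I - {a}) g x N)"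
proof -
  let ?G = "\<lambda>s. \<bar>detI I (\<lambda>i j. f i \<bullet> x (s j))\<bar>"
  let ?H = "\<lambda>s. \<bar>detI (I - {a}) (\<lambda>i j. g i \<bullet> x (s j))\<bar>"
  have g0: "g i \<bullet> x N = 0" if "i \<noteq> a" for i
    using that nz by (simp add: g_def inner_diff_left)
  have row: "detI I (\<lambda>i j. f i \<bullet> v j) = detI I (\<lambda>i j. g i \<bullet> v j)" for v
  proof -
    have "(\<lambda>i j. g i \<bullet> v j)
        = (\<lambda>i j. if i = a then f i \<bullet> v j else f i \<bullet> v j - ((f i \<bullet> x N) / (f a \<bullet> x N)) * (f a \<bullet> v j))"
      by (auto simp: g_def fun_eq_iff inner_diff_left)
    then show ?thesis using detI_row_operations[OF I, of "\<lambda>i j. f i \<bullet> v j"] by simp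
  qed
  have "(\<Sum>s\<in>I - {j} \<rightarrow>\<^sub>E {..<N}. ?G (s(j := N))) = \<bar>f a \<bullet> x N\<bar> * sum ?H (I - {a} \<rightarrow>\<^sub>E {..<N})"
    if j: "j \<in> I" for j
  proof -
    have "?G (s(j := N)) = \<bar>f a \<bullet> x N\<bar> * ?H (\<lambda>l\<in>I - {a}. s (Transposition.transpose a j l))" for s
    proof -
      have "?G (s(j := N)) = \<bar>g a \<bullet> x N\<bar> * \<bar>detI (I - {a})
          (\<lambda>i l. g i \<bullet> x ((s(j := N)) (Transposition.transpose a j l)))\<bar>"
        unfolding row
        using abs_detI_pivot[OF I j, of "\<lambda>i l. g i \<bullet> x ((s(j := N)) l)"] g0 by simp
      also have "detI (I - {a}) (\<lambda>i l. g i \<bullet> x ((s(j := N)) (Transposition.transpose a j l)))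
          = detI (I - {a}) (\<lambda>i l. g i \<bullet> x ((\<lambda>l\<in>I - {a}. s (Transposition.transpose a j l)) l))"
        by (intro detI_cong) (auto simp: Transposition.transpose_def)
      finally show ?thesis by (simp add: g_def)
    qed
    then have "(\<Sum>s\<in>I - {j} \<rightarrow>\<^sub>E {..<N}. ?G (s(j := N)))
        = \<bar>f a \<bullet> x N\<bar> * (\<Sum>s\<in>I - {j} \<rightarrow>\<^sub>E {..<N}. ?H (\<lambda>l\<in>I - {a}. s (Transposition.transpose a j l)))"
      by (simp add: sum_distrib_left)
    also have "(\<Sum>s\<in>I - {j} \<rightarrow>\<^sub>E {..<N}. ?H (\<lambda>l\<in>I - {a}. s (Transposition.transpose a j l)))
        = sum ?H (I - {a} \<rightarrow>\<^sub>E {..<N})"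
      by (rule sum.reindex_bij_betw[OF bij_betw_PiE_transpose[OF I(2) j]])
    finally show ?thesis .
  qed
  moreover have "sum ?G (I \<rightarrow>\<^sub>E {..<Suc N}) = sum ?G (I \<rightarrow>\<^sub>E {..<N})
      + (\<Sum>j\<in>I. \<Sum>s\<in>I - {j} \<rightarrow>\<^sub>E {..<N}. ?G (s(j := N)))"
  proof (rule sum_PiE_lessThan_Suc[OF I(1)])
    fix s b c assume "b \<in> I" "c \<in> I" "b \<noteq> c" "s b = N" "s c = N"
    then show "?G s = 0" using detI_equal_cols[OF I(1), of b c] by simp
  qed
  ultimately show ?thesis by (simp add: det_sum_def)
qed

lemma det_sum_Suc_orthogonal:
  assumes I: "finite I" and z: "\<And>i. i \<in> I \<Longrightarrow> f i \<bullet> x N = 0"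
  shows "det_sum I f x (Suc N) = det_sum I f x N"
  unfolding det_sum_def
proof (rule sum.mono_neutral_right)
  show "finite (I \<rightarrow>\<^sub>E {..<Suc N})" using I by (intro finite_PiE) auto
  show "(I \<rightarrow>\<^sub>E {..<N}) \<subseteq> (I \<rightarrow>\<^sub>E {..<Suc N})" by (intro PiE_mono) auto
  show "\<forall>s\<in>(I \<rightarrow>\<^sub>E {..<Suc N}) - (I \<rightarrow>\<^sub>E {..<N}). \<bar>detI I (\<lambda>i j. f i \<bullet> x (s j))\<bar> = 0"
  proof
    fix s assume "s \<in> (I \<rightarrow>\<^sub>E {..<Suc N}) - (I \<rightarrow>\<^sub>E {..<N})"
    then obtain b where "b \<in> I" "s b = N" by (auto simp: PiE_iff less_Suc_eq)
    then show "\<bar>detI I (\<lambda>i j. f i \<bullet> x (s j))\<bar> = 0"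
      using detI_zero_col[OF I, of b "\<lambda>i j. f i \<bullet> x (s j)"] z by simp
  qed
qed

lemma det_sum_nonneg: "0 \<le> det_sum I f x N"
  unfolding det_sum_def by (intro sum_nonneg) auto

lemma coord_volume_singleton_0:
  assumes I: "finite I"
  shows "coord_volume I f {0} = (if I = {} then 1 else 0)"
proof -
  have "coord_volume I f {0} = (\<integral>\<^sup>+t. indicator (I \<rightarrow>\<^sub>E {0}) t \<partial>PiM I (\<lambda>_. lborel :: real measure))"
    unfolding coord_volume_def
  proof (intro nn_integral_cong)
    fix t assume "t \<in> space (PiM I (\<lambda>_. lborel :: real measure))"
    then have "t \<in> coord_image I f {0} \<longleftrightarrow> t \<in> I \<rightarrow>\<^sub>E {0}"
      unfolding coord_image_def PiE_iff space_PiM by auto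
    then show "indicator (coord_image I f {0}) t = (indicator (I \<rightarrow>\<^sub>E {0}) t :: ennreal)"
      by (simp only: indicator_def)
  qed
  also have "\<dots> = emeasure (PiM I (\<lambda>_. lborel :: real measure)) (I \<rightarrow>\<^sub>E {0})"
    using nn_integral_indicator[OF sets_PiM_I_finite[OF I, of "\<lambda>_. {0}" "\<lambda>_. lborel :: real measure"]] by simp
  also have "\<dots> = (\<Prod>i\<in>I. emeasure lborel {0::real})"
    using I by (intro lborel_product.emeasure_PiM) auto
  also have "\<dots> = (if I = {} then 1 else 0)"
    using I by (auto simp: prod_zero_iff)
  finally show ?thesis .
qed

text \<open>The induction generalises over \<open>I\<close> and \<open>f\<close> because its step
  meets the sheared functionals and the index set without the pivot. A new vector orthogonal to all
  functionals changes neither side. Otherwise volume and \<open>det_sum\<close> satisfy the same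
  recurrence: the factor \<open>card I\<close> of the latter turns the factorial of
  \<open>card I\<close> into that of \<open>card I - 1\<close>.\<close>

theorem coord_volume_zonotope:
  fixes f :: "'i \<Rightarrow> 'a::euclidean_space"
  assumes "finite I"
  shows "coord_volume I f (zonotope x N) = ennreal (det_sum I f x N / fact (card I))"
  using assms
proof (induction N arbitrary: I f)
  case 0
  show ?case
  proof (cases "I = {}")
    case True
    then show ?thesis using 0 by (simp add: coord_volume_singleton_0 det_sum_def detI_def)
  next
    case False
    then have "(I \<rightarrow>\<^sub>E ({} :: nat set)) = {}" by (auto simp: PiE_eq_empty_iff)
    then show ?thesis using 0 False by (simp add: coord_volume_singleton_0 det_sum_def)
  qed
next
  case (Suc N)
  note I = \<open>finite I\<close>
  show ?case
  proof (cases "\<exists>a\<in>I. f a \<bullet> x N \<noteq> 0")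
    case False
    then have z: "f i \<bullet> x N = 0" if "i \<in> I" for i using that by auto
    have "coord_image I f (add_segment (zonotope x N) (x N)) = coord_image I f (zonotope x N)"
    proof (intro set_eqI iffI)
      fix t assume "t \<in> coord_image I f (add_segment (zonotope x N) (x N))"
      then show "t \<in> coord_image I f (zonotope x N)"
        unfolding coord_image_def add_segment_def by (auto simp: inner_right_distrib z)
    next
      fix t assume "t \<in> coord_image I f (zonotope x N)"
      then obtain y where y: "y \<in> zonotope x N" "\<And>i. i \<in> I \<Longrightarrow> f i \<bullet> y = t i"
        unfolding coord_image_def by auto
      then have "y \<in> add_segment (zonotope x N) (x N)"
        unfolding add_segment_def by (intro image_eqI[where x="(y, 0)"]) auto
      with y(2) show "t \<in> coord_image I f (add_segment (zonotope x N) (x N))"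
        unfolding coord_image_def by auto
    qed
    then have "coord_volume I f (zonotope x (Suc N)) = coord_volume I f (zonotope x N)"
      by (simp add: coord_volume_def)
    with Suc.IH[OF I] det_sum_Suc_orthogonal[OF I, of f x N, OF z] show ?thesis by simp
  next
    case True
    then obtain a where a: "a \<in> I" "f a \<bullet> x N \<noteq> 0" by auto
    define c where "c = (\<lambda>j. (f j \<bullet> x N) / (f a \<bullet> x N))"
    define g where "g = (\<lambda>j. if j = a then f a else f j - c j *\<^sub>R f a)"
    define J where "J = I - {a}"
    have J: "finite J" "a \<notin> J" "I = insert a J" using I a by (auto simp: J_def)
    have g0: "g i \<bullet> x N = 0" if "i \<in> J" for i
      using that a by (auto simp: g_def c_def J_def inner_diff_left)
    have "coord_volume I f (zonotope x (Suc N)) = coord_volume I g (zonotope x (Suc N))"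
      unfolding J(3) g_def by (rule coord_volume_shear[symmetric]) (use J compact_zonotope in blast)+
    also have "\<dots> = coord_volume I g (zonotope x N) + ennreal \<bar>g a \<bullet> x N\<bar> * coord_volume J g (zonotope x N)"
      unfolding J(3) zonotope.simps
      by (intro coord_volume_add_segment_orthogonal J compact_zonotope convex_zonotope g0)
    also have "coord_volume I g (zonotope x N) = coord_volume I f (zonotope x N)"
      unfolding J(3) g_def by (rule coord_volume_shear) (use J compact_zonotope in blast)+
    also have "\<dots> + ennreal \<bar>g a \<bullet> x N\<bar> * coord_volume J g (zonotope x N)
       = ennreal (det_sum I f x N / fact (card I) + \<bar>f a \<bullet> x N\<bar> * (det_sum J g x N / fact (card J)))"
      by (simp add: Suc.IH I J(1) g_def ennreal_mult'[symmetric] ennreal_plus[symmetric] det_sum_nonneg del: ennreal_plus)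
    also have "det_sum I f x N / fact (card I) + \<bar>f a \<bullet> x N\<bar> * (det_sum J g x N / fact (card J))
       = det_sum I f x (Suc N) / fact (card I)"
    proof -
      have c: "card I = Suc (card J)" using J by simp
      then have "fact (card I) = real (card I) * fact (card J)" by simp
      then have "y / fact (card J) = real (card I) * y / fact (card I)" for y :: real
        using c by (simp del: fact_Suc of_nat_Suc)
      moreover have "det_sum I f x (Suc N) = det_sum I f x N + card I * (\<bar>f a \<bullet> x N\<bar> * det_sum J g x N)"
        unfolding J_def g_def c_def by (rule det_sum_Suc_pivot[OF I a(1), of f x N, OF a(2)])
      ultimately show ?thesis by (simp add: add_divide_distrib mult_ac)
    qed
    finally show ?thesis .
  qed
qed

section \<open>Support functions\<close>

text \<open>For arbitrary \<open>h\<close> this is the Wulff shape, whose support function may lie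
  below \<open>h\<close>. Both sides of the final equation are brought into this form with the same
  \<open>h\<close>.\<close>

definition support_body :: "('a::euclidean_space \<Rightarrow> real) \<Rightarrow> 'a set" where
  "support_body h = {x. \<forall>u. x \<bullet> u \<le> h u}"

lemma support_body_mono: "(\<And>u. h u \<le> h' u) \<Longrightarrow> support_body h \<subseteq> support_body h'"
  unfolding support_body_def by (auto intro: order_trans)

lemma closed_support_body: "closed (support_body h)"
proof -
  have "support_body h = (\<Inter>u. {x. x \<bullet> u \<le> h u})" by (auto simp: support_body_def)
  then show ?thesis by (auto intro!: closed_INT closed_Collect_le continuous_intros)
qed

lemma convex_support_body: "convex (support_body h)"
proof -
  have "support_body h = (\<Inter>u. {x. u \<bullet> x \<le> h u})" by (auto simp: support_body_def inner_commute)
  then show ?thesis by (auto intro!: convex_INT convex_halfspace_le)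
qed

lemma compact_support_body:
  assumes "\<And>u. h u \<le> C * norm u"
  shows "compact (support_body h)"
proof -
  have "norm x \<le> max C 0" if "x \<in> support_body h" for x
  proof (cases "x = 0")
    case False
    have "norm x * norm x = x \<bullet> x" by (simp add: norm_eq_sqrt_inner)
    also have "\<dots> \<le> C * norm x" using that assms[of x] unfolding support_body_def
      by (auto intro: order_trans)
    finally show ?thesis using False by simp
  qed simp
  then have "bounded (support_body h)" unfolding bounded_iff by blast
  then show ?thesis using closed_support_body compact_eq_bounded_closed by blast
qed

text \<open>Separation of a point from a closed convex set. Approximate attainment is enough because
  the separation is strict, and it is all that the measurable sections of the fiber body
  provide.\<close>

lemma eq_support_body:
  fixes A :: "'a::euclidean_space set"
  assumes "closed A" "convex A" and le: "\<And>a u. a \<in> A \<Longrightarrow> a \<bullet> u \<le> h u"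
    and att: "\<And>u e. 0 < e \<Longrightarrow> \<exists>a\<in>A. h u - e \<le> a \<bullet> u"
  shows "A = support_body h"
proof
  show "A \<subseteq> support_body h" using le by (auto simp: support_body_def)
  show "support_body h \<subseteq> A"
  proof (rule ccontr)
    assume "\<not> support_body h \<subseteq> A"
    then obtain z where z: "z \<in> support_body h" "z \<notin> A" by auto
    obtain u b where u: "u \<bullet> z < b" "\<forall>x\<in>A. b < u \<bullet> x"
      using separating_hyperplane_closed_point[OF assms(2,1) z(2)] by auto
    \<comment> \<open>Separation puts \<open>z\<close> on the lower side, so the relevant direction
      is \<open>- u\<close>; the gap \<open>b - u \<bullet> z\<close> is the error to be
      beaten.\<close>
    obtain a where a: "a \<in> A" "h (- u) - (b - u \<bullet> z) \<le> a \<bullet> (- u)"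
      using att[of "b - u \<bullet> z" "- u"] u(1) by auto
    have "z \<bullet> (- u) \<le> h (- u)" using z(1) by (simp only: support_body_def mem_Collect_eq)
    with a u(2) show False by (auto simp: inner_commute)
  qed
qed

lemma K0_eq_support_body: "K0 M X = support_body (\<lambda>u. (1/2) * integral\<^sup>L M (\<lambda>\<omega>. \<bar>u \<bullet> X \<omega>\<bar>))"
  by (simp add: K0_def support_body_def)

lemma zonotope_eq_support_body:
  "zonotope x N = support_body (\<lambda>u. (1/2) * (\<Sum>i<N. \<bar>u \<bullet> x i\<bar>))"
proof (rule eq_support_body)
  show "closed (zonotope x N)" by (rule compact_imp_closed[OF compact_zonotope])
  show "convex (zonotope x N)" by (rule convex_zonotope)
  show "a \<bullet> u \<le> (1/2) * (\<Sum>i<N. \<bar>u \<bullet> x i\<bar>)" if "a \<in> zonotope x N" for a u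
    using that
  proof (induction N arbitrary: a)
    case (Suc N)
    then obtain b s where b: "b \<in> zonotope x N" "s \<in> {-1/2..1/2}" "a = b + s *\<^sub>R x N"
      by (auto simp: add_segment_def)
    have "s * (x N \<bullet> u) \<le> \<bar>s\<bar> * \<bar>x N \<bullet> u\<bar>" by (metis abs_ge_self abs_mult)
    also have "\<dots> \<le> (1/2) * \<bar>x N \<bullet> u\<bar>" using b(2) by (intro mult_right_mono) auto
    finally show ?case using Suc.IH[OF b(1)] b(3)
      by (simp add: inner_commute inner_right_distrib)
  qed simp
  have "\<exists>a\<in>zonotope x N. a \<bullet> u = (1/2) * (\<Sum>i<N. \<bar>u \<bullet> x i\<bar>)" for u
  proof (induction N)
    case (Suc N)
    then obtain b where b: "b \<in> zonotope x N" "b \<bullet> u = (1/2) * (\<Sum>i<N. \<bar>u \<bullet> x i\<bar>)" by auto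
    \<comment> \<open>The sign selects the end of the new segment that maximises \<open>u\<close>,
      or its midpoint if the segment is orthogonal to \<open>u\<close>.\<close>
    let ?s = "sgn (u \<bullet> x N) / 2"
    have "b + ?s *\<^sub>R x N \<in> zonotope x (Suc N)"
      using b(1) unfolding zonotope.simps add_segment_def
      by (intro image_eqI[where x="(b, ?s)"]) (auto simp: sgn_real_def)
    moreover have "(b + ?s *\<^sub>R x N) \<bullet> u = (1/2) * (\<Sum>i<Suc N. \<bar>u \<bullet> x i\<bar>)"
      using b(2) by (simp add: inner_commute inner_right_distrib abs_sgn mult.commute)
    ultimately show ?case by blast
  qed simp
  then show "\<exists>a\<in>zonotope x N. (1/2) * (\<Sum>i<N. \<bar>u \<bullet> x i\<bar>) - e \<le> a \<bullet> u" if "0 < e" for u e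
    using that by (metis diff_ge_0_iff_ge diff_diff_eq2 add_diff_cancel_left' less_imp_le)
qed

text \<open>A compact set fits into a cube, and the cube is a zonotope: the segment of
  \<open>2 * R\<close> times a basis vector reaches from \<open>- R\<close> to \<open>R\<close>. Its
  volume is finite by the zonotope formula.\<close>

lemma coord_volume_less_top:
  fixes f :: "'i \<Rightarrow> 'a::euclidean_space"
  assumes "finite I" "compact A"
  shows "coord_volume I f A < \<top>"
proof -
  obtain e :: "nat \<Rightarrow> 'a" where e: "bij_betw e {..<DIM('a)} Basis"
    using ex_bij_betw_nat_finite[OF finite_Basis] by (auto simp: atLeast0LessThan)
  obtain R where R: "\<And>x. x \<in> A \<Longrightarrow> norm x \<le> R"
    using compact_imp_bounded[OF assms(2)] unfolding bounded_iff by auto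
  have "A \<subseteq> zonotope (\<lambda>i. (2 * R) *\<^sub>R e i) DIM('a)"
    unfolding zonotope_eq_support_body support_body_def
  proof (intro subsetI CollectI allI)
    fix x u assume x: "x \<in> A"
    have "x \<bullet> u = (\<Sum>b\<in>Basis. (x \<bullet> b) * (u \<bullet> b))" by (rule euclidean_inner)
    also have "\<dots> \<le> (\<Sum>b\<in>Basis. R * \<bar>u \<bullet> b\<bar>)"
    proof (intro sum_mono)
      fix b :: 'a assume "b \<in> Basis"
      then have "\<bar>x \<bullet> b\<bar> \<le> R" using R[OF x] Basis_le_norm order_trans by blast
      then have "\<bar>x \<bullet> b\<bar> * \<bar>u \<bullet> b\<bar> \<le> R * \<bar>u \<bullet> b\<bar>" by (intro mult_right_mono) auto
      then show "(x \<bullet> b) * (u \<bullet> b) \<le> R * \<bar>u \<bullet> b\<bar>" by (metis abs_ge_self abs_mult order_trans)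
    qed
    also have "\<dots> = (1/2) * (\<Sum>b\<in>Basis. \<bar>u \<bullet> (2 * R) *\<^sub>R b\<bar>)"
      using order_trans[OF norm_ge_zero R[OF x]] by (simp add: sum_distrib_left abs_mult)
    also have "(\<Sum>b\<in>Basis. \<bar>u \<bullet> (2 * R) *\<^sub>R b\<bar>) = (\<Sum>i<DIM('a). \<bar>u \<bullet> (2 * R) *\<^sub>R e i\<bar>)"
      by (rule sum.reindex_bij_betw[OF e, symmetric])
    finally show "x \<bullet> u \<le> (1/2) * (\<Sum>i<DIM('a). \<bar>u \<bullet> (2 * R) *\<^sub>R e i\<bar>)" .
  qed
  then have "coord_volume I f A \<le> coord_volume I f (zonotope (\<lambda>i. (2 * R) *\<^sub>R e i) DIM('a))"
    by (rule coord_volume_mono)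
  also have "\<dots> < \<top>" using assms(1) by (simp add: coord_volume_zonotope)
  finally show ?thesis .
qed

text \<open>Continuity from above. Images need not commute with intersections, but by compactness
  preimages of \<open>t\<close> in the sets \<open>A m\<close> cluster at a point common to all of
  them. The indicators therefore converge pointwise, dominated by the one of
  \<open>A 0\<close>.\<close>

lemma coord_volume_INF:
  fixes A :: "nat \<Rightarrow> 'a::euclidean_space set"
  assumes I: "finite I" and A: "\<And>m. compact (A m)" "decseq A"
    and L: "\<And>m. L \<le> coord_volume I f (A m)"
  shows "L \<le> coord_volume I f (\<Inter>m. A m)"
proof -
  let ?P = "PiM I (\<lambda>_. lborel :: real measure)"
  have "(\<lambda>m. coord_volume I f (A m)) \<longlonglongrightarrow> coord_volume I f (\<Inter>m. A m)"
    unfolding coord_volume_def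
  proof (rule nn_integral_dominated_convergence[where w="\<lambda>t. indicator (coord_image I f (A 0)) t"])
    show "(\<integral>\<^sup>+t. indicator (coord_image I f (A 0)) t \<partial>?P) < \<infinity>"
      using coord_volume_less_top[OF I A(1)[of 0]] by (simp add: coord_volume_def)
    show "(\<lambda>t. indicator (coord_image I f (A m)) t :: ennreal) \<in> borel_measurable ?P" for m
      by (rule borel_measurable_coord_image[OF I A(1)])
    show "(\<lambda>t. indicator (coord_image I f (A 0)) t :: ennreal) \<in> borel_measurable ?P"
      by (rule borel_measurable_coord_image[OF I A(1)])
    show "(\<lambda>t. indicator (coord_image I f (\<Inter>m. A m)) t :: ennreal) \<in> borel_measurable ?P"
      by (rule borel_measurable_coord_image[OF I]) (intro compact_Inter, use A in auto)
    show "AE t in ?P. indicator (coord_image I f (A m)) t \<le> (indicator (coord_image I f (A 0)) t :: ennreal)" for m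
      using decseqD[OF A(2), of 0 m] by (auto simp: indicator_def coord_image_def)
    have "(\<lambda>m. indicator (coord_image I f (A m)) t :: ennreal) \<longlonglongrightarrow> indicator (coord_image I f (\<Inter>m. A m)) t" for t
    proof (cases "\<forall>m. t \<in> coord_image I f (A m)")
      case True
      then obtain x where x: "\<And>m. x m \<in> A m" "\<And>m i. i \<in> I \<Longrightarrow> f i \<bullet> x m = t i"
        unfolding coord_image_def by (auto) metis
      have "x m \<in> A 0" for m using x(1)[of m] decseqD[OF A(2), of 0 m] by auto
      then obtain y r where y: "y \<in> A 0" "strict_mono r" "(x \<circ> r) \<longlonglongrightarrow> y"
        using A(1)[of 0] unfolding compact_def by metis
      have "y \<in> A m" for m
      proof (rule closed_sequentially[OF compact_imp_closed[OF A(1)]])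
        show "(\<lambda>k. (x \<circ> r) (k + m)) \<longlonglongrightarrow> y" by (rule LIMSEQ_ignore_initial_segment[OF y(3)])
        show "(x \<circ> r) (k + m) \<in> A m" for k
          using x(1)[of "r (k + m)"] decseqD[OF A(2), of m "r (k + m)"] seq_suble[OF y(2), of "k + m"] by auto
      qed
      moreover have "f i \<bullet> y = t i" if "i \<in> I" for i
      proof (rule LIMSEQ_unique)
        show "(\<lambda>k. f i \<bullet> (x \<circ> r) k) \<longlonglongrightarrow> f i \<bullet> y" by (intro tendsto_intros y)
        show "(\<lambda>k. f i \<bullet> (x \<circ> r) k) \<longlonglongrightarrow> t i" using x(2)[OF that] by simp
      qed
      ultimately have "t \<in> coord_image I f (\<Inter>m. A m)" unfolding coord_image_def by auto
      with True show ?thesis by simp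
    next
      case False
      then obtain m where m: "t \<notin> coord_image I f (A m)" by auto
      have "t \<notin> coord_image I f (A k)" if "m \<le> k" for k
        using m decseqD[OF A(2) that] by (auto simp: coord_image_def)
      then have "\<forall>\<^sub>F k in sequentially. indicator (coord_image I f (A k)) t = (0 :: ennreal)"
        by (auto simp: eventually_sequentially intro!: exI[of _ m])
      moreover have "t \<notin> coord_image I f (\<Inter>m. A m)"
        using m by (auto simp: coord_image_def)
      ultimately show ?thesis by (simp add: tendsto_eventually)
    qed
    then show "AE t in ?P. (\<lambda>m. indicator (coord_image I f (A m)) t :: ennreal) \<longlonglongrightarrow> indicator (coord_image I f (\<Inter>m. A m)) t"
      by simp
  qed
  then show ?thesis by (rule LIMSEQ_le_const) (use L in auto)
qed

section \<open>Bounds for determinants and their sums\<close>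

definition det_bound :: "'i set \<Rightarrow> ('i \<Rightarrow> 'a::euclidean_space) \<Rightarrow> real" where
  "det_bound I f = (\<Sum>p | p permutes I. \<Prod>i\<in>I. norm (f i))"

lemma det_bound_nonneg: "0 \<le> det_bound I f"
  unfolding det_bound_def by (intro sum_nonneg prod_nonneg) auto

lemma abs_detI_le:
  assumes "finite I"
  shows "\<bar>detI I (\<lambda>i j. f i \<bullet> v j)\<bar> \<le> det_bound I f * (\<Prod>j\<in>I. norm (v j))"
proof -
  have "\<bar>detI I (\<lambda>i j. f i \<bullet> v j)\<bar> \<le> (\<Sum>p | p permutes I. \<bar>of_int (sign p) * (\<Prod>i\<in>I. f i \<bullet> v (p i))\<bar>)"
    unfolding detI_def by (rule sum_abs)
  also have "\<dots> \<le> (\<Sum>p | p permutes I. (\<Prod>i\<in>I. norm (f i)) * (\<Prod>j\<in>I. norm (v j)))"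
  proof (intro sum_mono)
    fix p assume "p \<in> {p. p permutes I}"
    then have p: "p permutes I" by simp
    have "\<bar>of_int (sign p) * (\<Prod>i\<in>I. f i \<bullet> v (p i))\<bar> = (\<Prod>i\<in>I. \<bar>f i \<bullet> v (p i)\<bar>)"
      by (simp add: abs_mult sign_def abs_prod)
    also have "\<dots> \<le> (\<Prod>i\<in>I. norm (f i) * norm (v (p i)))"
      by (intro prod_mono conjI Cauchy_Schwarz_ineq2) auto
    also have "\<dots> = (\<Prod>i\<in>I. norm (f i)) * (\<Prod>i\<in>I. norm (v (p i)))"
      by (rule prod.distrib)
    also have "(\<Prod>i\<in>I. norm (v (p i))) = (\<Prod>j\<in>I. norm (v j))"
      using prod.permute[OF p, of "\<lambda>j. norm (v j)"] by (simp add: comp_def)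
    finally show "\<bar>of_int (sign p) * (\<Prod>i\<in>I. f i \<bullet> v (p i))\<bar> \<le> (\<Prod>i\<in>I. norm (f i)) * (\<Prod>j\<in>I. norm (v j))" .
  qed
  finally show ?thesis by (simp add: det_bound_def sum_distrib_right)
qed

lemma detI_scale_cols:
  "detI I (\<lambda>i j. c j * A i j) = (\<Prod>j\<in>I. c j) * detI I A"
proof -
  have "of_int (sign p) * (\<Prod>i\<in>I. c (p i) * A i (p i)) = (\<Prod>j\<in>I. c j) * (of_int (sign p) * (\<Prod>i\<in>I. A i (p i)))"
    if "p permutes I" for p
    using prod.permute[OF that, of c] by (simp add: prod.distrib comp_def)
  then show ?thesis by (simp add: detI_def sum_distrib_left mult.left_commute)
qed

text \<open>Further vectors only add tuples. Bounding each determinant by a product of norms and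
  expanding the powers into tuples gives a difference of powers, which is small when the total
  length of the added vectors is small.\<close>

lemma det_sum_increment_le:
  assumes "finite I" "N \<le> N'"
  shows "det_sum I f x N' - det_sum I f x N
    \<le> det_bound I f * ((\<Sum>i<N'. norm (x i)) ^ card I - (\<Sum>i<N. norm (x i)) ^ card I)"
proof -
  let ?G = "\<lambda>s. \<bar>detI I (\<lambda>i j. f i \<bullet> x (s j))\<bar>"
  let ?H = "\<lambda>s. \<Prod>j\<in>I. norm (x (s j))"
  have sub: "(I \<rightarrow>\<^sub>E {..<N}) \<subseteq> (I \<rightarrow>\<^sub>E {..<N'})" using assms(2) by (intro PiE_mono) auto
  have fin: "finite (I \<rightarrow>\<^sub>E {..<N'})" using assms(1) by (intro finite_PiE) auto
  have pw: "(\<Sum>i<n. norm (x i)) ^ card I = sum ?H (I \<rightarrow>\<^sub>E {..<n})" for n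
    using prod_sum_PiE[OF assms(1), of "\<lambda>_. {..<n}" "\<lambda>_ i. norm (x i)"] by simp
  have "det_sum I f x N' - det_sum I f x N = sum ?G ((I \<rightarrow>\<^sub>E {..<N'}) - (I \<rightarrow>\<^sub>E {..<N}))"
    unfolding det_sum_def using sum_diff[OF fin sub, of ?G] by simp
  also have "\<dots> \<le> (\<Sum>s\<in>(I \<rightarrow>\<^sub>E {..<N'}) - (I \<rightarrow>\<^sub>E {..<N}). det_bound I f * ?H s)"
    by (intro sum_mono abs_detI_le assms)
  also have "\<dots> = det_bound I f * sum ?H ((I \<rightarrow>\<^sub>E {..<N'}) - (I \<rightarrow>\<^sub>E {..<N}))"
    by (rule sum_distrib_left[symmetric])
  also have "sum ?H ((I \<rightarrow>\<^sub>E {..<N'}) - (I \<rightarrow>\<^sub>E {..<N}))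
      = (\<Sum>i<N'. norm (x i)) ^ card I - (\<Sum>i<N. norm (x i)) ^ card I"
    unfolding pw by (rule sum_diff[OF fin sub])
  finally show ?thesis .
qed

section \<open>Vitale's volume formula\<close>

lemma borel_measurable_detI:
  assumes "\<And>i j. i \<in> I \<Longrightarrow> j \<in> I \<Longrightarrow> (\<lambda>w. A w i j) \<in> borel_measurable M"
  shows "(\<lambda>w. detI I (A w)) \<in> borel_measurable M"
  unfolding detI_def
  by (intro borel_measurable_sum borel_measurable_times borel_measurable_prod borel_measurable_const)
    (use assms in \<open>auto simp: permutes_in_image\<close>)

lemma borel_measurable_detI_inner:
  fixes f :: "'i \<Rightarrow> 'a::euclidean_space"
  assumes "sets \<mu> = sets borel" "s \<in> borel_measurable borel"
  shows "(\<lambda>v. detI I (\<lambda>i j. f i \<bullet> s (v j))) \<in> borel_measurable (PiM I (\<lambda>_. \<mu>))"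
proof (rule borel_measurable_detI)
  fix i j assume "i \<in> I" "j \<in> I"
  then have "(\<lambda>v. v j) \<in> measurable (PiM I (\<lambda>_. \<mu>)) \<mu>" by (intro measurable_component_singleton)
  moreover have "(\<lambda>z. f i \<bullet> s z) \<in> borel_measurable \<mu>"
    using assms by (simp cong: measurable_cong_sets)
  ultimately show "(\<lambda>v. f i \<bullet> s (v j)) \<in> borel_measurable (PiM I (\<lambda>_. \<mu>))"
    by (rule measurable_compose)
qed

lemma product_sigma_finite_prob: "prob_space \<mu> \<Longrightarrow> product_sigma_finite (\<lambda>_. \<mu>)"
  by (simp add: product_sigma_finite_def prob_space_imp_sigma_finite)

text \<open>If \<open>s\<close> takes the value \<open>y i\<close> with probability
  \<open>p i\<close>, its Vitale zonoid is the zonotope of the vectors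
  \<open>p i *\<^sub>R y i\<close>: homogeneity absorbs the probabilities into the segments. For the
  determinants, the product measure gives products of probabilities, and multilinearity absorbs them
  in the same way.\<close>

lemma simple_function_atoms:
  fixes s :: "'a::euclidean_space \<Rightarrow> 'a" and f :: "'i \<Rightarrow> 'a"
  assumes "prob_space \<mu>" and sets: "sets \<mu> = sets borel" and s: "simple_function \<mu> s" and I: "finite I"
  obtains N x where "\<And>u. (\<Sum>i<N. \<bar>u \<bullet> x i\<bar>) = (\<integral>v. \<bar>u \<bullet> s v\<bar> \<partial>\<mu>)"
    and "(\<Sum>i<N. norm (x i)) = (\<integral>v. norm (s v) \<partial>\<mu>)"
    and "det_sum I f x N = (\<integral>v. \<bar>detI I (\<lambda>i j. f i \<bullet> s (v j))\<bar> \<partial>PiM I (\<lambda>_. \<mu>))"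
proof -
  interpret \<mu>: prob_space \<mu> by fact
  interpret P: product_sigma_finite "\<lambda>_. \<mu>" by (rule product_sigma_finite_prob[OF assms(1)])
  have sp: "space \<mu> = UNIV" using sets_eq_imp_space_eq[OF sets] by simp
  have "finite (range s)" using simple_functionD(1)[OF s] sp by simp
  then obtain y :: "nat \<Rightarrow> 'a" where y: "bij_betw y {..<card (range s)} (range s)"
    using ex_bij_betw_nat_finite[of "range s"] by (auto simp: atLeast0LessThan)
  define N where "N = card (range s)"
  define B where "B = (\<lambda>i. s -` {y i})"
  define p where "p = (\<lambda>i. measure \<mu> (B i))"
  define x where "x = (\<lambda>i. p i *\<^sub>R y i)"
  have y': "inj_on y {..<N}" "y ` {..<N} = range s" using y by (auto simp: N_def bij_betw_def)
  have B [measurable]: "B i \<in> sets \<mu>" for i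
    using simple_functionD(2)[OF s, of "{y i}"] sp by (simp add: B_def)
  have ind: "integrable \<mu> (indicator (B i) :: 'a \<Rightarrow> real)" for i
    by (intro integrable_real_indicator B) (simp add: less_top[symmetric])
  have ind_int: "(\<integral>v. indicator (B i) v \<partial>\<mu>) = p i" for i by (simp add: p_def sp)
  have p0: "p i \<ge> 0" for i by (simp add: p_def)
  have idx: "\<exists>i<N. s v = y i" for v using y'(2) by (metis imageE lessThan_iff rangeI)
  have ind_eq: "indicator (B i) v = (if i = k then 1 else 0 :: real)" if "i < N" "k < N" "s v = y k" for i k v
    using that y'(1) by (auto simp: B_def indicator_def inj_on_def)
  have int: "(\<integral>v. g (s v) \<partial>\<mu>) = (\<Sum>i<N. p i * g (y i))" for g :: "'a \<Rightarrow> real"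
  proof -
    have "g (s v) = (\<Sum>i<N. indicator (B i) v * g (y i))" for v
    proof -
      obtain k where k: "k < N" "s v = y k" using idx by blast
      then have "(\<Sum>i<N. indicator (B i) v * g (y i)) = (\<Sum>i<N. if i = k then g (y i) else 0)"
        by (intro sum.cong refl) (auto simp: ind_eq)
      with k show ?thesis by simp
    qed
    then have "(\<integral>v. g (s v) \<partial>\<mu>) = (\<integral>v. (\<Sum>i<N. indicator (B i) v * g (y i)) \<partial>\<mu>)" by presburger
    also have "\<dots> = (\<Sum>i<N. (\<integral>v. indicator (B i) v * g (y i) \<partial>\<mu>))"
      by (intro Bochner_Integration.integral_sum integrable_mult_left ind)
    finally show ?thesis by (simp add: p_def)
  qed
  have "det_sum I f x N = (\<integral>v. \<bar>detI I (\<lambda>i j. f i \<bullet> s (v j))\<bar> \<partial>PiM I (\<lambda>_. \<mu>))"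
  proof -
    let ?F = "I \<rightarrow>\<^sub>E {..<N}"
    let ?d = "\<lambda>t. \<bar>detI I (\<lambda>i j. f i \<bullet> y (t j))\<bar>"
    have fin: "finite ?F" using I by (intro finite_PiE) auto
    \<comment> \<open>At every point exactly one tuple of atoms has all its indicators equal to
      one.\<close>
    have e: "\<bar>detI I (\<lambda>i j. f i \<bullet> s (v j))\<bar> = (\<Sum>t\<in>?F. (\<Prod>j\<in>I. indicator (B (t j)) (v j)) * ?d t)" for v
    proof -
      have "\<exists>k. \<forall>j. k j < N \<and> s (v j) = y (k j)" using idx by (intro choice) blast
      then obtain k where k: "\<And>j. k j < N" "\<And>j. s (v j) = y (k j)" by blast
      define k' where "k' = restrict k I"
      have k'F: "k' \<in> ?F" using k by (auto simp: k'_def)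
      have "(\<Prod>j\<in>I. indicator (B (t j)) (v j)) = (if t = k' then 1 else 0 :: real)" if t: "t \<in> ?F" for t
      proof (cases "t = k'")
        case True
        then show ?thesis using k by (auto simp: k'_def B_def intro!: prod.neutral)
      next
        case False
        have "\<exists>j\<in>I. t j \<noteq> k' j" using False PiE_ext[OF t k'F] by auto
        then obtain j where j: "j \<in> I" "t j \<noteq> k j" by (auto simp: k'_def)
        moreover have "t j < N" using t j(1) by auto
        ultimately have "indicator (B (t j)) (v j) = (0::real)" using k by (subst ind_eq[of _ "k j"]) auto
        with j(1) I False show ?thesis by (auto simp: prod_zero_iff)
      qed
      then have "(\<Sum>t\<in>?F. (\<Prod>j\<in>I. indicator (B (t j)) (v j)) * ?d t) = (\<Sum>t\<in>?F. if t = k' then ?d t else 0)"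
        by (intro sum.cong refl) auto
      also have "\<dots> = ?d k'" using fin k'F by simp
      also have "\<dots> = \<bar>detI I (\<lambda>i j. f i \<bullet> s (v j))\<bar>"
        using k by (intro arg_cong[where f=abs] detI_cong) (auto simp: k'_def)
      finally show ?thesis by simp
    qed
    have "(\<integral>v. \<bar>detI I (\<lambda>i j. f i \<bullet> s (v j))\<bar> \<partial>PiM I (\<lambda>_. \<mu>))
        = (\<Sum>t\<in>?F. (\<integral>v. (\<Prod>j\<in>I. indicator (B (t j)) (v j)) * ?d t \<partial>PiM I (\<lambda>_. \<mu>)))"
      unfolding e
      by (intro Bochner_Integration.integral_sum integrable_mult_left P.product_integrable_prod I ind)
    also have "\<dots> = (\<Sum>t\<in>?F. (\<Prod>j\<in>I. p (t j)) * ?d t)"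
    proof (intro sum.cong refl)
      fix t
      have "(\<integral>v. (\<Prod>j\<in>I. indicator (B (t j)) (v j)) \<partial>PiM I (\<lambda>_. \<mu>)) = (\<Prod>j\<in>I. p (t j))"
        using P.product_integral_prod[OF I, of "\<lambda>j. indicator (B (t j)) :: 'a \<Rightarrow> real", OF ind]
        by (simp add: p_def sp)
      then show "(\<integral>v. (\<Prod>j\<in>I. indicator (B (t j)) (v j)) * ?d t \<partial>PiM I (\<lambda>_. \<mu>)) = (\<Prod>j\<in>I. p (t j)) * ?d t"
        by simp
    qed
    also have "\<dots> = det_sum I f x N"
      unfolding det_sum_def
    proof (intro sum.cong refl)
      fix t
      have "detI I (\<lambda>i j. f i \<bullet> x (t j)) = (\<Prod>j\<in>I. p (t j)) * detI I (\<lambda>i j. f i \<bullet> y (t j))"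
        unfolding detI_scale_cols[symmetric] by (simp add: x_def)
      then show "(\<Prod>j\<in>I. p (t j)) * ?d t = \<bar>detI I (\<lambda>i j. f i \<bullet> x (t j))\<bar>"
        using p0 by (simp add: abs_mult abs_prod)
    qed
    finally show ?thesis by simp
  qed
  moreover have "(\<Sum>i<N. \<bar>u \<bullet> x i\<bar>) = (\<integral>v. \<bar>u \<bullet> s v\<bar> \<partial>\<mu>)" for u
    using p0 by (simp add: int[of "\<lambda>z. \<bar>u \<bullet> z\<bar>"] x_def abs_mult)
  moreover have "(\<Sum>i<N. norm (x i)) = (\<integral>v. norm (s v) \<partial>\<mu>)"
    using p0 by (simp add: int[of norm] x_def)
  ultimately show thesis by (intro that[of x N])
qed

lemma abs_inner_le_sum_Basis:
  fixes u z :: "'a::euclidean_space"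
  assumes "norm z \<le> e"
  shows "\<bar>u \<bullet> z\<bar> \<le> e * (\<Sum>b\<in>Basis. \<bar>u \<bullet> b\<bar>)"
proof -
  have "\<bar>u \<bullet> z\<bar> \<le> norm z * norm u" using Cauchy_Schwarz_ineq2[of z u] by (simp add: inner_commute)
  also have "\<dots> \<le> e * (\<Sum>b\<in>Basis. \<bar>u \<bullet> b\<bar>)"
    using assms order_trans[OF norm_ge_zero assms] by (intro mult_mono norm_le_l1) auto
  finally show ?thesis .
qed

text \<open>The L1 error of \<open>s\<close> is weighed by the support function of a cube, the sum
  of \<open>\<bar>u \<bullet> b\<bar>\<close>, which dominates \<open>norm u\<close>. Unlike a ball,
  a cube is a zonotope, so the zonotope of \<open>s\<close> enlarged by it is again a zonotope with
  an explicit volume. The enlargement lies around the zonotope of \<open>s\<close> in the upper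
  bound and around the zonoid in the lower one.\<close>

lemma simple_function_sandwich:
  fixes s :: "'a::euclidean_space \<Rightarrow> 'a" and f :: "'i \<Rightarrow> 'a" and \<epsilon> m D :: real
  assumes prob: "prob_space \<mu>" and sets: "sets \<mu> = sets borel" and s: "simple_function \<mu> s" and I: "finite I"
    and int: "integrable \<mu> (\<lambda>v. v)"
  defines "h \<equiv> \<lambda>\<delta> u. (1/2) * (\<integral>v. \<bar>u \<bullet> v\<bar> \<partial>\<mu>) + \<delta> * (\<Sum>b\<in>Basis. \<bar>u \<bullet> b\<bar>)"
    and "\<epsilon> \<equiv> \<integral>v. norm (s v - v) \<partial>\<mu>" and "m \<equiv> \<integral>v. norm (s v) \<partial>\<mu>"
    and "D \<equiv> \<integral>v. \<bar>detI I (\<lambda>i j. f i \<bullet> s (v j))\<bar> \<partial>PiM I (\<lambda>_. \<mu>)"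
  shows "ennreal (D / fact (card I)) \<le> coord_volume I f (support_body (h (\<epsilon> / 2)))"
    and "coord_volume I f (support_body (h 0))
      \<le> ennreal ((D + det_bound I f * ((m + DIM('a) * \<epsilon>) ^ card I - m ^ card I)) / fact (card I))"
proof -
  interpret \<mu>: prob_space \<mu> by fact
  obtain N x where x: "\<And>u. (\<Sum>i<N. \<bar>u \<bullet> x i\<bar>) = (\<integral>v. \<bar>u \<bullet> s v\<bar> \<partial>\<mu>)"
      "(\<Sum>i<N. norm (x i)) = m" "det_sum I f x N = D"
    using simple_function_atoms[OF prob sets s I, of f] unfolding m_def D_def by metis
  have s_int: "integrable \<mu> s"
    by (rule integrable_simple_function) (use s in auto)
  have ids: "integrable \<mu> (\<lambda>v. norm (s v - v))" using s_int int by auto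
  have e0: "\<epsilon> \<ge> 0" by (simp add: \<epsilon>_def)
  have diff: "\<bar>(\<integral>v. \<bar>u \<bullet> s v\<bar> \<partial>\<mu>) - (\<integral>v. \<bar>u \<bullet> v\<bar> \<partial>\<mu>)\<bar> \<le> \<epsilon> * (\<Sum>b\<in>Basis. \<bar>u \<bullet> b\<bar>)" for u
  proof -
    have i1: "integrable \<mu> (\<lambda>v. \<bar>u \<bullet> s v\<bar>)" "integrable \<mu> (\<lambda>v. \<bar>u \<bullet> v\<bar>)" using s_int int by auto
    then have "\<bar>(\<integral>v. \<bar>u \<bullet> s v\<bar> \<partial>\<mu>) - (\<integral>v. \<bar>u \<bullet> v\<bar> \<partial>\<mu>)\<bar> = \<bar>\<integral>v. \<bar>u \<bullet> s v\<bar> - \<bar>u \<bullet> v\<bar> \<partial>\<mu>\<bar>"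
      by simp
    also have "\<dots> \<le> (\<integral>v. \<bar>\<bar>u \<bullet> s v\<bar> - \<bar>u \<bullet> v\<bar>\<bar> \<partial>\<mu>)"
      using integral_norm_bound[of \<mu> "\<lambda>v. \<bar>u \<bullet> s v\<bar> - \<bar>u \<bullet> v\<bar>"] by simp
    also have "\<dots> \<le> (\<integral>v. norm (s v - v) * (\<Sum>b\<in>Basis. \<bar>u \<bullet> b\<bar>) \<partial>\<mu>)"
    proof (intro integral_mono)
      show "integrable \<mu> (\<lambda>v. \<bar>\<bar>u \<bullet> s v\<bar> - \<bar>u \<bullet> v\<bar>\<bar>)" using i1 by auto
      show "integrable \<mu> (\<lambda>v. norm (s v - v) * (\<Sum>b\<in>Basis. \<bar>u \<bullet> b\<bar>))" using ids by auto
      fix v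
      have "\<bar>\<bar>u \<bullet> s v\<bar> - \<bar>u \<bullet> v\<bar>\<bar> \<le> \<bar>u \<bullet> (s v - v)\<bar>" by (simp add: inner_diff_right)
      also have "\<dots> \<le> norm (s v - v) * (\<Sum>b\<in>Basis. \<bar>u \<bullet> b\<bar>)" by (rule abs_inner_le_sum_Basis) simp
      finally show "\<bar>\<bar>u \<bullet> s v\<bar> - \<bar>u \<bullet> v\<bar>\<bar> \<le> norm (s v - v) * (\<Sum>b\<in>Basis. \<bar>u \<bullet> b\<bar>)" .
    qed
    also have "\<dots> = \<epsilon> * (\<Sum>b\<in>Basis. \<bar>u \<bullet> b\<bar>)" by (simp add: \<epsilon>_def)
    finally show ?thesis .
  qed
  have "zonotope x N \<subseteq> support_body (h (\<epsilon> / 2))"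
    unfolding zonotope_eq_support_body x(1)
  proof (intro support_body_mono)
    fix u show "(1/2) * (\<integral>v. \<bar>u \<bullet> s v\<bar> \<partial>\<mu>) \<le> h (\<epsilon> / 2) u"
      using diff[of u] by (simp add: h_def)
  qed
  from coord_volume_mono[OF this, of I f]
  show "ennreal (D / fact (card I)) \<le> coord_volume I f (support_body (h (\<epsilon> / 2)))"
    by (simp add: coord_volume_zonotope I x(3))
  obtain e :: "nat \<Rightarrow> 'a" where e: "bij_betw e {..<DIM('a)} Basis"
    using ex_bij_betw_nat_finite[OF finite_Basis] by (auto simp: atLeast0LessThan)
  \<comment> \<open>One further segment of length \<open>\<epsilon>\<close> per basis direction, so
    the total length grows by \<open>DIM('a) * \<epsilon>\<close>.\<close>
  define x' where "x' = (\<lambda>i. if i < N then x i else \<epsilon> *\<^sub>R e (i - N))"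
  have split: "(\<Sum>i<N + DIM('a). g (x' i)) = (\<Sum>i<N. g (x i)) + (\<Sum>b\<in>Basis. g (\<epsilon> *\<^sub>R b))" for g :: "'a \<Rightarrow> real"
  proof -
    have "(\<Sum>i<N + DIM('a). g (x' i)) = (\<Sum>i<N. g (x' i)) + (\<Sum>i=N..<N + DIM('a). g (x' i))"
      by (metis atLeast0LessThan le0 le_add1 sum.atLeastLessThan_concat)
    also have "(\<Sum>i=N..<N + DIM('a). g (x' i)) = (\<Sum>i<DIM('a). g (\<epsilon> *\<^sub>R e i))"
      by (rule sum.reindex_bij_witness[where i="\<lambda>i. i + N" and j="\<lambda>i. i - N"]) (auto simp: x'_def)
    also have "\<dots> = (\<Sum>b\<in>Basis. g (\<epsilon> *\<^sub>R b))" by (rule sum.reindex_bij_betw[OF e])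
    finally show ?thesis by (simp add: x'_def)
  qed
  have "support_body (h 0) \<subseteq> zonotope x' (N + DIM('a))"
    unfolding zonotope_eq_support_body
  proof (intro support_body_mono)
    fix u
    have "(\<Sum>i<N + DIM('a). \<bar>u \<bullet> x' i\<bar>) = (\<integral>v. \<bar>u \<bullet> s v\<bar> \<partial>\<mu>) + \<epsilon> * (\<Sum>b\<in>Basis. \<bar>u \<bullet> b\<bar>)"
      using split[of "\<lambda>z. \<bar>u \<bullet> z\<bar>"] e0 by (simp add: x(1) abs_mult sum_distrib_left)
    then show "h 0 u \<le> (1/2) * (\<Sum>i<N + DIM('a). \<bar>u \<bullet> x' i\<bar>)"
      using diff[of u] by (simp add: h_def)
  qed
  then have "coord_volume I f (support_body (h 0)) \<le> coord_volume I f (zonotope x' (N + DIM('a)))"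
    by (rule coord_volume_mono)
  also have "\<dots> = ennreal (det_sum I f x' (N + DIM('a)) / fact (card I))"
    by (rule coord_volume_zonotope[OF I])
  also have "\<dots> \<le> ennreal ((D + det_bound I f * ((m + DIM('a) * \<epsilon>) ^ card I - m ^ card I)) / fact (card I))"
  proof (intro ennreal_leI divide_right_mono)
    have "det_sum I f x' N = det_sum I f x N"
      unfolding det_sum_def
      by (intro sum.cong refl arg_cong[where f=abs] detI_cong) (auto simp: x'_def PiE_iff)
    moreover have "(\<Sum>i<N + DIM('a). norm (x' i)) = m + DIM('a) * \<epsilon>"
      using split[of norm] e0 by (simp add: x(2))
    moreover have "(\<Sum>i<N. norm (x' i)) = m" using x(2) by (simp add: x'_def)
    ultimately show "det_sum I f x' (N + DIM('a)) \<le> D + det_bound I f * ((m + DIM('a) * \<epsilon>) ^ card I - m ^ card I)"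
      using det_sum_increment_le[OF I, of N "N + DIM('a)" f x'] x(3) by simp
  qed simp
  finally show "coord_volume I f (support_body (h 0))
      \<le> ennreal ((D + det_bound I f * ((m + DIM('a) * \<epsilon>) ^ card I - m ^ card I)) / fact (card I))" .
qed

text \<open>The two halves of the sandwich are used differently. The upper bound concerns the zonoid
  itself and passes directly to the limit. The lower bound only controls enlarged bodies, which have
  to be shrunk to the zonoid by continuity from above.\<close>

theorem coord_volume_zonoid:
  fixes f :: "'i \<Rightarrow> 'a::euclidean_space"
  assumes prob: "prob_space \<mu>" and sets: "sets \<mu> = sets borel" and I: "finite I"
    and int: "integrable \<mu> (\<lambda>v. v)"
  shows "coord_volume I f (K0 \<mu> (\<lambda>v. v))
    = ennreal ((\<integral>v. \<bar>detI I (\<lambda>i j. f i \<bullet> v j)\<bar> \<partial>PiM I (\<lambda>_. \<mu>)) / fact (card I))"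
proof -
  interpret \<mu>: prob_space \<mu> by fact
  interpret P: product_sigma_finite "\<lambda>_. \<mu>" by (rule product_sigma_finite_prob[OF prob])
  let ?P = "PiM I (\<lambda>_. \<mu>)"
  have sp: "space \<mu> = UNIV" using sets_eq_imp_space_eq[OF sets] by simp
  have id: "(\<lambda>v. v) \<in> borel_measurable \<mu>" using int by (rule borel_measurable_integrable)
  obtain s :: "nat \<Rightarrow> 'a \<Rightarrow> 'a" where s: "\<And>k. simple_function \<mu> (s k)"
      "\<And>v. (\<lambda>k. s k v) \<longlonglongrightarrow> v" "\<And>k v. norm (s k v) \<le> 2 * norm v"
    using borel_measurable_implies_sequence_metric[OF id, of 0] sp by (auto simp: dist_norm)
  have sm: "s k \<in> borel_measurable borel" for k
    using borel_measurable_simple_function[OF s(1)[of k]] sets by (simp cong: measurable_cong_sets)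
  have sm': "s k \<in> borel_measurable \<mu>" for k by (rule borel_measurable_simple_function[OF s(1)])
  have nint: "integrable \<mu> (\<lambda>v. norm v)" using int by auto
  define h where "h = (\<lambda>\<delta> u. (1/2) * (\<integral>v. \<bar>u \<bullet> v\<bar> \<partial>\<mu>) + \<delta> * (\<Sum>b\<in>Basis. \<bar>u \<bullet> b\<bar>))"
  define \<epsilon> where "\<epsilon> = (\<lambda>k. \<integral>v. norm (s k v - v) \<partial>\<mu>)"
  define m where "m = (\<lambda>k. \<integral>v. norm (s k v) \<partial>\<mu>)"
  define D where "D = (\<lambda>k. \<integral>v. \<bar>detI I (\<lambda>i j. f i \<bullet> s k (v j))\<bar> \<partial>?P)"
  define Dlim where "Dlim = (\<integral>v. \<bar>detI I (\<lambda>i j. f i \<bullet> v j)\<bar> \<partial>?P)"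
  have \<epsilon>: "\<epsilon> \<longlonglongrightarrow> 0"
  proof -
    have "\<epsilon> \<longlonglongrightarrow> (\<integral>v. 0 \<partial>\<mu>)" unfolding \<epsilon>_def
    proof (rule integral_dominated_convergence[where w="\<lambda>v. 3 * norm v"])
      show "AE v in \<mu>. (\<lambda>k. norm (s k v - v)) \<longlonglongrightarrow> 0"
        using s(2) by (intro AE_I2 tendsto_norm_zero) (simp add: LIM_zero)
      show "AE v in \<mu>. norm (norm (s k v - v)) \<le> 3 * norm v" for k
      proof (intro AE_I2)
        fix v
        show "norm (norm (s k v - v)) \<le> 3 * norm v" using norm_triangle_ineq4[of "s k v" v] s(3)[of k v] by simp
      qed
    qed (use nint sm' id in auto)
    then show ?thesis by simp
  qed
  have m: "m \<longlonglongrightarrow> (\<integral>v. norm v \<partial>\<mu>)" unfolding m_def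
  proof (rule integral_dominated_convergence[where w="\<lambda>v. 2 * norm v"])
    show "AE v in \<mu>. (\<lambda>k. norm (s k v)) \<longlonglongrightarrow> norm v"
      using s(2) by (intro AE_I2 tendsto_norm)
    show "AE v in \<mu>. norm (norm (s k v)) \<le> 2 * norm v" for k using s(3) by simp
  qed (use nint sm' id in auto)
  have D: "D \<longlonglongrightarrow> Dlim" unfolding D_def Dlim_def
  proof (rule integral_dominated_convergence[where w="\<lambda>v. det_bound I f * (\<Prod>j\<in>I. 2 * norm (v j))"])
    show "integrable ?P (\<lambda>v. det_bound I f * (\<Prod>j\<in>I. 2 * norm (v j)))"
      using nint by (intro integrable_mult_right P.product_integrable_prod[OF I]) auto
    show "(\<lambda>v. \<bar>detI I (\<lambda>i j. f i \<bullet> s k (v j))\<bar>) \<in> borel_measurable ?P" for k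
      by (intro borel_measurable_abs borel_measurable_detI_inner[OF sets sm])
    show "(\<lambda>v. \<bar>detI I (\<lambda>i j. f i \<bullet> v j)\<bar>) \<in> borel_measurable ?P"
      by (intro borel_measurable_abs borel_measurable_detI_inner[OF sets, where s="\<lambda>v. v"]) simp
    show "AE v in ?P. (\<lambda>k. \<bar>detI I (\<lambda>i j. f i \<bullet> s k (v j))\<bar>) \<longlonglongrightarrow> \<bar>detI I (\<lambda>i j. f i \<bullet> v j)\<bar>"
      unfolding detI_def by (intro AE_I2 tendsto_intros s(2))
    show "AE v in ?P. norm \<bar>detI I (\<lambda>i j. f i \<bullet> s k (v j))\<bar> \<le> det_bound I f * (\<Prod>j\<in>I. 2 * norm (v j))" for k
    proof (intro AE_I2)
      fix v
      have "\<bar>detI I (\<lambda>i j. f i \<bullet> s k (v j))\<bar> \<le> det_bound I f * (\<Prod>j\<in>I. norm (s k (v j)))"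
        by (rule abs_detI_le[OF I])
      also have "\<dots> \<le> det_bound I f * (\<Prod>j\<in>I. 2 * norm (v j))"
        using s(3) by (intro mult_left_mono prod_mono det_bound_nonneg) auto
      finally show "norm \<bar>detI I (\<lambda>i j. f i \<bullet> s k (v j))\<bar> \<le> det_bound I f * (\<Prod>j\<in>I. 2 * norm (v j))" by simp
    qed
  qed
  have h0: "support_body (h 0) = K0 \<mu> (\<lambda>v. v)" by (simp add: h_def K0_eq_support_body)
  have lower: "ennreal (D k / fact (card I)) \<le> coord_volume I f (support_body (h (\<epsilon> k / 2)))" for k
    unfolding D_def h_def \<epsilon>_def by (rule simple_function_sandwich(1)[OF prob sets s(1) I int])
  have upper: "coord_volume I f (support_body (h 0))
      \<le> ennreal ((D k + det_bound I f * ((m k + DIM('a) * \<epsilon> k) ^ card I - m k ^ card I)) / fact (card I))" for k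
    unfolding D_def h_def \<epsilon>_def m_def by (rule simple_function_sandwich(2)[OF prob sets s(1) I int])
  have hmono: "h \<delta> u \<le> h \<delta>' u" if "\<delta> \<le> \<delta>'" for \<delta> \<delta>' u
    using that by (auto simp: h_def intro!: mult_right_mono sum_nonneg)
  have lim1: "(\<lambda>k. ennreal (D k / fact (card I))) \<longlonglongrightarrow> ennreal (Dlim / fact (card I))"
    by (intro tendsto_ennrealI tendsto_divide D tendsto_const) simp
  \<comment> \<open>Each enlargement \<open>1 / Suc n\<close> is kept fixed while \<open>k\<close>
    grows: once \<open>\<epsilon> k\<close> is below it, the body contains the zonotope of
    \<open>s k\<close>. Only then is \<open>n\<close> varied.\<close>
  have "ennreal (Dlim / fact (card I)) \<le> coord_volume I f (\<Inter>n. support_body (h (1 / Suc n)))"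
  proof (rule coord_volume_INF[OF I])
    fix n :: nat
    show "compact (support_body (h (1 / Suc n)))"
    proof (rule compact_support_body)
      fix u
      have "(\<integral>v. \<bar>u \<bullet> v\<bar> \<partial>\<mu>) \<le> (\<integral>v. norm u * norm v \<partial>\<mu>)"
        using int nint by (intro integral_mono Cauchy_Schwarz_ineq2) auto
      then have a: "(\<integral>v. \<bar>u \<bullet> v\<bar> \<partial>\<mu>) \<le> (\<integral>v. norm v \<partial>\<mu>) * norm u" by (simp add: mult.commute)
      have b: "(\<Sum>b\<in>Basis. \<bar>u \<bullet> b\<bar>) \<le> DIM('a) * norm u"
        by (rule sum_bounded_above) (rule Basis_le_norm)
      have "h (1 / Suc n) u \<le> (1/2) * ((\<integral>v. norm v \<partial>\<mu>) * norm u) + (1 / Suc n) * (DIM('a) * norm u)"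
        unfolding h_def by (intro add_mono mult_left_mono a b) auto
      then show "h (1 / Suc n) u \<le> ((1/2) * (\<integral>v. norm v \<partial>\<mu>) + (1 / Suc n) * DIM('a)) * norm u"
        by (simp add: algebra_simps)
    qed
    have "\<forall>\<^sub>F k in sequentially. \<epsilon> k < 1 / Suc n"
      using order_tendstoD(2)[OF \<epsilon>, of "1 / Suc n"] by simp
    then have "\<forall>\<^sub>F k in sequentially. ennreal (D k / fact (card I)) \<le> coord_volume I f (support_body (h (1 / Suc n)))"
    proof eventually_elim
      case (elim k)
      have "0 \<le> \<epsilon> k" by (simp add: \<epsilon>_def)
      with elim have "\<epsilon> k / 2 \<le> 1 / Suc n" by simp
      then show ?case
        by (intro order_trans[OF lower] coord_volume_mono support_body_mono hmono)
    qed
    then show "ennreal (Dlim / fact (card I)) \<le> coord_volume I f (support_body (h (1 / Suc n)))"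
      by (intro tendsto_upperbound[OF lim1]) auto
  next
    show "decseq (\<lambda>n. support_body (h (1 / Suc n)))"
      by (intro decseq_SucI support_body_mono hmono) (auto simp: field_simps)
  qed
  also have "(\<Inter>n. support_body (h (1 / Suc n))) \<subseteq> support_body (h 0)"
  proof
    fix z assume z: "z \<in> (\<Inter>n. support_body (h (1 / Suc n)))"
    have "z \<bullet> u \<le> h 0 u" for u
    proof (rule LIMSEQ_le_const)
      have "(\<lambda>n. (1/2) * (\<integral>v. \<bar>u \<bullet> v\<bar> \<partial>\<mu>) + (1 / Suc n) * (\<Sum>b\<in>Basis. \<bar>u \<bullet> b\<bar>))
          \<longlonglongrightarrow> (1/2) * (\<integral>v. \<bar>u \<bullet> v\<bar> \<partial>\<mu>) + 0 * (\<Sum>b\<in>Basis. \<bar>u \<bullet> b\<bar>)"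
        by (intro tendsto_intros lim_1_over_n[THEN LIMSEQ_Suc])
      then show "(\<lambda>n. h (1 / Suc n) u) \<longlonglongrightarrow> h 0 u" by (simp add: h_def)
      show "\<exists>N. \<forall>n\<ge>N. z \<bullet> u \<le> h (1 / Suc n) u" using z by (auto simp: support_body_def)
    qed
    then show "z \<in> support_body (h 0)" by (simp add: support_body_def)
  qed
  then have "coord_volume I f (\<Inter>n. support_body (h (1 / Suc n))) \<le> coord_volume I f (support_body (h 0))"
    by (rule coord_volume_mono)
  finally have "ennreal (Dlim / fact (card I)) \<le> coord_volume I f (support_body (h 0))" .
  moreover have "coord_volume I f (support_body (h 0)) \<le> ennreal (Dlim / fact (card I))"
  proof (rule LIMSEQ_le_const)
    let ?m = "\<integral>v. norm v \<partial>\<mu>"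
    have "(\<lambda>k. ennreal ((D k + det_bound I f * ((m k + DIM('a) * \<epsilon> k) ^ card I - m k ^ card I)) / fact (card I)))
      \<longlonglongrightarrow> ennreal ((Dlim + det_bound I f * ((?m + DIM('a) * 0) ^ card I - ?m ^ card I)) / fact (card I))"
      by (intro tendsto_ennrealI tendsto_intros D m \<epsilon>) (simp_all add: \<epsilon>)
    then show "(\<lambda>k. ennreal ((D k + det_bound I f * ((m k + DIM('a) * \<epsilon> k) ^ card I - m k ^ card I)) / fact (card I)))
      \<longlonglongrightarrow> ennreal (Dlim / fact (card I))" by simp
  qed (use upper in auto)
  ultimately show ?thesis unfolding h0 Dlim_def by (rule antisym[rotated])
qed

section \<open>Integrals of measurable sections\<close>

text \<open>Membership is demanded at every point of \<open>A\<close>, as in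
  \<open>fiber_body\<close>, even though only almost everywhere matters for the integral. Limits of
  sections must therefore be corrected on null sets.\<close>

definition sections :: "'b measure \<Rightarrow> 'b set \<Rightarrow> ('b \<Rightarrow> 'a::euclidean_space set) \<Rightarrow> ('b \<Rightarrow> 'a) set" where
  "sections \<nu> A G = {\<gamma> \<in> borel_measurable \<nu>. \<forall>x\<in>A. \<gamma> x \<in> G x}"

context finite_measure
begin

lemma integrable_section:
  assumes "AE x in M. x \<in> A" "\<And>x y. x \<in> A \<Longrightarrow> y \<in> G x \<Longrightarrow> norm y \<le> R" "\<gamma> \<in> sections M A G"
  shows "integrable M \<gamma>" and "integrable M (\<lambda>x. (norm (\<gamma> x))\<^sup>2)"
proof -
  have m: "\<gamma> \<in> borel_measurable M" and b: "AE x in M. norm (\<gamma> x) \<le> R"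
    using assms by (auto simp: sections_def elim!: eventually_mono)
  show "integrable M \<gamma>" by (rule integrable_const_bound[OF b m])
  have "AE x in M. norm ((norm (\<gamma> x))\<^sup>2) \<le> R\<^sup>2"
    using b by eventually_elim (simp add: power_mono)
  then show "integrable M (\<lambda>x. (norm (\<gamma> x))\<^sup>2)"
    by (rule integrable_const_bound) (use m in simp)
qed

lemma convex_sections:
  assumes "\<And>x. x \<in> A \<Longrightarrow> convex (G x)" "\<gamma> \<in> sections M A G" "\<delta> \<in> sections M A G"
    and "0 \<le> s" "0 \<le> t" "s + t = 1"
  shows "(\<lambda>x. s *\<^sub>R \<gamma> x + t *\<^sub>R \<delta> x) \<in> sections M A G"
  using assms by (auto simp: sections_def intro: convexD)

lemma convex_section_integrals:
  fixes G :: "'a \<Rightarrow> 'b::euclidean_space set"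
  assumes "AE x in M. x \<in> A" "\<And>x. x \<in> A \<Longrightarrow> convex (G x)"
    and "\<And>x y. x \<in> A \<Longrightarrow> y \<in> G x \<Longrightarrow> norm y \<le> R"
  shows "convex ((\<lambda>\<gamma>. \<integral>x. \<gamma> x \<partial>M) ` sections M A G)"
proof (rule convexI)
  fix p q s t assume "p \<in> (\<lambda>\<gamma>. \<integral>x. \<gamma> x \<partial>M) ` sections M A G" "q \<in> (\<lambda>\<gamma>. \<integral>x. \<gamma> x \<partial>M) ` sections M A G"
    and st: "0 \<le> s" "0 \<le> t" "s + t = (1::real)"
  then obtain \<gamma> \<delta> where g: "\<gamma> \<in> sections M A G" "p = (\<integral>x. \<gamma> x \<partial>M)"
    and d: "\<delta> \<in> sections M A G" "q = (\<integral>x. \<delta> x \<partial>M)" by blast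
  have i: "integrable M \<gamma>" if "\<gamma> \<in> sections M A G" for \<gamma>
    by (rule integrable_section(1)[OF assms(1) assms(3) that])
  have "s *\<^sub>R p + t *\<^sub>R q = (\<integral>x. s *\<^sub>R \<gamma> x + t *\<^sub>R \<delta> x \<partial>M)"
    using i[OF g(1)] i[OF d(1)] by (simp add: g d)
  then show "s *\<^sub>R p + t *\<^sub>R q \<in> (\<lambda>\<gamma>. \<integral>x. \<gamma> x \<partial>M) ` sections M A G"
    using convex_sections[OF assms(2) g(1) d(1) st] by (intro image_eqI)
qed

text \<open>Among the sections whose integral lies within \<open>1 / (n + 1)\<close> of the limit point, choose one
  whose square norm is almost minimal. By the parallelogram law these choices form a Cauchy sequence.\<close>
lemma closed_section_integrals:
  fixes G :: "'a \<Rightarrow> 'b::euclidean_space set"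
  assumes A: "AE x in M. x \<in> A" and G: "\<And>x. x \<in> A \<Longrightarrow> closed (G x)" "\<And>x. x \<in> A \<Longrightarrow> convex (G x)"
    and R: "\<And>x y. x \<in> A \<Longrightarrow> y \<in> G x \<Longrightarrow> norm y \<le> R"
  shows "closed ((\<lambda>\<gamma>. \<integral>x. \<gamma> x \<partial>M) ` sections M A G)"
  unfolding closed_sequential_limits
proof (intro allI impI, elim conjE)
  fix P p assume P: "\<forall>n. P n \<in> (\<lambda>\<gamma>. \<integral>x. \<gamma> x \<partial>M) ` sections M A G" "P \<longlonglongrightarrow> p"
  have int: "integrable M \<gamma>" "integrable M (\<lambda>x. (norm (\<gamma> x))\<^sup>2)" if "\<gamma> \<in> sections M A G" for \<gamma>
    by (rule integrable_section[OF A R that]; assumption)+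
  define q where "q = (\<lambda>\<gamma>::'a \<Rightarrow> 'b. \<integral>x. (norm (\<gamma> x))\<^sup>2 \<partial>M)"
  define C where "C = (\<lambda>n::nat. {\<gamma> \<in> sections M A G. norm ((\<integral>x. \<gamma> x \<partial>M) - p) \<le> 1 / Suc n})"
  define a where "a = (\<lambda>n. Inf (q ` C n))"
  have q0: "0 \<le> q \<gamma>" for \<gamma> by (simp add: q_def)
  have bdd: "bdd_below (q ` C n)" for n by (rule bdd_belowI2[of _ 0]) (rule q0)
  have C_ne: "C n \<noteq> {}" for n
  proof -
    have "\<forall>\<^sub>F k in sequentially. dist (P k) p < 1 / Suc n"
      using P(2) by (rule tendstoD) simp
    then obtain k where "dist (P k) p < 1 / Suc n" by (auto simp: eventually_sequentially)
    moreover obtain \<gamma> where "\<gamma> \<in> sections M A G" "P k = (\<integral>x. \<gamma> x \<partial>M)" using P(1) by blast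
    ultimately have "\<gamma> \<in> C n" by (auto simp: C_def dist_norm)
    then show ?thesis by auto
  qed
  have C_anti: "C k \<subseteq> C n" if "n \<le> k" for n k
  proof -
    have "1 / Suc k \<le> 1 / Suc n" using that by (simp add: frac_le)
    then show ?thesis by (auto simp: C_def)
  qed
  have C_mid: "(\<lambda>x. (1/2) *\<^sub>R \<gamma> x + (1/2) *\<^sub>R \<delta> x) \<in> C n" if "\<gamma> \<in> C n" "\<delta> \<in> C n" for \<gamma> \<delta> n
  proof -
    have s: "\<gamma> \<in> sections M A G" "\<delta> \<in> sections M A G" using that by (auto simp: C_def)
    have "(\<integral>x. (1/2) *\<^sub>R \<gamma> x + (1/2) *\<^sub>R \<delta> x \<partial>M) - p
        = (1/2) *\<^sub>R ((\<integral>x. \<gamma> x \<partial>M) - p) + (1/2) *\<^sub>R ((\<integral>x. \<delta> x \<partial>M) - p)"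
      using int(1)[OF s(1)] int(1)[OF s(2)] by (simp add: algebra_simps flip: scaleR_add_left)
    also have "norm \<dots> \<le> (1/2) * norm ((\<integral>x. \<gamma> x \<partial>M) - p) + (1/2) * norm ((\<integral>x. \<delta> x \<partial>M) - p)"
      by (rule order_trans[OF norm_triangle_ineq]) simp
    also have "\<dots> \<le> 1 / Suc n" using that by (simp add: C_def)
    finally show ?thesis
      using convex_sections[OF G(2) s, of "1/2" "1/2"] by (simp add: C_def)
  qed
  have "\<exists>\<gamma>\<in>C n. q \<gamma> \<le> a n + 1 / Suc n" for n
    using cInf_lessD[of "q ` C n" "a n + 1 / Suc n"] C_ne[of n] by (auto simp: a_def intro: less_imp_le)
  then obtain g where g: "\<And>n. g n \<in> C n" "\<And>n. q (g n) \<le> a n + 1 / Suc n" by metis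
  have gs: "g n \<in> sections M A G" for n using g(1) by (auto simp: C_def)
  note gi = int(1)[OF gs] and gi2 = int(2)[OF gs]
  have a_mono: "a n \<le> a k" if "n \<le> k" for n k
    unfolding a_def using C_anti[OF that] C_ne bdd by (intro cInf_superset_mono image_mono) auto
  have "bdd_above (range a)"
  proof (rule bdd_aboveI2)
    fix n
    have "a n \<le> q (g n)" unfolding a_def using g(1) bdd by (intro cInf_lower) auto
    also have "\<dots> \<le> (\<integral>x. R\<^sup>2 \<partial>M)" unfolding q_def
    proof (intro integral_mono_AE gi2 integrable_const)
      show "AE x in M. (norm (g n x))\<^sup>2 \<le> R\<^sup>2"
        using A by eventually_elim (use gs R in \<open>auto simp: sections_def intro!: power_mono\<close>)
    qed
    finally show "a n \<le> (\<integral>x. R\<^sup>2 \<partial>M)" .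
  qed
  then obtain L where L: "a \<longlonglongrightarrow> L" "\<And>n. a n \<le> L"
    using LIMSEQ_incseq_SUP[of a] a_mono cSUP_upper[of _ UNIV a] by (metis UNIV_I incseq_def)
  \<comment> \<open>Both functions lie in \<open>C n\<close>, and so does their midpoint, whose
    square norm is at least \<open>a n\<close>. Their own square norms exceed \<open>L\<close> by at
    most \<open>1 / Suc n\<close>, and the parallelogram law combines the three estimates.\<close>
  have sq: "(\<integral>x. (norm (g i x - g j x))\<^sup>2 \<partial>M) \<le> 4 * (L - a n) + 4 / Suc n" if "n \<le> i" "n \<le> j" for i j n
  proof -
    let ?h = "\<lambda>x. (1/2) *\<^sub>R g i x + (1/2) *\<^sub>R g j x"
    have ij: "g i \<in> C n" "g j \<in> C n" using g(1) C_anti that by auto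
    then have h: "?h \<in> C n" by (rule C_mid)
    then have hs: "?h \<in> sections M A G" by (simp add: C_def)
    have "a n \<le> q ?h" unfolding a_def using h bdd by (intro cInf_lower) auto
    moreover have "(\<integral>x. (norm (g i x - g j x))\<^sup>2 \<partial>M)
        = (\<integral>x. 2 * (norm (g i x))\<^sup>2 + 2 * (norm (g j x))\<^sup>2 - 4 * (norm (?h x))\<^sup>2 \<partial>M)"
    proof (intro Bochner_Integration.integral_cong refl)
      fix x
      show "(norm (g i x - g j x))\<^sup>2 = 2 * (norm (g i x))\<^sup>2 + 2 * (norm (g j x))\<^sup>2 - 4 * (norm (?h x))\<^sup>2"
        by (simp add: power2_norm_eq_inner inner_diff_left inner_diff_right inner_add_left inner_add_right
            inner_commute field_simps)
    qed
    moreover have "\<dots> = 2 * q (g i) + 2 * q (g j) - 4 * q ?h"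
      using gi2 int(2)[OF hs] by (simp add: q_def)
    moreover define c where "c = 1 / real (Suc n)"
    moreover have "q (g k) \<le> L + c" if "n \<le> k" for k
    proof -
      have "1 / Suc k \<le> c" using that by (simp add: c_def frac_le)
      then show ?thesis using g(2)[of k] L(2)[of k] by linarith
    qed
    from this[OF that(1)] this[OF that(2)] have "2 * q (g i) + 2 * q (g j) \<le> 4 * L + 4 * c" by linarith
    ultimately have "(\<integral>x. (norm (g i x - g j x))\<^sup>2 \<partial>M) \<le> 4 * (L - a n) + 4 * c"
      by argo
    then show ?thesis by (simp add: c_def)
  qed
  have cauchy: "\<exists>N. \<forall>i\<ge>N. \<forall>j\<ge>N. (\<integral>x. norm (g i x - g j x) \<partial>M) < e" if e: "0 < e" for e
  proof -
    define m where "m = measure M (space M)"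
    have m: "0 \<le> m" by (simp add: m_def)
    \<comment> \<open>Adding one covers a measure of total mass zero and leaves the final bound at
      \<open>e / 2\<close>.\<close>
    define d where "d = e / (m + 1)"
    have d: "0 < d" using e m by (simp add: d_def)
    have "(\<lambda>n. 4 * (L - a n) + 4 / Suc n) \<longlonglongrightarrow> 4 * (L - L) + 4 * 0"
      using tendsto_mult[OF tendsto_const lim_1_over_n[THEN LIMSEQ_Suc], of 4]
      by (intro tendsto_add tendsto_mult tendsto_diff tendsto_const L(1)) simp
    then have "\<forall>\<^sub>F n in sequentially. 4 * (L - a n) + 4 / Suc n < d\<^sup>2"
      using d by (intro order_tendstoD(2)) auto
    then obtain N where N: "4 * (L - a N) + 4 / Suc N < d\<^sup>2" by (auto simp: eventually_sequentially)
    have "(\<integral>x. norm (g i x - g j x) \<partial>M) < e" if "N \<le> i" "N \<le> j" for i j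
    proof -
      have i2: "integrable M (\<lambda>x. (norm (g i x - g j x))\<^sup>2)"
      proof (rule integrable_const_bound[where B="(2 * R)\<^sup>2"])
        show "AE x in M. norm ((norm (g i x - g j x))\<^sup>2) \<le> (2 * R)\<^sup>2"
          using A
        proof eventually_elim
          case (elim x)
          have "norm (g i x - g j x) \<le> norm (g i x) + norm (g j x)" by (rule norm_triangle_ineq4)
          also have "\<dots> \<le> 2 * R" using gs[of i] gs[of j] R[OF elim, of "g i x"] R[OF elim, of "g j x"] elim
            by (auto simp: sections_def)
          finally have "(norm (g i x - g j x))\<^sup>2 \<le> (2 * R)\<^sup>2" by (rule power_mono) simp
          then show ?case by simp
        qed
      qed (use gi in auto)
      \<comment> \<open>On a finite measure the square norm controls the L1 norm; expanding
        \<open>(d - norm (g i x - g j x))\<^sup>2 \<ge> 0\<close> makes this pointwise.\<close>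
      have "(\<integral>x. norm (g i x - g j x) \<partial>M) \<le> (\<integral>x. d / 2 + (norm (g i x - g j x))\<^sup>2 / (2 * d) \<partial>M)"
      proof (intro integral_mono)
        fix x
        have "0 \<le> (d - norm (g i x - g j x))\<^sup>2" by simp
        then show "norm (g i x - g j x) \<le> d / 2 + (norm (g i x - g j x))\<^sup>2 / (2 * d)"
          using d by (simp add: power2_eq_square field_simps)
      qed (use gi i2 in auto)
      also have "\<dots> = m * (d / 2) + (\<integral>x. (norm (g i x - g j x))\<^sup>2 \<partial>M) / (2 * d)"
        using i2 by (simp add: m_def)
      also have "\<dots> \<le> m * (d / 2) + d\<^sup>2 / (2 * d)"
        using sq[OF that] N d by (intro add_left_mono divide_right_mono) auto
      also have "\<dots> = (m + 1) * d / 2" using d by (simp add: power2_eq_square field_simps)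
      also have "\<dots> < e" using e m by (simp add: d_def)
      finally show ?thesis .
    qed
    then show ?thesis by blast
  qed
  from cauchy_L1_AE_cauchy_subseq[OF gi cauchy]
  obtain r where r: "strict_mono r" "AE x in M. Cauchy (\<lambda>i. g (r i) x)" by metis
  \<comment> \<open>On the null set without a limit the value of \<open>g 0\<close> is kept, so that
    \<open>\<gamma> x\<close> lies in \<open>G x\<close> at every point of \<open>A\<close>.\<close>
  define \<gamma> where "\<gamma> = (\<lambda>x. if Cauchy (\<lambda>i. g (r i) x) then lim (\<lambda>i. g (r i) x) else g 0 x)"
  have gm: "g n \<in> borel_measurable M" for n using gs by (simp add: sections_def)
  have lim: "(\<lambda>i. g (r i) x) \<longlonglongrightarrow> \<gamma> x" if "Cauchy (\<lambda>i. g (r i) x)" for x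
    using that by (simp add: \<gamma>_def Cauchy_convergent_iff convergent_LIMSEQ_iff)
  have \<gamma>: "\<gamma> \<in> sections M A G"
    unfolding sections_def
  proof (intro CollectI conjI ballI)
    show "\<gamma> \<in> borel_measurable M"
      unfolding \<gamma>_def by (intro measurable_If borel_measurable_lim_metric gm sets_Collect_Cauchy)
    fix x assume x: "x \<in> A"
    have gx: "g n x \<in> G x" for n using gs x by (auto simp: sections_def)
    show "\<gamma> x \<in> G x"
    proof (cases "Cauchy (\<lambda>i. g (r i) x)")
      case True
      show ?thesis by (rule closed_sequentially[OF G(1)[OF x] _ lim[OF True]]) (rule gx)
    next
      case False
      then show ?thesis using gx by (simp add: \<gamma>_def)
    qed
  qed
  have "(\<lambda>i. \<integral>x. g (r i) x \<partial>M) \<longlonglongrightarrow> (\<integral>x. \<gamma> x \<partial>M)"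
  proof (rule integral_dominated_convergence[where w="\<lambda>_. R"])
    show "\<gamma> \<in> borel_measurable M" using \<gamma> by (simp add: sections_def)
    show "AE x in M. (\<lambda>i. g (r i) x) \<longlonglongrightarrow> \<gamma> x" using r(2) by eventually_elim (rule lim)
    show "AE x in M. norm (g (r i) x) \<le> R" for i
      using A by eventually_elim (use gs R in \<open>auto simp: sections_def\<close>)
  qed (use gm in auto)
  moreover have "(\<lambda>i. \<integral>x. g (r i) x \<partial>M) \<longlonglongrightarrow> p"
  proof -
    have "(\<lambda>n. (\<integral>x. g n x \<partial>M) - p) \<longlonglongrightarrow> 0"
    proof (rule Lim_null_comparison)
      show "\<forall>\<^sub>F n in sequentially. norm ((\<integral>x. g n x \<partial>M) - p) \<le> 1 / Suc n"
        using g(1) by (auto simp: C_def)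
    qed (rule lim_1_over_n[THEN LIMSEQ_Suc])
    then have "(\<lambda>n. \<integral>x. g n x \<partial>M) \<longlonglongrightarrow> p" by (simp add: LIM_zero_iff)
    from LIMSEQ_subseq_LIMSEQ[OF this r(1)] show ?thesis by (simp add: comp_def)
  qed
  ultimately have "p = (\<integral>x. \<gamma> x \<partial>M)" by (intro LIMSEQ_unique)
  with \<gamma> show "p \<in> (\<lambda>\<gamma>. \<integral>x. \<gamma> x \<partial>M) ` sections M A G" by blast
qed

end

section \<open>Fibers of a symmetric convex body\<close>

text \<open>Collects what the comparison of fiber body and lifted volume uses about the zonoid;
  probability enters only when the lifted volume is evaluated.\<close>

locale symmetric_body_projection =
  fixes b :: "nat \<Rightarrow> 'a::euclidean_space" and n :: nat and K :: "'a set"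
  assumes orthonormal: "\<And>j k. j < n \<Longrightarrow> k < n \<Longrightarrow> b j \<bullet> b k = (if j = k then 1 else 0)"
    and compact_K: "compact K" and convex_K: "convex K" and sym_K: "\<And>x. x \<in> K \<Longrightarrow> - x \<in> K"
begin

abbreviation "\<pi> \<equiv> proj b n"
abbreviation "emb \<equiv> coord_emb b n"
abbreviation "fib \<equiv> fiber b n K"
abbreviation "P \<equiv> PiM {..<n} (\<lambda>_. lborel :: real measure)"

lemma emb_inner: "k < n \<Longrightarrow> emb t \<bullet> b k = t k"
  by (simp add: coord_emb_def inner_sum_left orthonormal if_distrib[of "\<lambda>x. _ * x"] cong: if_cong)

lemma proj_eq_emb: "\<pi> x = emb (\<lambda>j. x \<bullet> b j)"
  by (simp add: proj_def coord_emb_def)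

lemma proj_inner: "k < n \<Longrightarrow> \<pi> x \<bullet> b k = x \<bullet> b k"
  by (simp add: proj_eq_emb emb_inner)

lemma proj_eq_emb_iff: "\<pi> x = emb t \<longleftrightarrow> (\<forall>k<n. x \<bullet> b k = t k)"
proof
  assume "\<pi> x = emb t"
  then show "\<forall>k<n. x \<bullet> b k = t k" by (metis proj_inner emb_inner)
qed (simp add: proj_def coord_emb_def)

lemma linear_proj: "linear \<pi>"
  unfolding proj_def
  by (intro linearI) (simp_all add: inner_left_distrib scaleR_left_distrib sum.distrib scaleR_right.sum)

lemma continuous_on_proj: "continuous_on A \<pi>"
  unfolding proj_def by (intro continuous_intros)

lemma diff_proj_in_orthW: "x - \<pi> x \<in> orthW b n"
  by (simp add: orthW_def inner_diff_left proj_inner)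

lemma orthW_inner_proj:
  assumes "y \<in> orthW b n"
  shows "y \<bullet> \<pi> x = 0" "y \<bullet> emb t = 0"
  using assms by (simp_all add: orthW_def proj_def coord_emb_def inner_sum_right)

lemma proj_orthW: "y \<in> orthW b n \<Longrightarrow> \<pi> y = 0"
  by (simp add: orthW_def proj_def)

lemma proj_idem: "\<pi> (\<pi> x) = \<pi> x"
  by (simp add: proj_def[of b n "\<pi> x"] proj_inner) (simp add: proj_def)

lemma fib_eq:
  assumes "x \<in> \<pi> ` K"
  shows "fib x = (\<lambda>z. z - x) ` {z \<in> K. \<pi> z = x}"
proof -
  have x: "\<pi> x = x" using assms proj_idem by auto
  show ?thesis
  proof (intro set_eqI iffI)
    fix y assume "y \<in> fib x"
    then have "y \<in> orthW b n" "x + y \<in> K" by (auto simp: fiber_def)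
    moreover from this x have "\<pi> (x + y) = x" by (simp add: linear_add[OF linear_proj] proj_orthW)
    ultimately show "y \<in> (\<lambda>z. z - x) ` {z \<in> K. \<pi> z = x}" by (intro image_eqI[where x="x + y"]) auto
  next
    fix y assume "y \<in> (\<lambda>z. z - x) ` {z \<in> K. \<pi> z = x}"
    then show "y \<in> fib x" using diff_proj_in_orthW by (auto simp: fiber_def)
  qed
qed

lemma fib_nonempty: "x \<in> \<pi> ` K \<Longrightarrow> fib x \<noteq> {}"
  by (auto simp: fib_eq)

lemma compact_fib: "x \<in> \<pi> ` K \<Longrightarrow> compact (fib x)"
proof -
  assume x: "x \<in> \<pi> ` K"
  have "{z \<in> K. \<pi> z = x} = K \<inter> {z. \<pi> z = x}" by auto
  moreover have "compact (K \<inter> {z. \<pi> z = x})"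
    by (intro compact_Int_closed compact_K closed_Collect_eq continuous_on_proj continuous_on_const)
  ultimately show ?thesis
    unfolding fib_eq[OF x] by (intro compact_continuous_image continuous_intros) simp
qed

lemma convex_fib: "convex (fib x)"
proof (rule convexI)
  fix y z s t assume y: "y \<in> fib x" and z: "z \<in> fib x" and st: "0 \<le> s" "0 \<le> t" "s + t = (1::real)"
  have "s *\<^sub>R (x + y) + t *\<^sub>R (x + z) \<in> K"
    using y z st by (intro convexD[OF convex_K]) (auto simp: fiber_def)
  moreover have "s *\<^sub>R (x + y) + t *\<^sub>R (x + z) = x + (s *\<^sub>R y + t *\<^sub>R z)"
    using st(3) by (simp add: scaleR_right_distrib) (metis (no_types, lifting) add.left_commute scaleR_left_distrib scaleR_one add.assoc)
  ultimately show "s *\<^sub>R y + t *\<^sub>R z \<in> fib x"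
    using y z by (auto simp: fiber_def orthW_def inner_left_distrib)
qed

text \<open>Reflection of \<open>K\<close> exchanges the fibers over opposite points instead of
  preserving each fiber. This is why \<open>\<gamma> x\<close> and \<open>\<gamma> (- x)\<close>
  occur together in the volume estimates.\<close>

lemma fib_uminus:
  assumes "y \<in> fib x"
  shows "- y \<in> fib (- x)"
proof -
  have "- y - x = - (x + y)" by simp
  with assms sym_K[of "x + y"] have "- y - x \<in> K" by (simp only: fiber_def mem_Collect_eq)
  with assms show ?thesis by (auto simp: fiber_def orthW_def)
qed

lemma proj_K_uminus: "x \<in> \<pi> ` K \<Longrightarrow> - x \<in> \<pi> ` K"
  using sym_K by (auto simp: linear_neg[OF linear_proj, symmetric])

lemma fib_bounded: obtains R where "\<And>x y. x \<in> \<pi> ` K \<Longrightarrow> y \<in> fib x \<Longrightarrow> norm y \<le> R"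
proof -
  have "compact ((\<lambda>z. z - \<pi> z) ` K)"
    by (intro compact_continuous_image compact_K continuous_intros continuous_on_proj)
  from compact_imp_bounded[OF this] obtain R where R: "\<And>z. z \<in> K \<Longrightarrow> norm (z - \<pi> z) \<le> R"
    unfolding bounded_iff by auto
  show thesis
  proof (rule that[of R])
    fix x y assume "x \<in> \<pi> ` K" "y \<in> fib x"
    then obtain z where "z \<in> K" "\<pi> z = x" "y = z - x" by (auto simp: fib_eq)
    with R show "norm y \<le> R" by blast
  qed
qed

section \<open>Borel sections that almost maximise a functional\<close>

lemma proj_K_borel: "\<pi> ` K \<in> sets borel"
  by (intro borel_compact compact_continuous_image compact_K continuous_on_proj)

text \<open>An explicit Borel selection. Taking \<open>q\<close> far out in direction
  \<open>u\<close> makes the nearest point almost maximal for \<open>u\<close>, and unlike a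
  maximiser the nearest point is unique.\<close>

definition nearest_section :: "'a \<Rightarrow> 'a \<Rightarrow> 'a" where
  "nearest_section q x = (if x \<in> \<pi> ` K then closest_point (fib x) q else 0)"

lemma nearest_section_in: "x \<in> \<pi> ` K \<Longrightarrow> nearest_section q x \<in> fib x"
  using compact_imp_closed[OF compact_fib] fib_nonempty
  by (simp add: nearest_section_def closest_point_in_set)

text \<open>The nearest point lies in a closed set \<open>C\<close> iff, for every rational radius, whenever the ball
  about \<open>q\<close> meets the fiber it also meets the fiber inside \<open>C\<close>. Both conditions on \<open>x\<close> define
  projections of compact sets.\<close>
lemma nearest_section_in_closed_iff:
  assumes x: "x \<in> \<pi> ` K" and C: "closed C"
  shows "nearest_section q x \<in> C \<longleftrightarrow>
    (\<forall>r\<in>\<rat>. (\<exists>y\<in>fib x. dist q y \<le> r) \<longrightarrow> (\<exists>y\<in>fib x \<inter> C. dist q y \<le> r))"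
proof -
  let ?y = "nearest_section q x"
  note cl = compact_imp_closed[OF compact_fib[OF x]]
  have y: "?y \<in> fib x" by (rule nearest_section_in[OF x])
  have min: "dist q ?y \<le> dist q z" if "z \<in> fib x" for z
    using closest_point_le[OF cl that] x by (simp add: nearest_section_def)
  show ?thesis
  proof
    assume "?y \<in> C"
    with y min show "\<forall>r\<in>\<rat>. (\<exists>y\<in>fib x. dist q y \<le> r) \<longrightarrow> (\<exists>y\<in>fib x \<inter> C. dist q y \<le> r)"
      by (meson IntI order_trans)
  next
    assume *: "\<forall>r\<in>\<rat>. (\<exists>y\<in>fib x. dist q y \<le> r) \<longrightarrow> (\<exists>y\<in>fib x \<inter> C. dist q y \<le> r)"
    have ex: "\<exists>y\<in>fib x \<inter> C. dist q y \<le> r" if "dist q ?y \<le> r" "r \<in> \<rat>" for r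
      using * that y by blast
    obtain r0 where "r0 \<in> \<rat>" "dist q ?y < r0" using Rats_dense_in_real[of "dist q ?y" "dist q ?y + 1"] by auto
    with ex[of r0] have "fib x \<inter> C \<noteq> {}" by auto
    then obtain z where z: "z \<in> fib x \<inter> C" "\<And>w. w \<in> fib x \<inter> C \<Longrightarrow> dist q z \<le> dist q w"
      using distance_attains_inf[of "fib x \<inter> C" q] cl C by auto
    have "dist q z \<le> dist q ?y"
    proof (rule ccontr)
      assume "\<not> dist q z \<le> dist q ?y"
      then obtain r where r: "r \<in> \<rat>" "dist q ?y < r" "r < dist q z"
        using Rats_dense_in_real[of "dist q ?y" "dist q z"] by auto
      then obtain w where "w \<in> fib x \<inter> C" "dist q w \<le> r" using ex[of r] by auto
      with z(2)[of w] r(3) show False by simp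
    qed
    then have "\<forall>w\<in>fib x. dist q z \<le> dist q w" using min order_trans by blast
    then have "z = closest_point (fib x) q"
      using z(1) by (intro closest_point_unique convex_fib cl) auto
    with z(1) x show "?y \<in> C" by (simp add: nearest_section_def)
  qed
qed

lemma borel_measurable_nearest_section: "nearest_section q \<in> borel_measurable borel"
proof -
  have closed_case: "nearest_section q -` C \<in> sets borel" if C: "closed C" for C
  proof -
    define D where "D = (\<lambda>S r. \<pi> ` (K \<inter> {z. dist q (z - \<pi> z) \<le> r} \<inter> {z. z - \<pi> z \<in> S}))"
    have D: "D S r \<in> sets borel" if "closed S" for S r
    proof -
      have "closed {z. z - \<pi> z \<in> S}"
        using continuous_closed_vimage[OF that, of "\<lambda>z. z - \<pi> z"] continuous_on_proj[of UNIV]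
        by (auto simp: vimage_def continuous_on_eq_continuous_at intro!: continuous_intros)
      then have "compact (K \<inter> {z. dist q (z - \<pi> z) \<le> r} \<inter> {z. z - \<pi> z \<in> S})"
        by (intro compact_Int_closed compact_K closed_Collect_le continuous_intros continuous_on_proj)
      then show ?thesis
        unfolding D_def by (intro borel_compact compact_continuous_image continuous_on_proj)
    qed
    have D_iff: "x \<in> D S r \<longleftrightarrow> (\<exists>y\<in>fib x \<inter> S. dist q y \<le> r)" if "x \<in> \<pi> ` K" for x S r
      unfolding D_def fib_eq[OF that] by (auto simp: image_iff)
    \<comment> \<open>Outside the projection the section has the default value 0, so the whole
      complement belongs to the preimage exactly when \<open>0 \<in> C\<close>.\<close>
    have "nearest_section q -` C = (\<pi> ` K \<inter> (\<Inter>r\<in>\<rat>. - D UNIV r \<union> D C r)) \<union> (if 0 \<in> C then - \<pi> ` K else {})"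
      (is "?L = ?R")
    proof (intro set_eqI)
      fix x show "x \<in> ?L \<longleftrightarrow> x \<in> ?R"
      proof (cases "x \<in> \<pi> ` K")
        case True
        then show ?thesis
          by (simp add: nearest_section_in_closed_iff[OF True C] D_iff[OF True]) blast
      next
        case False
        then show ?thesis by (simp add: nearest_section_def)
      qed
    qed
    moreover have "(\<Inter>r\<in>\<rat>. - D UNIV r \<union> D C r) \<in> sets borel"
      using C D by (intro sets.countable_INT' countable_rat sets.Un) (auto simp: Rats_def)
    ultimately show ?thesis using proj_K_borel by auto
  qed
  show ?thesis
  proof (rule borel_measurableI)
    fix S :: "'a set" assume "open S"
    then have "nearest_section q -` (- S) \<in> sets borel" by (intro closed_case) auto
    then have "- (nearest_section q -` (- S)) \<in> sets borel" by auto
    then show "nearest_section q -` S \<inter> space borel \<in> sets borel" by (simp add: vimage_Compl)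
  qed
qed

text \<open>In the comparison of squared distances to \<open>s *\<^sub>R u\<close> the common square
  cancels. The inner products carry the factor \<open>2 * s\<close>, while the error is at most the
  square of \<open>norm y\<close>; dividing by \<open>2 * s\<close> makes it small for large
  \<open>s\<close>.\<close>

lemma nearest_section_almost_maximal:
  assumes R: "\<And>x y. x \<in> \<pi> ` K \<Longrightarrow> y \<in> fib x \<Longrightarrow> norm y \<le> R" and s: "0 < s"
    and x: "x \<in> \<pi> ` K" and y: "y \<in> fib x"
  shows "u \<bullet> y \<le> u \<bullet> nearest_section (s *\<^sub>R u) x + R\<^sup>2 / (2 * s)"
proof -
  let ?z = "nearest_section (s *\<^sub>R u) x"
  have "dist (s *\<^sub>R u) ?z \<le> dist (s *\<^sub>R u) y"
    using closest_point_le[OF compact_imp_closed[OF compact_fib[OF x]] y] x by (simp add: nearest_section_def)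
  then have "(norm (s *\<^sub>R u - ?z))\<^sup>2 \<le> (norm (s *\<^sub>R u - y))\<^sup>2"
    by (simp add: dist_norm)
  then have "2 * s * (u \<bullet> y) \<le> 2 * s * (u \<bullet> ?z) + (norm y)\<^sup>2 - (norm ?z)\<^sup>2"
    by (simp add: power2_norm_eq_inner inner_diff_left inner_diff_right inner_commute algebra_simps)
  moreover have "(norm y)\<^sup>2 \<le> R\<^sup>2" by (intro power_mono R[OF x y]) simp
  ultimately have "2 * s * (u \<bullet> y) \<le> 2 * s * (u \<bullet> ?z) + R\<^sup>2"
    using zero_le_power2[of "norm ?z"] by linarith
  then show ?thesis using s by (simp add: field_simps)
qed

text \<open>Lebesgue measure of \<open>V\<close> restricted to the projection, but carried by the
  ambient space: sections stay functions of points, and the coordinates \<open>t\<close> appear only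
  when slices are compared.\<close>

definition fiber_measure :: "'a measure" where
  "fiber_measure = distr (density P (\<lambda>t. ennreal (indicator (\<pi> ` K) (emb t)))) borel emb"

lemma emb_measurable [measurable]: "emb \<in> measurable P borel"
proof -
  have "(\<lambda>t. t j) \<in> borel_measurable P" if "j \<in> {..<n}" for j using that by measurable
  then show ?thesis unfolding coord_emb_def by (intro borel_measurable_sum borel_measurable_scaleR) auto
qed

lemma indicator_emb_measurable [measurable]: "(\<lambda>t. indicator (\<pi> ` K) (emb t) :: real) \<in> borel_measurable P"
  using measurable_compose[OF emb_measurable borel_measurable_indicator[OF proj_K_borel]] .

lemma sets_fiber_measure [measurable_cong]: "sets fiber_measure = sets borel"
  by (simp add: fiber_measure_def)

lemma integral_fiber_measure:
  fixes g :: "'a \<Rightarrow> 'b::{banach, second_countable_topology}"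
  assumes [measurable]: "g \<in> borel_measurable borel"
  shows "(\<integral>x. g x \<partial>fiber_measure) = (\<integral>t. indicator (\<pi> ` K) (emb t) *\<^sub>R g (emb t) \<partial>P)"
proof -
  have "(\<integral>x. g x \<partial>fiber_measure) = (\<integral>t. g (emb t) \<partial>density P (\<lambda>t. ennreal (indicator (\<pi> ` K) (emb t))))"
    unfolding fiber_measure_def by (intro integral_distr) auto
  also have "\<dots> = (\<integral>t. indicator (\<pi> ` K) (emb t) *\<^sub>R g (emb t) \<partial>P)"
    by (intro integral_density) auto
  finally show ?thesis .
qed

lemma nn_integral_fiber_measure:
  assumes [measurable]: "g \<in> borel_measurable borel"
  shows "(\<integral>\<^sup>+x. g x \<partial>fiber_measure) = (\<integral>\<^sup>+t. indicator (\<pi> ` K) (emb t) * g (emb t) \<partial>P)"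
proof -
  have "(\<integral>\<^sup>+x. g x \<partial>fiber_measure) = (\<integral>\<^sup>+t. g (emb t) \<partial>density P (\<lambda>t. ennreal (indicator (\<pi> ` K) (emb t))))"
    unfolding fiber_measure_def by (intro nn_integral_distr) auto
  also have "\<dots> = (\<integral>\<^sup>+t. ennreal (indicator (\<pi> ` K) (emb t)) * g (emb t) \<partial>P)"
    by (intro nn_integral_density) auto
  finally show ?thesis by (simp add: ennreal_indicator)
qed

lemma emb_in_proj_iff: "emb t \<in> \<pi> ` K \<longleftrightarrow> t \<in> coord_image {..<n} b K"
proof -
  have "emb t \<in> \<pi> ` K \<longleftrightarrow> (\<exists>x\<in>K. \<pi> x = emb t)" by (metis image_iff)
  then show ?thesis
    by (simp add: coord_image_def proj_eq_emb_iff inner_commute Ball_def)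
qed

sublocale fiber_measure: finite_measure fiber_measure
proof
  have "emeasure fiber_measure (space fiber_measure) = (\<integral>\<^sup>+x. 1 \<partial>fiber_measure)" by simp
  also have "\<dots> = coord_volume {..<n} b K"
    by (subst nn_integral_fiber_measure)
      (auto simp: coord_volume_def indicator_def emb_in_proj_iff intro!: nn_integral_cong)
  also have "\<dots> < \<top>" by (rule coord_volume_less_top) (simp_all add: compact_K)
  finally show "emeasure fiber_measure (space fiber_measure) \<noteq> \<infinity>" by simp
qed

lemma AE_fiber_measure: "AE x in fiber_measure. x \<in> \<pi> ` K"
proof -
  have e: "emb \<in> measurable (density P (\<lambda>t. ennreal (indicator (\<pi> ` K) (emb t)))) borel" by simp
  have "{x \<in> space borel. x \<in> \<pi> ` K} \<in> sets borel" using proj_K_borel by simp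
  then show ?thesis
    unfolding fiber_measure_def by (subst AE_distr_iff[OF e]) (simp_all add: AE_density indicator_def)
qed

text \<open>Negating every coordinate preserves Lebesgue measure, and the projection of
  \<open>K\<close> is symmetric. Consequently \<open>g x\<close> and \<open>g (- x)\<close> have
  equal integrals, which yields the factor two.\<close>

lemma distr_fiber_measure_uminus: "distr fiber_measure borel uminus = fiber_measure"
proof (rule measure_eqI)
  show "sets (distr fiber_measure borel uminus) = sets fiber_measure" by (simp add: sets_fiber_measure)
  fix B assume "B \<in> sets (distr fiber_measure borel uminus)"
  then have B [measurable]: "B \<in> sets borel" by simp
  have um [measurable]: "uminus \<in> measurable fiber_measure borel" by measurable
  have "emeasure (distr fiber_measure borel uminus) B = (\<integral>\<^sup>+x. indicator B x \<partial>distr fiber_measure borel uminus)"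
    by simp
  also have "\<dots> = (\<integral>\<^sup>+x. indicator B (- x) \<partial>fiber_measure)"
    by (intro nn_integral_distr um) simp
  also have "\<dots> = (\<integral>\<^sup>+t. indicator (\<pi> ` K) (emb t) * indicator B (- emb t) \<partial>P)"
    by (intro nn_integral_fiber_measure) measurable
  also have "\<dots> = (\<integral>\<^sup>+t. indicator (\<pi> ` K) (emb (\<lambda>i\<in>{..<n}. - t i)) * indicator B (emb (\<lambda>i\<in>{..<n}. - t i)) \<partial>P)"
  proof (intro nn_integral_cong)
    fix t
    have e: "emb (\<lambda>i\<in>{..<n}. - t i) = - emb t" by (simp add: coord_emb_def sum_negf)
    have "- emb t \<in> \<pi> ` K \<longleftrightarrow> emb t \<in> \<pi> ` K" using proj_K_uminus[of "emb t"] proj_K_uminus[of "- emb t"] by auto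
    then show "indicator (\<pi> ` K) (emb t) * indicator B (- emb t)
        = (indicator (\<pi> ` K) (emb (\<lambda>i\<in>{..<n}. - t i)) * indicator B (emb (\<lambda>i\<in>{..<n}. - t i)) :: ennreal)"
      unfolding e by (simp add: indicator_def)
  qed
  also have "\<dots> = (\<integral>\<^sup>+t. indicator (\<pi> ` K) (emb t) * indicator B (emb t) \<partial>P)"
  proof (rule nn_integral_PiM_lborel_map[where T="\<lambda>_. uminus" and h="\<lambda>t. indicator (\<pi> ` K) (emb t) * indicator B (emb t)"])
    show "distr lborel lborel uminus = (lborel :: real measure)"
      using lborel_distr_uminus by (simp cong: distr_cong)
    show "(\<lambda>t. indicator (\<pi> ` K) (emb t) * indicator B (emb t) :: ennreal) \<in> borel_measurable P"
      using proj_K_borel by measurable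
  qed auto
  also have "\<dots> = (\<integral>\<^sup>+x. indicator B x \<partial>fiber_measure)"
    by (rule nn_integral_fiber_measure[symmetric]) measurable
  also have "\<dots> = emeasure fiber_measure B" by (simp add: sets_fiber_measure)
  finally show "emeasure (distr fiber_measure borel uminus) B = emeasure fiber_measure B" .
qed

lemma fiber_body_eq_section_integrals:
  "fiber_body b n K = (\<lambda>\<gamma>. \<integral>x. \<gamma> x \<partial>fiber_measure) ` sections fiber_measure (\<pi> ` K) fib"
proof -
  have m: "borel_measurable fiber_measure = borel_measurable borel"
    by (rule measurable_cong_sets[OF sets_fiber_measure refl])
  show ?thesis
    unfolding fiber_body_def sections_def m
    using integral_fiber_measure by (force simp: image_iff)
qed

section \<open>Slices of the lifted body and the support function of the fiber body\<close>

lemma coord_section_outside: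
  assumes "emb t \<notin> \<pi> ` K"
  shows "coord_section n {..<n} (b(n := u)) K t = {}"
  using assms by (auto simp: emb_in_proj_iff coord_image_def coord_section_def)

text \<open>A point of \<open>K\<close> and its component in \<open>W\<close> have the same product
  with \<open>u\<close>, since \<open>u\<close> is orthogonal to \<open>V\<close>.\<close>

lemma coord_section_eq_fib:
  assumes u: "u \<in> orthW b n" and x: "emb t \<in> \<pi> ` K"
  shows "coord_section n {..<n} (b(n := u)) K t = (\<lambda>y. u \<bullet> y) ` fib (emb t)"
proof -
  have "{z \<in> K. \<forall>j\<in>{..<n}. (b(n := u)) j \<bullet> z = t j} = {z \<in> K. \<pi> z = emb t}"
    by (auto simp: proj_eq_emb_iff inner_commute)
  then show ?thesis
    unfolding coord_section_def fib_eq[OF x] image_image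
    by (simp add: inner_diff_right orthW_inner_proj[OF u])
qed

text \<open>The volume of \<open>T K\<close> from the overview: the functionals of \<open>V\<close>
  occupy the indices below \<open>n\<close>, and \<open>u\<close> is placed at index
  \<open>n\<close>.\<close>

definition lifted_volume :: "'a \<Rightarrow> real" where
  "lifted_volume u = enn2real (coord_volume (insert n {..<n}) (b(n := u)) K)"

lemma ennreal_lifted_volume:
  "ennreal (lifted_volume u) = (\<integral>\<^sup>+t. emeasure lborel (coord_section n {..<n} (b(n := u)) K t) \<partial>P)"
proof -
  have "ennreal (lifted_volume u) = coord_volume (insert n {..<n}) (b(n := u)) K"
    unfolding lifted_volume_def
    using coord_volume_less_top[OF _ compact_K, of "insert n {..<n}" "b(n := u)"] by simp
  then show ?thesis by (simp add: coord_volume_insert compact_K)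
qed

lemma section_integrable:
  assumes "\<gamma> \<in> sections fiber_measure (\<pi> ` K) fib"
  shows "integrable fiber_measure \<gamma>"
proof -
  obtain R where R: "\<And>x y. x \<in> \<pi> ` K \<Longrightarrow> y \<in> fib x \<Longrightarrow> norm y \<le> R" using fib_bounded by blast
  show ?thesis by (rule fiber_measure.integrable_section(1)[OF AE_fiber_measure R assms])
qed

lemma integral_section_reflect:
  assumes g: "g \<in> borel_measurable borel"
  shows "(\<integral>x. g (- x) \<partial>fiber_measure) = (\<integral>x. g x \<partial>fiber_measure :: real)"
proof -
  have "(\<integral>x. g x \<partial>distr fiber_measure borel uminus) = (\<integral>x. g (- x) \<partial>fiber_measure)"
    by (intro integral_distr g) measurable
  then show ?thesis by (simp add: distr_fiber_measure_uminus)
qed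

lemma integrable_section_reflect:
  fixes g :: "'a \<Rightarrow> real"
  assumes "g \<in> borel_measurable borel" "integrable fiber_measure g"
  shows "integrable fiber_measure (\<lambda>x. g (- x))"
proof -
  have "integrable (distr fiber_measure borel uminus) g \<longleftrightarrow> integrable fiber_measure (\<lambda>x. g (- x))"
    by (intro integrable_distr_eq assms) measurable
  with assms(2) show ?thesis by (simp add: distr_fiber_measure_uminus)
qed

lemma section_borel: "\<gamma> \<in> sections fiber_measure (\<pi> ` K) fib \<Longrightarrow> \<gamma> \<in> borel_measurable borel"
  by (simp add: sections_def measurable_cong_sets[OF sets_fiber_measure refl])

text \<open>Over \<open>x\<close>, the lifted body contains the segment from \<open>- u \<bullet> \<gamma> (- x)\<close> to \<open>u \<bullet> \<gamma> x\<close>.\<close>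
lemma inner_section_integral_le:
  assumes u: "u \<in> orthW b n" and \<gamma>: "\<gamma> \<in> sections fiber_measure (\<pi> ` K) fib"
  shows "(\<integral>x. u \<bullet> \<gamma> x \<partial>fiber_measure) \<le> lifted_volume u / 2"
proof -
  let ?g = "\<lambda>x. u \<bullet> \<gamma> x"
  let ?\<phi> = "\<lambda>x. ?g x + ?g (- x)"
  have gm [measurable]: "?g \<in> borel_measurable borel" using section_borel[OF \<gamma>] by measurable
  have gi: "integrable fiber_measure ?g" using section_integrable[OF \<gamma>] by auto
  note gi' = integrable_section_reflect[OF gm gi]
  \<comment> \<open>For a badly chosen section the endpoints can come in reverse order and
    \<open>?\<phi>\<close> is negative. The estimate therefore passes through the positive part,
    which is what \<open>ennreal\<close> keeps.\<close>
  have "ennreal (\<integral>x. max 0 (?\<phi> x) \<partial>fiber_measure) = (\<integral>\<^sup>+x. ennreal (max 0 (?\<phi> x)) \<partial>fiber_measure)"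
    using gi gi' by (intro nn_integral_eq_integral[symmetric]) auto
  also have "\<dots> = (\<integral>\<^sup>+x. ennreal (?\<phi> x) \<partial>fiber_measure)" by (simp add: ennreal_max_0)
  also have "\<dots> = (\<integral>\<^sup>+t. indicator (\<pi> ` K) (emb t) * ennreal (?\<phi> (emb t)) \<partial>P)"
    by (rule nn_integral_fiber_measure) measurable
  also have "\<dots> \<le> (\<integral>\<^sup>+t. emeasure lborel (coord_section n {..<n} (b(n := u)) K t) \<partial>P)"
  proof (intro nn_integral_mono)
    fix t
    show "indicator (\<pi> ` K) (emb t) * ennreal (?\<phi> (emb t)) \<le> emeasure lborel (coord_section n {..<n} (b(n := u)) K t)"
    proof (cases "emb t \<in> \<pi> ` K")
      case True
      let ?S = "coord_section n {..<n} (b(n := u)) K t"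
      have y: "\<gamma> (emb t) \<in> fib (emb t)" "- \<gamma> (- emb t) \<in> fib (emb t)"
        using \<gamma> True proj_K_uminus[OF True] fib_uminus[of "\<gamma> (- emb t)" "- emb t"] by (auto simp: sections_def)
      have r: "?g (emb t) \<in> ?S" and l: "u \<bullet> (- \<gamma> (- emb t)) \<in> ?S"
        unfolding coord_section_eq_fib[OF u True] by (rule imageI[OF y(1)], rule imageI[OF y(2)])
      have conv: "convex ?S" and comp: "compact ?S"
        by (simp_all add: convex_coord_section compact_coord_section convex_K compact_K)
      show ?thesis
      proof (cases "- ?g (- emb t) \<le> ?g (emb t)")
        case le: True
        have "{- ?g (- emb t)..?g (emb t)} \<subseteq> ?S"
          using closed_segment_subset[OF l r conv] le by (simp add: closed_segment_eq_real_ivl)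
        then have "emeasure lborel {- ?g (- emb t)..?g (emb t)} \<le> emeasure lborel ?S"
          using comp by (intro emeasure_mono) (auto intro: borel_compact)
        then show ?thesis using True le by simp
      next
        case False
        then show ?thesis by (simp add: ennreal_neg)
      qed
    qed simp
  qed
  also have "\<dots> = ennreal (lifted_volume u)" by (rule ennreal_lifted_volume[symmetric])
  finally have "(\<integral>x. max 0 (?\<phi> x) \<partial>fiber_measure) \<le> lifted_volume u"
    by (simp add: ennreal_le_iff lifted_volume_def)
  moreover have "(\<integral>x. ?\<phi> x \<partial>fiber_measure) \<le> (\<integral>x. max 0 (?\<phi> x) \<partial>fiber_measure)"
    using gi gi' by (intro integral_mono) auto
  moreover have "(\<integral>x. ?\<phi> x \<partial>fiber_measure) = 2 * (\<integral>x. ?g x \<partial>fiber_measure)"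
    using gi gi' integral_section_reflect[OF gm] by simp
  ultimately show ?thesis by linarith
qed

text \<open>Almost maximality over \<open>x\<close> bounds the slice from above; over
  \<open>- x\<close> it bounds the slice, after reflection, from below. The slice has length at most
  \<open>?\<phi> x\<close>, and reflection invariance merges the two integrals.\<close>

lemma inner_section_integral_ge:
  assumes u: "u \<in> orthW b n" and \<gamma>: "\<gamma> \<in> sections fiber_measure (\<pi> ` K) fib"
    and max: "\<And>x y. x \<in> \<pi> ` K \<Longrightarrow> y \<in> fib x \<Longrightarrow> u \<bullet> y \<le> u \<bullet> \<gamma> x + e"
  shows "lifted_volume u / 2 - e * measure fiber_measure (space fiber_measure) \<le> (\<integral>x. u \<bullet> \<gamma> x \<partial>fiber_measure)"
proof -
  let ?g = "\<lambda>x. u \<bullet> \<gamma> x"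
  let ?\<phi> = "\<lambda>x. ?g x + ?g (- x) + 2 * e"
  have gm [measurable]: "?g \<in> borel_measurable borel" using section_borel[OF \<gamma>] by measurable
  have gi: "integrable fiber_measure ?g" using section_integrable[OF \<gamma>] by auto
  note gi' = integrable_section_reflect[OF gm gi]
  have bounds: "u \<bullet> y \<le> ?g x + e" "- (?g (- x) + e) \<le> u \<bullet> y" if "x \<in> \<pi> ` K" "y \<in> fib x" for x y
    using max[OF that] max[OF proj_K_uminus[OF that(1)] fib_uminus[OF that(2)]] by auto
  have nonneg: "0 \<le> ?\<phi> x" if "x \<in> \<pi> ` K" for x
    using fib_nonempty[OF that] bounds[OF that] by fastforce
  have "ennreal (lifted_volume u) = (\<integral>\<^sup>+t. emeasure lborel (coord_section n {..<n} (b(n := u)) K t) \<partial>P)"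
    by (rule ennreal_lifted_volume)
  also have "\<dots> \<le> (\<integral>\<^sup>+t. indicator (\<pi> ` K) (emb t) * ennreal (?\<phi> (emb t)) \<partial>P)"
  proof (intro nn_integral_mono)
    fix t
    show "emeasure lborel (coord_section n {..<n} (b(n := u)) K t) \<le> indicator (\<pi> ` K) (emb t) * ennreal (?\<phi> (emb t))"
    proof (cases "emb t \<in> \<pi> ` K")
      case True
      have "coord_section n {..<n} (b(n := u)) K t \<subseteq> {- (?g (- emb t) + e)..?g (emb t) + e}"
        unfolding coord_section_eq_fib[OF u True] using bounds[OF True] by auto
      then have "emeasure lborel (coord_section n {..<n} (b(n := u)) K t)
          \<le> emeasure lborel {- (?g (- emb t) + e)..?g (emb t) + e}"
        by (intro emeasure_mono) auto
      also have "\<dots> = ennreal (?\<phi> (emb t))" using nonneg[OF True] by (subst emeasure_lborel_Icc) (auto simp: algebra_simps)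
      finally show ?thesis using True by simp
    qed (simp add: coord_section_outside)
  qed
  also have "\<dots> = (\<integral>\<^sup>+x. ennreal (?\<phi> x) \<partial>fiber_measure)"
    by (rule nn_integral_fiber_measure[symmetric]) measurable
  also have "\<dots> = ennreal (\<integral>x. ?\<phi> x \<partial>fiber_measure)"
  proof (rule nn_integral_eq_integral)
    show "integrable fiber_measure ?\<phi>" using gi gi' by auto
    show "AE x in fiber_measure. 0 \<le> ?\<phi> x" using AE_fiber_measure by eventually_elim (rule nonneg)
  qed
  also have "(\<integral>x. ?\<phi> x \<partial>fiber_measure)
      = 2 * (\<integral>x. ?g x \<partial>fiber_measure) + 2 * (e * measure fiber_measure (space fiber_measure))"
    using gi gi' integral_section_reflect[OF gm] by simp
  finally have le: "ennreal (lifted_volume u)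
      \<le> ennreal (2 * (\<integral>x. ?g x \<partial>fiber_measure) + 2 * (e * measure fiber_measure (space fiber_measure)))" .
  \<comment> \<open>Comparison under \<open>ennreal\<close> reflects back to the reals only if the
    right side is not truncated.\<close>
  moreover have "0 \<le> 2 * (\<integral>x. ?g x \<partial>fiber_measure) + 2 * (e * measure fiber_measure (space fiber_measure))"
  proof -
    have "0 \<le> (\<integral>x. ?\<phi> x \<partial>fiber_measure)"
    proof (rule integral_nonneg_AE)
      show "AE x in fiber_measure. 0 \<le> ?\<phi> x" using AE_fiber_measure by eventually_elim (rule nonneg)
    qed
    then show ?thesis using gi gi' integral_section_reflect[OF gm] by (simp add: mult_ac)
  qed
  ultimately have "lifted_volume u \<le> 2 * (\<integral>x. ?g x \<partial>fiber_measure) + 2 * (e * measure fiber_measure (space fiber_measure))"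
    by (simp add: ennreal_le_iff)
  then show ?thesis by linarith
qed

lemma exists_almost_maximal_section:
  assumes u: "u \<in> orthW b n" and d: "0 < d"
  shows "\<exists>\<gamma>\<in>sections fiber_measure (\<pi> ` K) fib. lifted_volume u / 2 - d \<le> (\<integral>x. u \<bullet> \<gamma> x \<partial>fiber_measure)"
proof -
  obtain R where R: "\<And>x y. x \<in> \<pi> ` K \<Longrightarrow> y \<in> fib x \<Longrightarrow> norm y \<le> R" using fib_bounded by blast
  define m where "m = measure fiber_measure (space fiber_measure)"
  have m: "0 \<le> m" by (simp add: m_def)
  \<comment> \<open>Chosen so that the error \<open>R\<^sup>2 / (2 * s) * m\<close> is at most
    \<open>d\<close>; the added ones keep \<open>s\<close> positive when \<open>R\<close> or
    \<open>m\<close> is zero.\<close>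
  define s where "s = (R\<^sup>2 + 1) * (m + 1) / (2 * d)"
  have s: "0 < s" using d m by (auto simp: s_def intro!: divide_pos_pos mult_pos_pos add_nonneg_pos)
  let ?\<gamma> = "nearest_section (s *\<^sub>R u)"
  have \<gamma>: "?\<gamma> \<in> sections fiber_measure (\<pi> ` K) fib"
    by (simp add: sections_def nearest_section_in borel_measurable_nearest_section
        measurable_cong_sets[OF sets_fiber_measure refl])
  have "lifted_volume u / 2 - R\<^sup>2 / (2 * s) * m \<le> (\<integral>x. u \<bullet> ?\<gamma> x \<partial>fiber_measure)"
    unfolding m_def by (rule inner_section_integral_ge[OF u \<gamma> nearest_section_almost_maximal[OF R s]])
  moreover have "R\<^sup>2 / (2 * s) * m \<le> d"
  proof -
    have "R\<^sup>2 * m \<le> (R\<^sup>2 + 1) * (m + 1)" using m by (intro mult_mono) auto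
    also have "\<dots> = 2 * s * d" using d by (simp add: s_def)
    finally show ?thesis using s by (simp add: field_simps)
  qed
  ultimately have "lifted_volume u / 2 - d \<le> (\<integral>x. u \<bullet> ?\<gamma> x \<partial>fiber_measure)" by linarith
  with \<gamma> show ?thesis by blast
qed

text \<open>Sections take values in \<open>W\<close> over the projection, so a direction
  \<open>u\<close> acts only through its component \<open>u - \<pi> u\<close>. This extends the
  description by \<open>W\<close> to all directions of the ambient space.\<close>

theorem fiber_body_eq_support_body:
  "fiber_body b n K = support_body (\<lambda>u. lifted_volume (u - \<pi> u) / 2)"
  unfolding fiber_body_eq_section_integrals
proof (rule eq_support_body)
  obtain R where R: "\<And>x y. x \<in> \<pi> ` K \<Longrightarrow> y \<in> fib x \<Longrightarrow> norm y \<le> R" using fib_bounded by blast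
  show "closed ((\<lambda>\<gamma>. \<integral>x. \<gamma> x \<partial>fiber_measure) ` sections fiber_measure (\<pi> ` K) fib)"
    by (rule fiber_measure.closed_section_integrals[OF AE_fiber_measure compact_imp_closed[OF compact_fib] convex_fib R])
  show "convex ((\<lambda>\<gamma>. \<integral>x. \<gamma> x \<partial>fiber_measure) ` sections fiber_measure (\<pi> ` K) fib)"
    by (rule fiber_measure.convex_section_integrals[OF AE_fiber_measure convex_fib R])
  have inner: "(\<integral>x. \<gamma> x \<partial>fiber_measure) \<bullet> u = (\<integral>x. (u - \<pi> u) \<bullet> \<gamma> x \<partial>fiber_measure)"
    if \<gamma>: "\<gamma> \<in> sections fiber_measure (\<pi> ` K) fib" for \<gamma> u
  proof -
    have "(\<integral>x. \<gamma> x \<partial>fiber_measure) \<bullet> u = (\<integral>x. \<gamma> x \<bullet> u \<partial>fiber_measure)"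
      using section_integrable[OF \<gamma>] by simp
    also have "\<dots> = (\<integral>x. (u - \<pi> u) \<bullet> \<gamma> x \<partial>fiber_measure)"
    proof (rule integral_cong_AE)
      show "AE x in fiber_measure. \<gamma> x \<bullet> u = (u - \<pi> u) \<bullet> \<gamma> x"
        using AE_fiber_measure
      proof eventually_elim
        case (elim x)
        then have "\<gamma> x \<in> orthW b n" using \<gamma> by (auto simp: sections_def fiber_def)
        then show ?case using orthW_inner_proj(1)[of "\<gamma> x" u] by (simp add: inner_diff_left inner_commute[of "\<gamma> x"])
      qed
    qed (use section_integrable[OF \<gamma>] in auto)
    finally show ?thesis .
  qed
  show "a \<bullet> u \<le> lifted_volume (u - \<pi> u) / 2"
    if "a \<in> (\<lambda>\<gamma>. \<integral>x. \<gamma> x \<partial>fiber_measure) ` sections fiber_measure (\<pi> ` K) fib" for a u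
    using that inner inner_section_integral_le[OF diff_proj_in_orthW] by auto
  show "\<exists>a\<in>(\<lambda>\<gamma>. \<integral>x. \<gamma> x \<partial>fiber_measure) ` sections fiber_measure (\<pi> ` K) fib.
      lifted_volume (u - \<pi> u) / 2 - e \<le> a \<bullet> u" if "0 < e" for u e
    using exists_almost_maximal_section[OF diff_proj_in_orthW that, of u] inner by auto
qed

end

section \<open>The fiber body of a zonoid\<close>

text \<open>Laplace expansion along the row of products with \<open>u\<close>: the minors are the
  wedges of \<open>Fpi\<close>. Projections disappear because \<open>b\<close> is orthonormal and
  \<open>u\<close> is orthogonal to its span.\<close>

lemma inner_Fpi:
  assumes u: "\<And>j. j < n \<Longrightarrow> u \<bullet> b j = 0"
    and b: "\<And>j k. j < n \<Longrightarrow> k < n \<Longrightarrow> b j \<bullet> b k = (if j = k then 1 else 0)"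
  shows "u \<bullet> Fpi b n xs = detI {..<Suc n} (\<lambda>i j. (b(n := u)) i \<bullet> xs j) / fact (Suc n)"
proof -
  have proj: "proj b n x \<bullet> b j = b j \<bullet> x" if "j < n" for j x
    using that
    by (simp add: proj_def inner_sum_left b if_distrib[of "\<lambda>x. _ * x"] inner_commute[of x] cong: if_cong)
  have u_proj: "u \<bullet> proj b n x = 0" for x
    by (simp add: proj_def inner_sum_right u)
  have "wedge b n (\<lambda>l. xs (if l < k then l else Suc l))
      = det_nat n (\<lambda>i l. (b(n := u)) i \<bullet> xs (if l < k then l else Suc l))" for k
    unfolding wedge_def det_nat_eq_detI by (intro detI_cong) (auto simp: proj)
  then show ?thesis
    by (simp add: Fpi_def detI_laplace_last_row inner_sum_right inner_diff_right u_proj mult_ac)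
qed

text \<open>The Vitale zonoid depends only on the law, so the volume formula, proved for the
  identity under a Borel law, applies to \<open>X\<close>.\<close>

lemma K0_distr:
  assumes X: "X \<in> borel_measurable M"
  shows "K0 (distr M borel X) (\<lambda>v. v) = K0 M X"
proof -
  have "(\<integral>v. \<bar>u \<bullet> v\<bar> \<partial>distr M borel X) = (\<integral>\<omega>. \<bar>u \<bullet> X \<omega>\<bar> \<partial>M)" for u
    by (rule integral_distr[OF X]) simp
  then show ?thesis by (simp add: K0_def)
qed

lemma K0_uminus: "x \<in> K0 M X \<Longrightarrow> - x \<in> K0 M X"
proof -
  assume x: "x \<in> K0 M X"
  have "- x \<bullet> u \<le> (1/2) * integral\<^sup>L M (\<lambda>\<omega>. \<bar>u \<bullet> X \<omega>\<bar>)" for u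
  proof -
    have "x \<bullet> - u \<le> (1/2) * integral\<^sup>L M (\<lambda>\<omega>. \<bar>- u \<bullet> X \<omega>\<bar>)"
      using x unfolding K0_def by blast
    then show ?thesis by simp
  qed
  then show "- x \<in> K0 M X" by (simp add: K0_def)
qed

lemma compact_K0:
  fixes X :: "'s \<Rightarrow> 'a::euclidean_space"
  assumes X: "X \<in> borel_measurable M" and int: "integrable M (\<lambda>\<omega>. norm (X \<omega>))"
  shows "compact (K0 M X)"
  unfolding K0_eq_support_body
proof (rule compact_support_body)
  fix u
  have iX: "integrable M X" using int X by (simp add: integrable_norm_iff)
  have "(\<integral>\<omega>. \<bar>u \<bullet> X \<omega>\<bar> \<partial>M) \<le> (\<integral>\<omega>. norm u * norm (X \<omega>) \<partial>M)"
    using iX int by (intro integral_mono Cauchy_Schwarz_ineq2) auto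
  then show "(1/2) * (\<integral>\<omega>. \<bar>u \<bullet> X \<omega>\<bar> \<partial>M) \<le> (1/2) * (\<integral>\<omega>. norm (X \<omega>) \<partial>M) * norm u"
    by (simp add: mult.commute)
qed

text \<open>Independence makes the joint law a product. The determinant reads only coordinates in
  the index set, so restricting the joint map to that set does not change it.\<close>

lemma expectation_detI_iid:
  fixes f :: "nat \<Rightarrow> 'a::euclidean_space"
  assumes "prob_space M" and X: "\<And>i. i \<le> n \<Longrightarrow> Xs i \<in> borel_measurable M"
    and indep: "prob_space.indep_vars M (\<lambda>_. borel) Xs {..n}"
    and iid: "\<And>i. i \<le> n \<Longrightarrow> distr M borel (Xs i) = \<mu>"
  shows "(\<integral>\<omega>. \<bar>detI {..<Suc n} (\<lambda>i j. f i \<bullet> Xs j \<omega>)\<bar> \<partial>M)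
    = (\<integral>v. \<bar>detI {..<Suc n} (\<lambda>i j. f i \<bullet> v j)\<bar> \<partial>PiM {..<Suc n} (\<lambda>_. \<mu>))"
proof -
  interpret prob_space M by fact
  let ?I = "{..<Suc n}"
  have sets: "sets \<mu> = sets borel" using iid[of 0] by (metis le0 sets_distr)
  have I: "?I = {..n}" by auto
  have "distr M (PiM ?I (\<lambda>_. borel)) (\<lambda>\<omega>. \<lambda>i\<in>?I. Xs i \<omega>) = PiM ?I (\<lambda>i. distr M borel (Xs i))"
    using indep X unfolding I by (subst (asm) indep_vars_iff_distr_eq_PiM') auto
  also have "\<dots> = PiM ?I (\<lambda>_. \<mu>)" by (intro PiM_cong) (auto simp: iid)
  finally have D: "distr M (PiM ?I (\<lambda>_. borel)) (\<lambda>\<omega>. \<lambda>i\<in>?I. Xs i \<omega>) = PiM ?I (\<lambda>_. \<mu>)" .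
  have "(\<integral>v. \<bar>detI ?I (\<lambda>i j. f i \<bullet> v j)\<bar> \<partial>PiM ?I (\<lambda>_. \<mu>))
      = (\<integral>\<omega>. \<bar>detI ?I (\<lambda>i j. f i \<bullet> (\<lambda>i\<in>?I. Xs i \<omega>) j)\<bar> \<partial>M)"
    unfolding D[symmetric]
  proof (rule integral_distr)
    show "(\<lambda>\<omega>. \<lambda>i\<in>?I. Xs i \<omega>) \<in> measurable M (PiM ?I (\<lambda>_. borel))"
      by (intro measurable_restrict X) auto
    show "(\<lambda>v. \<bar>detI ?I (\<lambda>i j. f i \<bullet> v j)\<bar>) \<in> borel_measurable (PiM ?I (\<lambda>_. borel))"
      by (intro borel_measurable_abs borel_measurable_detI_inner[where s="\<lambda>v. v"]) auto
  qed
  also have "\<dots> = (\<integral>\<omega>. \<bar>detI ?I (\<lambda>i j. f i \<bullet> Xs j \<omega>)\<bar> \<partial>M)"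
    by (intro Bochner_Integration.integral_cong refl arg_cong[where f=abs] detI_cong) auto
  finally show ?thesis by simp
qed

theorem mainTheorem14:
  fixes M :: "'s measure" and X :: "'s \<Rightarrow> 'a::euclidean_space"
    and Xs :: "nat \<Rightarrow> 's \<Rightarrow> 'a" and b :: "nat \<Rightarrow> 'a" and n :: nat
  assumes "prob_space M"
    and "X \<in> borel_measurable M"
    and "integrable M (\<lambda>\<omega>. norm (X \<omega>))"
    and "\<And>i. i \<le> n \<Longrightarrow> Xs i \<in> borel_measurable M"
    and "prob_space.indep_vars M (\<lambda>_. borel) Xs {..n}"
    and "\<And>i. i \<le> n \<Longrightarrow> distr M borel (Xs i) = distr M borel X"
    and "\<And>j k. j < n \<Longrightarrow> k < n \<Longrightarrow> b j \<bullet> b k = (if j = k then 1 else 0)"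
  shows "fiber_body b n (K0 M X) = K0 M (\<lambda>\<omega>. Fpi b n (\<lambda>i. Xs i \<omega>))"
proof -
  note X = assms(2) and b = assms(7)
  let ?\<mu> = "distr M borel X"
  interpret prob_space M by fact
  interpret symmetric_body_projection b n "K0 M X"
  proof
    show "b j \<bullet> b k = (if j = k then 1 else 0)" if "j < n" "k < n" for j k
      using that by (rule b)
    show "convex (K0 M X)" unfolding K0_eq_support_body by (rule convex_support_body)
  qed (auto intro: compact_K0 X assms(3) K0_uminus)
  have int: "integrable ?\<mu> (\<lambda>v. v)"
    using assms(3) X by (simp add: integrable_distr_eq integrable_norm_iff)
  have "lifted_volume (u - proj b n u) / 2 = (1/2) * (\<integral>\<omega>. \<bar>u \<bullet> Fpi b n (\<lambda>i. Xs i \<omega>)\<bar> \<partial>M)" for u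
  proof -
    define w where "w = u - proj b n u"
    have w: "w \<bullet> b j = 0" if "j < n" for j
      using diff_proj_in_orthW[of u] that by (simp add: w_def orthW_def)
    \<comment> \<open>\<open>K0\<close> tests all directions of the ambient space; since
      \<open>Fpi\<close> takes values in \<open>W\<close>, only the component \<open>w\<close> of
      \<open>u\<close> contributes on this side as well.\<close>
    have Fpi_W: "proj b n u \<bullet> Fpi b n xs = 0" for xs
    proof -
      have "proj b n u \<bullet> (z - proj b n z) = 0" for z
        using orthW_inner_proj(1)[OF diff_proj_in_orthW, of z u] by (simp add: inner_commute)
      then show ?thesis by (simp add: Fpi_def inner_sum_right)
    qed
    have Suc: "insert n {..<n} = {..<Suc n}" by auto
    have "coord_volume {..<Suc n} (b(n := w)) (K0 M X)
        = ennreal ((\<integral>v. \<bar>detI {..<Suc n} (\<lambda>i j. (b(n := w)) i \<bullet> v j)\<bar> \<partial>PiM {..<Suc n} (\<lambda>_. ?\<mu>)) / fact (Suc n))"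
      using coord_volume_zonoid[OF prob_space_distr[OF X] _ _ int, of "{..<Suc n}" "b(n := w)"]
      by (simp add: K0_distr[OF X])
    then have "lifted_volume w
        = (\<integral>v. \<bar>detI {..<Suc n} (\<lambda>i j. (b(n := w)) i \<bullet> v j)\<bar> \<partial>PiM {..<Suc n} (\<lambda>_. ?\<mu>)) / fact (Suc n)"
      unfolding lifted_volume_def Suc by (simp del: fact_Suc)
    also have "\<dots> = (\<integral>\<omega>. \<bar>detI {..<Suc n} (\<lambda>i j. (b(n := w)) i \<bullet> Xs j \<omega>)\<bar> \<partial>M) / fact (Suc n)"
      by (subst expectation_detI_iid[OF assms(1,4-6)]) auto
    \<comment> \<open>The factorial from the volume formula is exactly the normalisation in
      \<open>Fpi\<close>.\<close>
    also have "\<dots> = (\<integral>\<omega>. \<bar>w \<bullet> Fpi b n (\<lambda>i. Xs i \<omega>)\<bar> \<partial>M)"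
      by (simp add: inner_Fpi[OF w b] del: fact_Suc)
    also have "\<dots> = (\<integral>\<omega>. \<bar>u \<bullet> Fpi b n (\<lambda>i. Xs i \<omega>)\<bar> \<partial>M)"
      by (simp add: w_def inner_diff_left Fpi_W)
    finally show ?thesis by (simp add: w_def)
  qed
  then show ?thesis
    by (simp only: fiber_body_eq_support_body K0_eq_support_body[of M "\<lambda>\<omega>. Fpi b n (\<lambda>i. Xs i \<omega>)"])
qed

end
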